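(* Let $g\ge2$ and let $M_{g-1}\supseteq M_{g-2}$ be the first step of a polarised flag type quotient (PFTQ) of genus $g$. Writing $M_{g-2}=\langle\underline{\alpha_1}e_1+\dots+\underline{\alpha_g}e_g,\,FM_{g-1},\,VM_{g-1}\rangle$ with $[\alpha_1:\dots:\alpha_g]\in\mathbb P^{g-1}$, the fiber of the truncation morphism $\mathcal V_{g-2}\to\mathcal V_{g-1}$ is described as follows. (i) For odd $g$, the fiber is given by the following equations in $\mathbb P^{g-1}$: $$\sum_{i=1}^g\alpha_i^{p^{g-2j}+1}=0\quad\text{for all }j\in\{1,\dots,\lfloor g/2\rfloor\}.$$ (ii) For even $g$, the fiber is given by the following equations in $\mathbb P^{g-1}$: $$\sum_{\substack{i=1\\ i\text{ odd}}}^g\left(\alpha_i\alpha_{i+1}^{p^{g-2j}}-\alpha_{i+1}\alpha_i^{p^{g-2j}}\right)=0\quad\text{for all }j\in\{1,\dots,\tfrac g2\}.$$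
   Context: $k$ is an algebraically closed field of characteristic $p$, $W(k)$ its ring of Witt vectors with Frobenius $\sigma$, $\underline a$ the Teichmüller lift of $a\in k$. A Dieudonné module is a left module over the ring $\mathcal D_k$ generated over $W(k)$ by $F,V$ with $Fw=\sigma(w)F$, $wV=V\sigma(w)$ for $w\in W(k)$, $FV=VF=p$. Here all are free of finite rank over $W(k)$; the genus is half the rank. $A_{1,1}=\mathcal D_k/\mathcal D_k(F-V)$. A quasi-polarised Dieudonné module is a Dieudonné module $M$ with a non-degenerate alternating $W(k)$-bilinear form $\langle\cdot,\cdot\rangle:M\times M\to\mathrm{Frac}(W(k))$ with $\langle Fx,y\rangle=\sigma(\langle x,Vy\rangle)$; its dual is $M^t=\{x\in M\otimes\mathrm{Frac}(W(k)):\langle x,M\rangle\subseteq W(k)\}$. A PFTQ of Dieudonné modules of genus $g$ over $W(k)$ is a filtration $M_{g-1}\supseteq\dots\supseteq M_0$ of quasi-polarised supersingular Dieudonné modules of genus $g$ (forms by restriction) such that (i) $M_{g-1}\cong A_{1,1}^{\oplus g}$ and $M_{g-1}^t=F^{g-1}M_{g-1}$; (ii) $(F,V)M_i\subseteq M_{i-1}$ and $\dim_k(M_i/M_{i-1})=i$ for $1\le i\le g-1$; (iii) $F^{i-j}V^jM_i\subseteq M_i^t$ for all $0\le j\le\lfloor i/2\rfloor$. An $m$-truncated PFTQ is the same data restricted to indices $m\le i\le g-1$. $\mathcal V_m$ is the moduli space over $k$ of $m$-truncated PFTQs of $g$-dimensional supersingular abelian varieties with respect to a fixed polarisation of the top step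 with kernel $\ker F^{g-1}$; its $k$-points correspond via Dieudonné theory to $m$-truncated PFTQs of Dieudonné modules. The truncation morphism $\mathcal V_{g-2}\to\mathcal V_{g-1}$ forgets $M_{g-2}$; $\mathcal V_{g-1}$ is one point. "The fiber is given by equations in $\mathbb P^{g-1}$" means, on $k$-points: $[\alpha_1:\dots:\alpha_g]\mapsto M_{g-2}$ is a bijection from the set of points of $\mathbb P^{g-1}(k)$ satisfying the equations to the set of $M_{g-2}$ such that $M_{g-1}\supseteq M_{g-2}$ is a $(g-2)$-truncated PFTQ. $e_1,f_1,\dots,e_g,f_g$ is a normal-form $W(k)$-basis of $M_{g-1}$: for $g$ odd, $Fe_i=f_i$, $Ve_i=-f_i$, $Ff_i=-pe_i$, $Vf_i=pe_i$, the only nonzero pairings of basis vectors being $\langle e_i,f_i\rangle=-\langle f_i,e_i\rangle=p^{-(g-1)/2}$; for $g$ even, $Fe_i=Ve_i=f_i$, $Ff_i=Vf_i=pe_i$, the only nonzero pairings being, for $i$ odd, $\langle e_i,e_{i+1}\rangle=-\langle e_{i+1},e_i\rangle=p^{-g/2}$ and $\langle f_i,f_{i+1}\rangle=-\langle f_{i+1},f_i\rangle=p^{-g/2+1}$. $\langle v,FM_{g-1},VM_{g-1}\rangle$ denotes the $W(k)$-span. *)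

theory Defs
  imports
    "HOL-Library.Poly_Mapping"
    "HOL-Computational_Algebra.Computational_Algebra"
begin

section \<open>Sums over finitely supported functions\<close>

definition psum :: "('i \<Rightarrow> 'c::zero \<Rightarrow> 'b::comm_monoid_add) \<Rightarrow> ('i \<Rightarrow>\<^sub>0 'c) \<Rightarrow> 'b" where
  "psum t x = (\<Sum>k\<in>Poly_Mapping.keys x. t k (Poly_Mapping.lookup x k))"

lemma psum_superset:
  assumes "finite A" "Poly_Mapping.keys x \<subseteq> A" "\<And>k. t k 0 = 0"
  shows "psum t x = (\<Sum>k\<in>A. t k (Poly_Mapping.lookup x k))"
  unfolding psum_def
  by (rule sum.mono_neutral_left) (use assms in \<open>auto simp: in_keys_iff\<close>)

lemma psum_add:
  assumes "\<And>k. t k 0 = 0" "\<And>k a b. t k (a + b) = t k a + t k b"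
  shows "psum t (x + y) = psum t x + psum t y"
proof -
  let ?A = "Poly_Mapping.keys x \<union> Poly_Mapping.keys y"
  have "psum t (x + y) = (\<Sum>k\<in>?A. t k (Poly_Mapping.lookup (x + y) k))"
    by (rule psum_superset) (use assms Poly_Mapping.keys_add[of x y] in auto)
  also have "\<dots> = (\<Sum>k\<in>?A. t k (Poly_Mapping.lookup x k)) + (\<Sum>k\<in>?A. t k (Poly_Mapping.lookup y k))"
    by (simp add: lookup_add assms sum.distrib)
  also have "\<dots> = psum t x + psum t y"
    by (subst (1 2) psum_superset[where A = ?A]) (use assms in auto)
  finally show ?thesis .
qed

lemma psum_zero [simp]: "psum t 0 = 0"
  by (simp add: psum_def)

lemma psum_single: "t k 0 = 0 \<Longrightarrow> psum t (Poly_Mapping.single k c) = t k c"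
  by (cases "c = 0") (auto simp: psum_def)

lemma poly_mapping_single_induct [case_names zero single_add]:
  fixes x :: "'i \<Rightarrow>\<^sub>0 'c::comm_monoid_add"
  assumes "P 0" "\<And>k c x. P x \<Longrightarrow> P (Poly_Mapping.single k c + x)"
  shows "P x"
proof (induction x rule: update_induct)
  case const
  show ?case by fact
next
  case (update f a b)
  have "Poly_Mapping.update a b f = Poly_Mapping.single a b + f"
    by (rule poly_mapping_eqI)
       (use update(1) in \<open>auto simp: lookup_update lookup_add lookup_single in_keys_iff when_def\<close>)
  then show ?case using assms(2)[OF update(3)] by simp
qed

section \<open>Integer polynomials and their evaluation\<close>

type_synonym zpoly = "(nat \<Rightarrow>\<^sub>0 nat) \<Rightarrow>\<^sub>0 int"

definition Var :: "nat \<Rightarrow> zpoly" where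
  "Var i = Poly_Mapping.single (Poly_Mapping.single i 1) 1"

lemma Var_power: "Poly_Mapping.single (Poly_Mapping.single i n) 1 = Var i ^ n"
proof (induction n)
  case (Suc n)
  have "Poly_Mapping.single i (Suc n) = Poly_Mapping.single i 1 + Poly_Mapping.single i n"
    by (simp flip: Poly_Mapping.single_add)
  hence "Poly_Mapping.single (Poly_Mapping.single i (Suc n)) (1::int) =
      Var i * Poly_Mapping.single (Poly_Mapping.single i n) 1"
    by (simp only: Var_def mult_single mult_1)
  thus ?case using Suc by simp
qed simp

definition monom_eval :: "(nat \<Rightarrow> 'a::comm_ring_1) \<Rightarrow> (nat \<Rightarrow>\<^sub>0 nat) \<Rightarrow> 'a" where
  "monom_eval \<rho> m = (\<Prod>i\<in>Poly_Mapping.keys m. \<rho> i ^ Poly_Mapping.lookup m i)"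

definition peval :: "(nat \<Rightarrow> 'a::comm_ring_1) \<Rightarrow> zpoly \<Rightarrow> 'a" where
  "peval \<rho> f = psum (\<lambda>m c. of_int c * monom_eval \<rho> m) f"

lemma monom_eval_superset:
  assumes "finite A" "Poly_Mapping.keys m \<subseteq> A"
  shows "monom_eval \<rho> m = (\<Prod>i\<in>A. \<rho> i ^ Poly_Mapping.lookup m i)"
  unfolding monom_eval_def
  by (rule prod.mono_neutral_left) (use assms in \<open>auto simp: in_keys_iff\<close>)

lemma monom_eval_0 [simp]: "monom_eval \<rho> 0 = 1"
  by (simp add: monom_eval_def)

lemma monom_eval_add: "monom_eval \<rho> (m + m') = monom_eval \<rho> m * monom_eval \<rho> m'"
proof -
  let ?A = "Poly_Mapping.keys m \<union> Poly_Mapping.keys m'"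
  have "monom_eval \<rho> (m + m') = (\<Prod>i\<in>?A. \<rho> i ^ Poly_Mapping.lookup (m + m') i)"
    by (rule monom_eval_superset) (use Poly_Mapping.keys_add[of m m'] in auto)
  also have "\<dots> = (\<Prod>i\<in>?A. \<rho> i ^ Poly_Mapping.lookup m i) * (\<Prod>i\<in>?A. \<rho> i ^ Poly_Mapping.lookup m' i)"
    by (simp add: lookup_add power_add prod.distrib)
  also have "\<dots> = monom_eval \<rho> m * monom_eval \<rho> m'"
    by (subst (1 2) monom_eval_superset[where A = ?A]) auto
  finally show ?thesis .
qed

lemma monom_eval_single [simp]: "monom_eval \<rho> (Poly_Mapping.single i n) = \<rho> i ^ n"
  by (cases "n = 0") (auto simp: monom_eval_def)

lemma peval_zero [simp]: "peval \<rho> 0 = 0"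
  by (simp add: peval_def)

lemma peval_add: "peval \<rho> (f + g) = peval \<rho> f + peval \<rho> g"
  unfolding peval_def by (rule psum_add) (auto simp: algebra_simps)

lemma peval_single: "peval \<rho> (Poly_Mapping.single m c) = of_int c * monom_eval \<rho> m"
  unfolding peval_def by (rule psum_single) auto

lemma peval_Var [simp]: "peval \<rho> (Var i) = \<rho> i"
  by (simp add: Var_def peval_single)

lemma peval_one [simp]: "peval \<rho> 1 = 1"
  by (simp add: peval_single flip: single_one)

lemma peval_single_mult: "peval \<rho> (Poly_Mapping.single m c * g) = peval \<rho> (Poly_Mapping.single m c) * peval \<rho> g"
proof (induction g rule: poly_mapping_single_induct)
  case (single_add k d x)
  then show ?case
    by (simp add: distrib_left peval_add mult_single peval_single monom_eval_add algebra_simps)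
qed auto

lemma peval_mult: "peval \<rho> (f * g) = peval \<rho> f * peval \<rho> g"
proof (induction f rule: poly_mapping_single_induct)
  case (single_add k d x)
  then show ?case
    by (simp add: distrib_right peval_add peval_single_mult)
qed auto

definition is_ring_hom :: "('a::comm_ring_1 \<Rightarrow> 'b::comm_ring_1) \<Rightarrow> bool" where
  "is_ring_hom h \<longleftrightarrow> h 1 = 1 \<and> (\<forall>x y. h (x + y) = h x + h y) \<and> (\<forall>x y. h (x * y) = h x * h y)"

lemma is_ring_hom_peval: "is_ring_hom (peval \<rho>)"
  by (simp add: is_ring_hom_def peval_add peval_mult)

context
  fixes h :: "'a::comm_ring_1 \<Rightarrow> 'b::comm_ring_1"
  assumes h: "is_ring_hom h"
begin

lemma hom_1: "h 1 = 1" using h by (simp add: is_ring_hom_def)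
lemma hom_add: "h (x + y) = h x + h y" using h by (simp add: is_ring_hom_def)
lemma hom_mult: "h (x * y) = h x * h y" using h by (simp add: is_ring_hom_def)
lemma hom_0: "h 0 = 0" using hom_add[of 0 0] by simp
lemma hom_minus: "h (- x) = - h x"
  using hom_add[of x "- x"] by (simp add: hom_0 eq_neg_iff_add_eq_0 add.commute)
lemma hom_diff: "h (x - y) = h x - h y" using hom_add[of x "- y"] by (simp add: hom_minus)
lemma hom_power: "h (x ^ n) = h x ^ n" by (induction n) (simp_all add: hom_1 hom_mult)
lemma hom_sum: "h (sum g A) = (\<Sum>i\<in>A. h (g i))"
  by (induction A rule: infinite_finite_induct) (simp_all add: hom_0 hom_add)
lemma hom_prod: "h (prod g A) = (\<Prod>i\<in>A. h (g i))"
  by (induction A rule: infinite_finite_induct) (simp_all add: hom_1 hom_mult)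
lemma hom_of_nat: "h (of_nat n) = of_nat n"
  by (induction n) (simp_all add: hom_0 hom_1 hom_add)
lemma hom_of_int: "h (of_int n) = of_int n"
  by (cases n) (simp_all add: hom_of_nat hom_minus hom_diff hom_1)
lemmas hom_simps = hom_0 hom_1 hom_add hom_mult hom_minus hom_diff hom_power hom_sum hom_prod
  hom_of_nat hom_of_int

lemma hom_peval: "h (peval \<rho> f) = peval (\<lambda>i. h (\<rho> i)) f"
  by (simp add: peval_def psum_def monom_eval_def hom_simps)

end

lemmas peval_simps = hom_simps[OF is_ring_hom_peval]

lemma peval_hom_eqI:
  assumes "is_ring_hom h" "\<And>i. h (Var i) = \<rho> i"
  shows "h f = peval \<rho> f"
proof (induction f rule: poly_mapping_single_induct)
  case zero
  show ?case by (simp add: hom_0[OF assms(1)])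
next
  case (single_add k c x)
  have 1: "h (Poly_Mapping.single m 1) = monom_eval \<rho> m" for m
  proof (induction m rule: poly_mapping_single_induct)
    case zero
    then show ?case by (simp add: hom_1[OF assms(1)])
  next
    case (single_add i n m)
    note Var_power[of i n]
    hence "h (Poly_Mapping.single (Poly_Mapping.single i n) 1) = \<rho> i ^ n"
      by (simp add: hom_power[OF assms(1)] assms(2))
    moreover have "Poly_Mapping.single (Poly_Mapping.single i n + m) (1::int) =
       Poly_Mapping.single (Poly_Mapping.single i n) 1 * Poly_Mapping.single m 1"
      by (simp add: mult_single)
    ultimately show ?case
      by (simp only: hom_mult[OF assms(1)] monom_eval_add single_add monom_eval_single)
  qed
  have "Poly_Mapping.single k c = of_int c * Poly_Mapping.single k 1"
    by (simp add: mult_single flip: single_of_int)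
  hence "h (Poly_Mapping.single k c) = of_int c * monom_eval \<rho> k"
    by (simp only: hom_mult[OF assms(1)] hom_of_int[OF assms(1)] 1)
  then show ?case using single_add by (simp add: hom_add[OF assms(1)] peval_add peval_single)
qed

lemma peval_peval: "peval \<rho> (peval \<tau> f) = peval (\<lambda>i. peval \<rho> (\<tau> i)) f"
  by (rule hom_peval[OF is_ring_hom_peval])


section \<open>Witt vectors\<close>

definition ghost :: "nat \<Rightarrow> (nat \<Rightarrow> 'a::comm_ring_1) \<Rightarrow> nat \<Rightarrow> 'a" where
  "ghost p x n = (\<Sum>i\<le>n. of_nat p ^ i * x i ^ (p ^ (n - i)))"

lemma hom_ghost: "is_ring_hom h \<Longrightarrow> h (ghost p x n) = ghost p (\<lambda>i. h (x i)) n"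
  by (simp add: ghost_def hom_simps)

lemma of_nat_prime_dvd_freshman:
  fixes a b :: "'a::comm_ring_1"
  assumes "prime p"
  shows "of_nat p dvd (a + b) ^ p - a ^ p - b ^ p"
proof -
  have "p > 0" using assms by (simp add: prime_gt_0_nat)
  have "(a + b) ^ p = (\<Sum>k\<le>p. of_nat (p choose k) * a ^ k * b ^ (p - k))"
    by (rule binomial_ring)
  also have "\<dots> = (\<Sum>k\<in>{0,p}. of_nat (p choose k) * a ^ k * b ^ (p - k))
                   + (\<Sum>k\<in>{..p}-{0,p}. of_nat (p choose k) * a ^ k * b ^ (p - k))"
    by (subst sum.subset_diff[of "{0,p}"]) (auto simp: add.commute)
  also have "(\<Sum>k\<in>{0,p}. of_nat (p choose k) * a ^ k * b ^ (p - k)) = a ^ p + b ^ p"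
    using \<open>p > 0\<close> by simp
  finally have "(a + b) ^ p - a ^ p - b ^ p = (\<Sum>k\<in>{..p}-{0,p}. of_nat (p choose k) * a ^ k * b ^ (p - k))"
    by simp
  also have "of_nat p dvd \<dots>"
  proof (rule dvd_sum)
    fix k assume k: "k \<in> {..p} - {0,p}"
    have "p dvd (p choose k)"
      by (rule dvd_choose_prime) (use k assms in auto)
    hence "(of_nat p :: 'a) dvd of_nat (p choose k)" by (auto elim!: dvdE)
    thus "of_nat p dvd (of_nat (p choose k) * a ^ k * b ^ (p - k) :: 'a)" by (simp add: dvd_mult2)
  qed
  finally show ?thesis .
qed

lemma dvd_power_lift1:
  fixes a b :: "'a::comm_ring_1"
  assumes "of_nat p ^ Suc k dvd a - b" "p > 0"
  shows "of_nat p ^ Suc (Suc k) dvd a ^ p - b ^ p"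
proof -
  have pd: "of_nat p dvd a - b"
    using assms(1) by (rule dvd_trans[rotated]) simp
  have "a ^ p - b ^ p = (a - b) * (\<Sum>i<p. b ^ (p - Suc i) * a ^ i)"
    by (rule power_diff_sumr2)
  moreover have "of_nat p dvd (\<Sum>i<p. b ^ (p - Suc i) * a ^ i)"
  proof -
    have "(\<Sum>i<p. b ^ (p - Suc i) * a ^ i) = (\<Sum>i<p. b ^ (p - Suc i) * (a ^ i - b ^ i)) + (\<Sum>i<p. b ^ (p - Suc i) * b ^ i)"
      by (simp add: sum.distrib[symmetric] algebra_simps)
    also have "(\<Sum>i<p. b ^ (p - Suc i) * b ^ i) = (\<Sum>i<p. b ^ (p - 1))"
      by (intro sum.cong) (auto simp flip: power_add)
    also have "\<dots> = of_nat p * b ^ (p - 1)" by simp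
    finally have eq: "(\<Sum>i<p. b ^ (p - Suc i) * a ^ i) = (\<Sum>i<p. b ^ (p - Suc i) * (a ^ i - b ^ i)) + of_nat p * b ^ (p - 1)" .
    have "of_nat p dvd b ^ (p - Suc i) * (a ^ i - b ^ i)" for i
      using pd by (metis dvd_mult dvd_mult2 power_diff_sumr2)
    thus ?thesis unfolding eq by (intro dvd_add dvd_sum) auto
  qed
  ultimately show ?thesis
    using assms(1) by (simp only: power_Suc2[of _ "Suc k"]) (rule mult_dvd_mono)
qed

lemma dvd_power_lift:
  fixes a b :: "'a::comm_ring_1"
  assumes "of_nat p dvd a - b" "p > 0"
  shows "of_nat p ^ Suc n dvd a ^ (p ^ n) - b ^ (p ^ n)"
proof (induction n)
  case (Suc n)
  from dvd_power_lift1[OF this assms(2)] show ?case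
    by (simp add: power_mult[symmetric] mult.commute)
qed (use assms in simp)

definition frob_lift :: "nat \<Rightarrow> zpoly \<Rightarrow> zpoly" where
  "frob_lift p = peval (\<lambda>i. Var i ^ p)"

lemma is_ring_hom_frob_lift: "is_ring_hom (frob_lift p)"
  unfolding frob_lift_def by (rule is_ring_hom_peval)

lemma frob_lift_cong:
  assumes p: "prime p"
  shows "of_nat p dvd frob_lift p f - f ^ p"
proof -
  note hs = hom_simps[OF is_ring_hom_frob_lift[of p]]
  define S where "S = {f. of_nat p dvd frob_lift p f - f ^ p}"
  have p0: "p > 0" using p by (simp add: prime_gt_0_nat)
  have add: "f + g \<in> S" if "f \<in> S" "g \<in> S" for f g
  proof -
    have eq: "frob_lift p (f + g) - (f + g) ^ p =
       (frob_lift p f - f ^ p) + (frob_lift p g - g ^ p) - ((f + g) ^ p - f ^ p - g ^ p)"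
      by (simp add: hs)
    show ?thesis unfolding S_def mem_Collect_eq eq
      using that of_nat_prime_dvd_freshman[OF p, of f g] unfolding S_def mem_Collect_eq by (metis dvd_diff dvd_add)
  qed
  have sub: "f \<in> S" if "f + g \<in> S" "g \<in> S" for f g
  proof -
    have eq: "frob_lift p f - f ^ p =
       (frob_lift p (f + g) - (f + g) ^ p) - (frob_lift p g - g ^ p) + ((f + g) ^ p - f ^ p - g ^ p)"
      by (simp add: hs)
    show ?thesis unfolding S_def mem_Collect_eq eq
      using that of_nat_prime_dvd_freshman[OF p, of f g] unfolding S_def mem_Collect_eq by (metis dvd_diff dvd_add)
  qed
  have mult: "f * g \<in> S" if "f \<in> S" "g \<in> S" for f g
  proof -
    have eq: "frob_lift p (f * g) - (f * g) ^ p =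
       (frob_lift p f - f ^ p) * frob_lift p g + f ^ p * (frob_lift p g - g ^ p)"
      by (simp add: hs power_mult_distrib algebra_simps)
    show ?thesis unfolding S_def mem_Collect_eq eq
      using that unfolding S_def by (intro dvd_add) auto
  qed
  have S0: "0 \<in> S" and S1: "1 \<in> S" using p0 by (auto simp: S_def hs power_0_left)
  have Sm1: "- 1 \<in> S" using sub[of "-1" 1] S0 S1 by simp
  have Sint: "of_int c \<in> S" for c
    by (induction c rule: int_induct[where k = 0])
       (use S0 add[OF _ S1] add[OF _ Sm1] in \<open>auto simp: add.commute[of 1]\<close>)
  have SVar: "Var i ^ n \<in> S" for i n
    by (auto simp: S_def hs) (simp add: frob_lift_def mult.commute flip: power_mult)
  have Smon: "Poly_Mapping.single m 1 \<in> S" for m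
  proof (induction m rule: poly_mapping_single_induct)
    case zero
    then show ?case using S1 by simp
  next
    case (single_add i n m)
    note Var_power[of i n]
    moreover have "Poly_Mapping.single (Poly_Mapping.single i n + m) (1::int) =
       Poly_Mapping.single (Poly_Mapping.single i n) 1 * Poly_Mapping.single m 1"
      by (simp add: mult_single)
    ultimately show ?case using mult[OF SVar[of i n] single_add] by simp
  qed
  have "f \<in> S"
  proof (induction f rule: poly_mapping_single_induct)
    case (single_add k c x)
    have "Poly_Mapping.single k c = of_int c * Poly_Mapping.single k 1"
      by (simp add: mult_single flip: single_of_int)
    thus ?case using add[OF mult[OF Sint[of c] Smon[of k]] single_add] by simp
  qed (rule S0)
  thus ?thesis by (simp add: S_def)
qed

text \<open>Dwork's criterion: a sequence of polynomials is a sequence of ghost components if successive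
  members are congruent.\<close>

definition ghost_seq :: "nat \<Rightarrow> (nat \<Rightarrow> zpoly) \<Rightarrow> bool" where
  "ghost_seq p h \<longleftrightarrow> (\<forall>n. of_nat p ^ Suc n dvd h (Suc n) - frob_lift p (h n))"

lemma ghost_seq_add: "ghost_seq p g \<Longrightarrow> ghost_seq p h \<Longrightarrow> ghost_seq p (\<lambda>n. g n + h n)"
  unfolding ghost_seq_def
proof safe
  fix n
  assume a: "\<forall>n. of_nat p ^ Suc n dvd g (Suc n) - frob_lift p (g n)"
     "\<forall>n. of_nat p ^ Suc n dvd h (Suc n) - frob_lift p (h n)"
  have eq: "g (Suc n) + h (Suc n) - frob_lift p (g n + h n) =
     (g (Suc n) - frob_lift p (g n)) + (h (Suc n) - frob_lift p (h n))"
    by (simp add: hom_simps[OF is_ring_hom_frob_lift])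
  show "of_nat p ^ Suc n dvd g (Suc n) + h (Suc n) - frob_lift p (g n + h n)"
    unfolding eq using a by (intro dvd_add) auto
qed

lemma ghost_seq_mult: "ghost_seq p g \<Longrightarrow> ghost_seq p h \<Longrightarrow> ghost_seq p (\<lambda>n. g n * h n)"
  unfolding ghost_seq_def
proof safe
  fix n
  assume a: "\<forall>n. of_nat p ^ Suc n dvd g (Suc n) - frob_lift p (g n)"
     "\<forall>n. of_nat p ^ Suc n dvd h (Suc n) - frob_lift p (h n)"
  have eq: "g (Suc n) * h (Suc n) - frob_lift p (g n * h n) =
     (g (Suc n) - frob_lift p (g n)) * h (Suc n) + frob_lift p (g n) * (h (Suc n) - frob_lift p (h n))"
    by (simp add: hom_simps[OF is_ring_hom_frob_lift] algebra_simps)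
  show "of_nat p ^ Suc n dvd g (Suc n) * h (Suc n) - frob_lift p (g n * h n)"
    unfolding eq using a by (intro dvd_add dvd_mult dvd_mult2) auto
qed

lemma ghost_seq_uminus: "ghost_seq p g \<Longrightarrow> ghost_seq p (\<lambda>n. - g n)"
  unfolding ghost_seq_def
proof
  fix n
  assume "\<forall>n. of_nat p ^ Suc n dvd g (Suc n) - frob_lift p (g n)"
  hence "of_nat p ^ Suc n dvd - (g (Suc n) - frob_lift p (g n))"
    by (simp only: dvd_minus_iff)
  also have "- (g (Suc n) - frob_lift p (g n)) = - g (Suc n) - frob_lift p (- g n)"
    by (simp add: hom_simps[OF is_ring_hom_frob_lift])
  finally show "of_nat p ^ Suc n dvd - g (Suc n) - frob_lift p (- g n)" .
qed

lemma ghost_Suc: "ghost p x (Suc n) = (\<Sum>i\<le>n. of_nat p ^ i * (x i ^ p) ^ (p ^ (n - i))) + of_nat p ^ Suc n * x (Suc n)"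
proof -
  have eq: "(\<Sum>i\<le>n. of_nat p ^ i * x i ^ (p ^ (Suc n - i))) = (\<Sum>i\<le>n. of_nat p ^ i * (x i ^ p) ^ (p ^ (n - i)))"
  proof (rule sum.cong[OF refl])
    fix i assume "i \<in> {..n}"
    hence "p ^ (Suc n - i) = p * p ^ (n - i)" by (simp add: Suc_diff_le)
    thus "of_nat p ^ i * x i ^ (p ^ (Suc n - i)) = of_nat p ^ i * (x i ^ p) ^ (p ^ (n - i))"
      by (simp only: power_mult)
  qed
  show ?thesis unfolding ghost_def sum.atMost_Suc eq by simp
qed

lemma ghost_seq_ghost:
  assumes "prime p"
  shows "ghost_seq p (ghost p x)"
  unfolding ghost_seq_def
proof
  fix n
  have p0: "p > 0" using assms by (simp add: prime_gt_0_nat)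
  have eq: "ghost p x (Suc n) - frob_lift p (ghost p x n) = of_nat p ^ Suc n * x (Suc n) -
     (\<Sum>i\<le>n. of_nat p ^ i * (frob_lift p (x i) ^ (p ^ (n - i)) - (x i ^ p) ^ (p ^ (n - i))))"
    unfolding ghost_Suc ghost_def[of p x n]
    by (simp add: hom_simps[OF is_ring_hom_frob_lift] sum_subtractf algebra_simps)
  show "of_nat p ^ Suc n dvd ghost p x (Suc n) - frob_lift p (ghost p x n)"
    unfolding eq
  proof (intro dvd_diff dvd_sum)
    fix i assume i: "i \<in> {..n}"
    have "of_nat p ^ Suc (n - i) dvd frob_lift p (x i) ^ (p ^ (n - i)) - (x i ^ p) ^ (p ^ (n - i))"
      by (rule dvd_power_lift[OF frob_lift_cong[OF assms] p0])
    hence "of_nat p ^ i * of_nat p ^ Suc (n - i) dvd of_nat p ^ i * (frob_lift p (x i) ^ (p ^ (n - i)) - (x i ^ p) ^ (p ^ (n - i)))"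
      by (rule mult_dvd_mono[OF dvd_refl])
    moreover have "of_nat p ^ i * of_nat p ^ Suc (n - i) = (of_nat p ^ Suc n :: zpoly)"
      using i by (subst power_add[symmetric]) simp
    ultimately show "of_nat p ^ Suc n dvd of_nat p ^ i * (frob_lift p (x i) ^ (p ^ (n - i)) - (x i ^ p) ^ (p ^ (n - i)))"
      by (simp only:)
  qed auto
qed

function dwork :: "nat \<Rightarrow> (nat \<Rightarrow> zpoly) \<Rightarrow> nat \<Rightarrow> zpoly" where
  "dwork p h n = (SOME q. of_nat p ^ n * q = h n - (\<Sum>i<n. of_nat p ^ i * dwork p h i ^ (p ^ (n - i))))"
  by auto
termination by (relation "measure (\<lambda>(p, h, n). n)") auto
declare dwork.simps [simp del]

lemma ghost_split: "ghost p x n = (\<Sum>i<n. of_nat p ^ i * x i ^ (p ^ (n - i))) + of_nat p ^ n * x n"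
  unfolding ghost_def by (simp add: lessThan_Suc_atMost[symmetric])

lemma ghost_dwork:
  assumes "prime p" "ghost_seq p h"
  shows "ghost p (dwork p h) n = h n"
proof (induction n)
  have *: "ghost p (dwork p h) n = h n" if "of_nat p ^ n dvd h n - (\<Sum>i<n. of_nat p ^ i * dwork p h i ^ (p ^ (n - i)))" for n
  proof -
    from that obtain q where "h n - (\<Sum>i<n. of_nat p ^ i * dwork p h i ^ (p ^ (n - i))) = of_nat p ^ n * q"
      by (rule dvdE)
    hence "of_nat p ^ n * dwork p h n = h n - (\<Sum>i<n. of_nat p ^ i * dwork p h i ^ (p ^ (n - i)))"
      by (subst dwork.simps) (rule someI[where x = q], simp)
    thus ?thesis by (simp add: ghost_split)
  qed
  case 0
  show ?case by (rule *) simp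
next
  case (Suc n)
  have *: "ghost p (dwork p h) n = h n" if "of_nat p ^ n dvd h n - (\<Sum>i<n. of_nat p ^ i * dwork p h i ^ (p ^ (n - i)))" for n
  proof -
    from that obtain q where "h n - (\<Sum>i<n. of_nat p ^ i * dwork p h i ^ (p ^ (n - i))) = of_nat p ^ n * q"
      by (rule dvdE)
    hence "of_nat p ^ n * dwork p h n = h n - (\<Sum>i<n. of_nat p ^ i * dwork p h i ^ (p ^ (n - i)))"
      by (subst dwork.simps) (rule someI[where x = q], simp)
    thus ?thesis by (simp add: ghost_split)
  qed
  have "of_nat p ^ Suc n dvd h (Suc n) - frob_lift p (h n)"
    using assms(2) unfolding ghost_seq_def by blast
  moreover have "of_nat p ^ Suc n dvd ghost p (dwork p h) (Suc n) - frob_lift p (h n)"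
    using ghost_seq_ghost[OF assms(1), of "dwork p h"] Suc unfolding ghost_seq_def by metis
  ultimately have "of_nat p ^ Suc n dvd (h (Suc n) - frob_lift p (h n)) -
     (ghost p (dwork p h) (Suc n) - frob_lift p (h n)) + of_nat p ^ Suc n * dwork p h (Suc n)"
    by (rule dvd_add[OF dvd_diff dvd_triv_left])
  also have "\<dots> = h (Suc n) - (\<Sum>i<Suc n. of_nat p ^ i * dwork p h i ^ (p ^ (Suc n - i)))"
    by (simp add: ghost_split[of p _ "Suc n"])
  finally show ?case by (rule *)
qed

lemma ghost_inj:
  fixes x y :: "nat \<Rightarrow> 'a::{idom, ring_char_0}"
  assumes "p > 0" "\<And>n. ghost p x n = ghost p y n"
  shows "x = y"
proof
  fix n
  show "x n = y n"
  proof (induction n rule: less_induct)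
    case (less n)
    have "(\<Sum>i<n. of_nat p ^ i * x i ^ (p ^ (n - i))) = (\<Sum>i<n. of_nat p ^ i * y i ^ (p ^ (n - i)))"
      by (intro sum.cong) (auto simp: less)
    with assms(2)[of n] have "of_nat p ^ n * x n = of_nat p ^ n * y n"
      by (simp add: ghost_split)
    thus ?case using assms(1) by simp
  qed
qed

text \<open>
  The universal Witt polynomials: the variables with even index are the coordinates of the first
  Witt vector, those with odd index the coordinates of the second one.  The descriptions are
  proper because ghost components determine a sequence of integer polynomials.
\<close>

definition sum_poly :: "nat \<Rightarrow> nat \<Rightarrow> zpoly" where
  "sum_poly p = (THE s. \<forall>n. ghost p s n =
     ghost p (\<lambda>i. Var (2 * i)) n + ghost p (\<lambda>i. Var (2 * i + 1)) n)"

definition prod_poly :: "nat \<Rightarrow> nat \<Rightarrow> zpoly" where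
  "prod_poly p = (THE s. \<forall>n. ghost p s n =
     ghost p (\<lambda>i. Var (2 * i)) n * ghost p (\<lambda>i. Var (2 * i + 1)) n)"

definition neg_poly :: "nat \<Rightarrow> nat \<Rightarrow> zpoly" where
  "neg_poly p = (THE s. \<forall>n. ghost p s n = - ghost p (\<lambda>i. Var (2 * i)) n)"

lemma ghost_the:
  assumes "prime p" "ghost_seq p h"
  shows "ghost p (THE s. \<forall>n. ghost p s n = h n) n = h n"
proof -
  have "\<exists>!s. \<forall>n. ghost p s n = h n"
  proof (rule ex_ex1I)
    show "\<exists>s. \<forall>n. ghost p s n = h n" using ghost_dwork[OF assms] by blast
    show "s = t" if "\<forall>n. ghost p s n = h n" "\<forall>n. ghost p t n = h n" for s t
      by (rule ghost_inj[of p]) (use that assms(1) in \<open>auto simp: prime_gt_0_nat\<close>)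
  qed
  from theI'[OF this] show ?thesis by blast
qed

lemma
  assumes "prime p"
  shows ghost_sum_poly: "ghost p (sum_poly p) n = ghost p (\<lambda>i. Var (2 * i)) n + ghost p (\<lambda>i. Var (2 * i + 1)) n"
    and ghost_prod_poly: "ghost p (prod_poly p) n = ghost p (\<lambda>i. Var (2 * i)) n * ghost p (\<lambda>i. Var (2 * i + 1)) n"
    and ghost_neg_poly: "ghost p (neg_poly p) n = - ghost p (\<lambda>i. Var (2 * i)) n"
  unfolding sum_poly_def prod_poly_def neg_poly_def
  by (rule ghost_the[OF assms] ghost_seq_add ghost_seq_mult ghost_seq_uminus ghost_seq_ghost[OF assms])+

definition interleave :: "(nat \<Rightarrow> 'a) \<Rightarrow> (nat \<Rightarrow> 'a) \<Rightarrow> nat \<Rightarrow> 'a" where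
  "interleave x y i = (if even i then x (i div 2) else y (i div 2))"

lemma interleave_simps [simp]: "interleave x y (2 * i) = x i" "interleave x y (Suc (2 * i)) = y i"
  by (auto simp: interleave_def)

definition witt_add :: "nat \<Rightarrow> (nat \<Rightarrow> 'a::comm_ring_1) \<Rightarrow> (nat \<Rightarrow> 'a) \<Rightarrow> nat \<Rightarrow> 'a" where
  "witt_add p x y n = peval (interleave x y) (sum_poly p n)"

definition witt_mult :: "nat \<Rightarrow> (nat \<Rightarrow> 'a::comm_ring_1) \<Rightarrow> (nat \<Rightarrow> 'a) \<Rightarrow> nat \<Rightarrow> 'a" where
  "witt_mult p x y n = peval (interleave x y) (prod_poly p n)"

definition witt_neg :: "nat \<Rightarrow> (nat \<Rightarrow> 'a::comm_ring_1) \<Rightarrow> nat \<Rightarrow> 'a" where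
  "witt_neg p x n = peval (interleave x x) (neg_poly p n)"

lemma interleave_hom: "(\<lambda>i. h (interleave x y i)) = interleave (\<lambda>i. h (x i)) (\<lambda>i. h (y i))"
  by (auto simp: interleave_def)

lemma
  assumes "is_ring_hom h"
  shows hom_witt_add: "h (witt_add p x y n) = witt_add p (\<lambda>i. h (x i)) (\<lambda>i. h (y i)) n"
    and hom_witt_mult: "h (witt_mult p x y n) = witt_mult p (\<lambda>i. h (x i)) (\<lambda>i. h (y i)) n"
    and hom_witt_neg: "h (witt_neg p x n) = witt_neg p (\<lambda>i. h (x i)) n"
  unfolding witt_add_def witt_mult_def witt_neg_def
  by (simp_all add: hom_peval[OF assms] interleave_hom)

lemma
  assumes "prime p"
  shows ghost_witt_add: "ghost p (witt_add p x y) n = ghost p x n + ghost p y n"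
    and ghost_witt_mult: "ghost p (witt_mult p x y) n = ghost p x n * ghost p y n"
    and ghost_witt_neg: "ghost p (witt_neg p x) n = - ghost p x n"
proof -
  have "ghost p (witt_add p x y) n = peval (interleave x y) (ghost p (sum_poly p) n)"
    unfolding witt_add_def by (simp add: hom_ghost[OF is_ring_hom_peval])
  also have "\<dots> = ghost p x n + ghost p y n"
    by (simp add: ghost_sum_poly[OF assms] peval_simps hom_ghost[OF is_ring_hom_peval])
  finally show "ghost p (witt_add p x y) n = ghost p x n + ghost p y n" .
  have "ghost p (witt_mult p x y) n = peval (interleave x y) (ghost p (prod_poly p) n)"
    unfolding witt_mult_def by (simp add: hom_ghost[OF is_ring_hom_peval])
  also have "\<dots> = ghost p x n * ghost p y n"
    by (simp add: ghost_prod_poly[OF assms] peval_simps hom_ghost[OF is_ring_hom_peval])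
  finally show "ghost p (witt_mult p x y) n = ghost p x n * ghost p y n" .
  have "ghost p (witt_neg p x) n = peval (interleave x x) (ghost p (neg_poly p) n)"
    unfolding witt_neg_def by (simp add: hom_ghost[OF is_ring_hom_peval])
  also have "\<dots> = - ghost p x n"
    by (simp add: ghost_neg_poly[OF assms] peval_simps hom_ghost[OF is_ring_hom_peval])
  finally show "ghost p (witt_neg p x) n = - ghost p x n" .
qed

definition witt_teich :: "'a::comm_ring_1 \<Rightarrow> nat \<Rightarrow> 'a" where
  "witt_teich a n = (if n = 0 then a else 0)"

lemma ghost_witt_teich: "p > 0 \<Longrightarrow> ghost p (witt_teich a) n = a ^ (p ^ n)"
proof -
  assume "p > 0"
  have "ghost p (witt_teich a) n = (\<Sum>i\<in>{0}. of_nat p ^ i * witt_teich a i ^ (p ^ (n - i)))"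
    unfolding ghost_def
    by (rule sum.mono_neutral_right) (use \<open>p > 0\<close> in \<open>auto simp: witt_teich_def power_0_left\<close>)
  thus ?thesis by (simp add: witt_teich_def)
qed

lemma hom_witt_teich: "is_ring_hom h \<Longrightarrow> h (witt_teich a n) = witt_teich (h a) n"
  by (simp add: witt_teich_def hom_0)

definition triple :: "(nat \<Rightarrow> 'a) \<Rightarrow> (nat \<Rightarrow> 'a) \<Rightarrow> (nat \<Rightarrow> 'a) \<Rightarrow> nat \<Rightarrow> 'a" where
  "triple x y z i = (if i mod 3 = 0 then x (i div 3) else if i mod 3 = 1 then y (i div 3) else z (i div 3))"

lemma witt_universal:
  fixes x y z :: "nat \<Rightarrow> 'a::comm_ring_1"
  obtains h :: "zpoly \<Rightarrow> 'a" and X Y Z where "is_ring_hom h" 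
    "x = (\<lambda>i. h (X i))" "y = (\<lambda>i. h (Y i))" "z = (\<lambda>i. h (Z i))"
proof (rule that[of "peval (triple x y z)" "\<lambda>i. Var (3 * i)" "\<lambda>i. Var (Suc (3 * i))" "\<lambda>i. Var (Suc (Suc (3 * i)))"])
  have a: "Suc (3 * i) mod 3 = 1" "Suc (Suc (3 * i)) mod 3 = 2" "Suc (3 * i) div 3 = i" "Suc (Suc (3 * i)) div 3 = i" for i
    by presburger+
  show "x = (\<lambda>i. peval (triple x y z) (Var (3 * i)))"
    "y = (\<lambda>i. peval (triple x y z) (Var (Suc (3 * i))))"
    "z = (\<lambda>i. peval (triple x y z) (Var (Suc (Suc (3 * i)))))"
    unfolding peval_Var triple_def a by auto
qed (rule is_ring_hom_peval)

lemma
  fixes x y z :: "nat \<Rightarrow> 'a::comm_ring_1"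
  assumes p: "prime p"
  shows witt_add_assoc: "witt_add p (witt_add p x y) z = witt_add p x (witt_add p y z)" (is ?th1)
    and witt_add_commute: "witt_add p x y = witt_add p y x" (is ?th2)
    and witt_add_0: "witt_add p (witt_teich 0) x = x" (is ?th3)
    and witt_add_neg: "witt_add p (witt_neg p x) x = witt_teich 0" (is ?th4)
    and witt_mult_assoc: "witt_mult p (witt_mult p x y) z = witt_mult p x (witt_mult p y z)" (is ?th5)
    and witt_mult_commute: "witt_mult p x y = witt_mult p y x" (is ?th6)
    and witt_mult_1: "witt_mult p (witt_teich 1) x = x" (is ?th7)
    and witt_distrib: "witt_mult p (witt_add p x y) z = witt_add p (witt_mult p x z) (witt_mult p y z)" (is ?th8)
proof -
  obtain h :: "zpoly \<Rightarrow> 'a" and X Y Z where h: "is_ring_hom h" and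
    xyz: "x = (\<lambda>i. h (X i))" "y = (\<lambda>i. h (Y i))" "z = (\<lambda>i. h (Z i))"
    by (rule witt_universal)
  have p0: "p > 0" using p by (simp add: prime_gt_0_nat)
  note nat = hom_witt_add[OF h, symmetric] hom_witt_mult[OF h, symmetric] hom_witt_neg[OF h, symmetric]
  have t0: "witt_teich 0 = (\<lambda>i. h (witt_teich 0 i))" and t1: "witt_teich 1 = (\<lambda>i. h (witt_teich 1 i))"
    by (auto simp: hom_witt_teich[OF h] hom_simps[OF h])
  note gh = ghost_witt_add[OF p] ghost_witt_mult[OF p] ghost_witt_neg[OF p] ghost_witt_teich[OF p0]
  have u: "witt_add p (witt_add p X Y) Z = witt_add p X (witt_add p Y Z)"
    "witt_add p X Y = witt_add p Y X" "witt_add p (witt_teich 0) X = X"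
    "witt_add p (witt_neg p X) X = witt_teich 0"
    "witt_mult p (witt_mult p X Y) Z = witt_mult p X (witt_mult p Y Z)"
    "witt_mult p X Y = witt_mult p Y X"
    "witt_mult p (witt_teich 1) X = X"
    "witt_mult p (witt_add p X Y) Z = witt_add p (witt_mult p X Z) (witt_mult p Y Z)"
    by (rule ghost_inj[OF p0], simp add: gh algebra_simps power_0_left p0)+
  show ?th1 unfolding xyz nat u(1) ..
  show ?th2 unfolding xyz nat u(2) ..
  show ?th3 unfolding xyz t0 nat u(3) ..
  show ?th4 unfolding xyz nat u(4) t0[symmetric] ..
  show ?th5 unfolding xyz nat u(5) ..
  show ?th6 unfolding xyz nat u(6) ..
  show ?th7 unfolding xyz t1 nat u(7) ..
  show ?th8 unfolding xyz nat u(8) ..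
qed

lemma witt_mult_lead_zpoly:
  fixes X Y :: "nat \<Rightarrow> zpoly"
  assumes p: "prime p" and X: "\<And>i. i < m \<Longrightarrow> X i = 0" and Y: "\<And>i. i < n \<Longrightarrow> Y i = 0"
  shows "of_nat p dvd witt_mult p X Y (m + n) - X m ^ (p ^ n) * Y n ^ (p ^ m)"
proof -
  define N where "N = m + n"
  define P :: zpoly where "P = of_nat p"
  define Z where "Z = witt_mult p X Y"
  have p2: "p \<ge> 2" using p by (rule prime_ge_2_nat)
  have P0: "P \<noteq> 0" using p2 by (simp add: P_def)
  have lead: "\<exists>A. ghost p U (a + b) = P ^ a * U a ^ (p ^ b) + P ^ Suc a * A" if "\<And>i. i < a \<Longrightarrow> U i = 0" for U :: "nat \<Rightarrow> zpoly" and a b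
  proof -
    have "ghost p U (a + b) = (\<Sum>i\<in>{a..a+b}. P ^ i * U i ^ (p ^ (a + b - i)))"
      unfolding ghost_def P_def[symmetric]
      by (rule sum.mono_neutral_right) (use that p2 in \<open>auto simp: power_0_left not_le\<close>)
    also have "{a..a+b} = insert a {Suc a..a+b}" by auto
    also have "(\<Sum>i\<in>insert a {Suc a..a+b}. P ^ i * U i ^ (p ^ (a + b - i))) =
       P ^ a * U a ^ (p ^ b) + (\<Sum>i\<in>{Suc a..a+b}. P ^ i * U i ^ (p ^ (a + b - i)))"
      by (subst sum.insert) auto
    finally have 1: "ghost p U (a + b) = \<dots>" .
    have "P ^ Suc a dvd (\<Sum>i\<in>{Suc a..a+b}. P ^ i * U i ^ (p ^ (a + b - i)))"
    proof (rule dvd_sum)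
      fix i assume "i \<in> {Suc a..a+b}"
      thus "P ^ Suc a dvd P ^ i * U i ^ (p ^ (a + b - i))"
        by (intro dvd_mult2 le_imp_power_dvd) auto
    qed
    with 1 show ?thesis by (auto elim!: dvdE)
  qed
  have low: "P ^ a dvd ghost p U r" if "\<And>i. i < a \<Longrightarrow> U i = 0" for U :: "nat \<Rightarrow> zpoly" and a r
    unfolding ghost_def P_def[symmetric]
  proof (rule dvd_sum)
    fix i
    show "P ^ a dvd P ^ i * U i ^ (p ^ (r - i))"
    proof (cases "i < a")
      case True
      then show ?thesis using that p2 by (simp add: power_0_left)
    next
      case False
      then show ?thesis by (intro dvd_mult2 le_imp_power_dvd) auto
    qed
  qed
  have gZ: "ghost p Z r = ghost p X r * ghost p Y r" for r
    unfolding Z_def by (rule ghost_witt_mult[OF p])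
  have gZd: "P ^ N dvd ghost p Z r" for r
    unfolding gZ N_def power_add by (intro mult_dvd_mono low X Y)
  have tm: "P ^ (i + (N - i) * p ^ k) dvd P ^ i * Z i ^ (p ^ k)" if "P ^ (N - i) dvd Z i" for i k
    unfolding power_add power_mult using that by (intro mult_dvd_mono dvd_power_same) auto
  have A: "P ^ (N - r) dvd Z r" if "r \<le> N" for r
    using that
  proof (induction r rule: less_induct)
    case (less r)
    have "P ^ N dvd P ^ i * Z i ^ (p ^ (r - i))" if "i < r" for i
    proof -
      have "N - i \<le> (N - i) * p ^ (r - i)" using p2 by simp
      hence "N \<le> i + (N - i) * p ^ (r - i)" using that less.prems by linarith
      hence "P ^ N dvd P ^ (i + (N - i) * p ^ (r - i))" by (rule le_imp_power_dvd)
      also have "\<dots> dvd P ^ i * Z i ^ (p ^ (r - i))" by (rule tm) (use less that in auto)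
      finally show ?thesis .
    qed
    hence "P ^ N dvd ghost p Z r - (\<Sum>i<r. P ^ i * Z i ^ (p ^ (r - i)))"
      by (intro dvd_diff gZd dvd_sum) auto
    hence "P ^ N dvd P ^ r * Z r" by (simp add: ghost_split P_def)
    moreover have "P ^ N = P ^ r * P ^ (N - r)" using less.prems by (simp flip: power_add)
    moreover have "P ^ r \<noteq> 0" using P0 by simp
    ultimately show ?case by (simp only: dvd_mult_cancel_left) simp
  qed
  have B: "P ^ Suc N dvd P ^ i * Z i ^ (p ^ (N - i))" if "i < N" for i
  proof -
    have "p \<le> p ^ (N - i)" by (rule self_le_power) (use that p2 in auto)
    hence "2 \<le> p ^ (N - i)" by (rule order_trans[OF p2])
    hence "(N - i) * 2 \<le> (N - i) * p ^ (N - i)" by (rule mult_le_mono2)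
    hence "Suc N \<le> i + (N - i) * p ^ (N - i)" using that by linarith
    hence "P ^ Suc N dvd P ^ (i + (N - i) * p ^ (N - i))" by (rule le_imp_power_dvd)
    also have "\<dots> dvd P ^ i * Z i ^ (p ^ (N - i))" by (rule tm) (use A that in auto)
    finally show ?thesis .
  qed
  obtain a where a: "ghost p X (m + n) = P ^ m * X m ^ (p ^ n) + P ^ Suc m * a"
    using lead[of m X n] X by blast
  obtain b where b: "ghost p Y (n + m) = P ^ n * Y n ^ (p ^ m) + P ^ Suc n * b"
    using lead[of n Y m] Y by blast
  have "ghost p Z N - P ^ N * (X m ^ (p ^ n) * Y n ^ (p ^ m)) =
     P ^ Suc N * (X m ^ (p ^ n) * b + a * Y n ^ (p ^ m) + P * a * b)"
    unfolding gZ N_def a b[unfolded add.commute[of n m]] power_add power_Suc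
    by (simp only: algebra_simps)
  hence "P ^ Suc N dvd ghost p Z N - P ^ N * (X m ^ (p ^ n) * Y n ^ (p ^ m))" by simp
  moreover have "P ^ Suc N dvd (\<Sum>i<N. P ^ i * Z i ^ (p ^ (N - i)))"
    by (intro dvd_sum) (use B in auto)
  ultimately have "P ^ Suc N dvd (ghost p Z N - P ^ N * (X m ^ (p ^ n) * Y n ^ (p ^ m))) - (\<Sum>i<N. P ^ i * Z i ^ (p ^ (N - i)))"
    by (rule dvd_diff)
  also have "\<dots> = P ^ N * (Z N - X m ^ (p ^ n) * Y n ^ (p ^ m))"
    by (simp add: ghost_split P_def algebra_simps)
  finally have "P dvd Z N - X m ^ (p ^ n) * Y n ^ (p ^ m)"
    using power_not_zero[OF P0, of N] by (simp only: power_Suc2 dvd_mult_cancel_left) simp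
  thus ?thesis by (simp add: P_def Z_def N_def)
qed

lemma witt_mult_lead:
  fixes x y :: "nat \<Rightarrow> 'a::idom_prime_char"
  assumes x: "\<And>i. i < m \<Longrightarrow> x i = 0" and y: "\<And>i. i < n \<Longrightarrow> y i = 0"
  shows "witt_mult CHAR('a) x y (m + n) = x m ^ (CHAR('a) ^ n) * y n ^ (CHAR('a) ^ m)"
proof -
  let ?p = "CHAR('a)"
  define X where "X = (\<lambda>i. if i < m then 0 else Var (2 * i))"
  define Y where "Y = (\<lambda>i. if i < n then 0 else Var (2 * i + 1))"
  define h where "h = peval (interleave x y)"
  have h: "is_ring_hom h" unfolding h_def by (rule is_ring_hom_peval)
  have hX: "h (X i) = x i" and hY: "h (Y i) = y i" for i
    using x y by (auto simp: X_def Y_def h_def)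
  have "of_nat ?p dvd witt_mult ?p X Y (m + n) - X m ^ (?p ^ n) * Y n ^ (?p ^ m)"
    by (rule witt_mult_lead_zpoly) (auto simp: X_def Y_def)
  then obtain q where "witt_mult ?p X Y (m + n) - X m ^ (?p ^ n) * Y n ^ (?p ^ m) = of_nat ?p * q"
    by (rule dvdE)
  hence "h (witt_mult ?p X Y (m + n) - X m ^ (?p ^ n) * Y n ^ (?p ^ m)) = h (of_nat ?p * q)"
    by simp
  thus ?thesis
    by (simp add: hom_simps[OF h] hom_witt_mult[OF h] hX hY)
qed


typedef 'a witt = "UNIV :: (nat \<Rightarrow> 'a) set"
  morphisms wcoord Witt ..

setup_lifting type_definition_witt

text \<open>
  The prime \<open>p\<close> of the \<open>p\<close>-typical Witt vectors is the characteristic of the coordinate ring.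
\<close>

instantiation witt :: (idom_prime_char) comm_ring_1
begin

lift_definition zero_witt :: "'a witt" is "witt_teich 0" .
lift_definition one_witt :: "'a witt" is "witt_teich 1" .
lift_definition plus_witt :: "'a witt \<Rightarrow> 'a witt \<Rightarrow> 'a witt" is "witt_add CHAR('a)" .
lift_definition uminus_witt :: "'a witt \<Rightarrow> 'a witt" is "witt_neg CHAR('a)" .
lift_definition times_witt :: "'a witt \<Rightarrow> 'a witt \<Rightarrow> 'a witt" is "witt_mult CHAR('a)" .
definition minus_witt :: "'a witt \<Rightarrow> 'a witt \<Rightarrow> 'a witt" where "minus_witt x y = x + - y"

instance
proof
  fix a b c :: "'a witt"
  have p: "prime CHAR('a)" by simp
  show "a + b + c = a + (b + c)" by transfer (rule witt_add_assoc[OF p])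
  show "a + b = b + a" by transfer (rule witt_add_commute[OF p])
  show "0 + a = a" by transfer (rule witt_add_0[OF p])
  show "- a + a = 0" by transfer (rule witt_add_neg[OF p])
  show "a - b = a + - b" by (rule minus_witt_def)
  show "a * b * c = a * (b * c)" by transfer (rule witt_mult_assoc[OF p])
  show "a * b = b * a" by transfer (rule witt_mult_commute[OF p])
  show "1 * a = a" by transfer (rule witt_mult_1[OF p])
  show "(a + b) * c = a * c + b * c" by transfer (rule witt_distrib[OF p])
  show "(0::'a witt) \<noteq> 1" by transfer (auto simp: witt_teich_def fun_eq_iff)
qed

end

instance witt :: (idom_prime_char) idom
proof
  fix a b :: "'a witt"
  show "a * b \<noteq> 0" if "a \<noteq> 0" "b \<noteq> 0"
    using that
  proof transfer
    fix x y :: "nat \<Rightarrow> 'a"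
    have zero: "witt_teich (0::'a) = (\<lambda>_. 0)" by (auto simp: witt_teich_def)
    assume "x \<noteq> witt_teich 0" "y \<noteq> witt_teich 0"
    hence ex: "\<exists>i. x i \<noteq> 0" "\<exists>i. y i \<noteq> 0" unfolding zero by auto
    define m where "m = (LEAST i. x i \<noteq> 0)"
    define n where "n = (LEAST i. y i \<noteq> 0)"
    have x: "x m \<noteq> 0" unfolding m_def by (rule LeastI_ex[OF ex(1)])
    have y: "y n \<noteq> 0" unfolding n_def by (rule LeastI_ex[OF ex(2)])
    have x0: "x i = 0" if "i < m" for i
      using not_less_Least[of i "\<lambda>i. x i \<noteq> 0"] that unfolding m_def by blast
    have y0: "y i = 0" if "i < n" for i
      using not_less_Least[of i "\<lambda>i. y i \<noteq> 0"] that unfolding n_def by blast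
    have "witt_mult CHAR('a) x y (m + n) \<noteq> 0"
      using witt_mult_lead[OF x0 y0] x y by simp
    thus "witt_mult CHAR('a) x y \<noteq> witt_teich 0" unfolding zero by auto
  qed
qed

lift_definition teich :: "'a::idom_prime_char \<Rightarrow> 'a witt" is witt_teich .

lift_definition frob :: "'a::idom_prime_char witt \<Rightarrow> 'a witt" is "\<lambda>x n. x n ^ CHAR('a)" .

lemma is_ring_hom_power_CHAR: "is_ring_hom (\<lambda>x :: 'a::idom_prime_char. x ^ CHAR('a))"
  by (simp add: is_ring_hom_def freshmans_dream power_mult_distrib)

lemma frob_add: "frob (x + y) = frob x + frob y"
  by transfer (rule ext, rule hom_witt_add[OF is_ring_hom_power_CHAR])

lemma frob_mult: "frob (x * y) = frob x * frob y"
  by transfer (rule ext, rule hom_witt_mult[OF is_ring_hom_power_CHAR])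

lemma frob_teich: "frob (teich a) = teich (a ^ CHAR('a))" for a :: "'a::idom_prime_char"
  by transfer (rule ext, rule hom_witt_teich[OF is_ring_hom_power_CHAR])

lemma frob_1: "frob 1 = 1"
  by transfer (rule ext, simp add: witt_teich_def)

lemma is_ring_hom_frob: "is_ring_hom frob"
  by (simp add: is_ring_hom_def frob_1 frob_add frob_mult)

lemma inj_frob: "inj (frob :: 'a::idom_prime_char witt \<Rightarrow> _)"
proof (rule injI)
  fix x y :: "'a witt"
  assume "frob x = frob y"
  moreover have "a = b" if "a ^ CHAR('a) = b ^ CHAR('a)" for a b :: 'a
  proof -
    note h = hom_simps[OF is_ring_hom_power_CHAR[where ?'a = 'a]]
    have "(a - b) ^ CHAR('a) = 0" unfolding h using that by simp
    thus ?thesis by simp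
  qed
  ultimately show "x = y" by transfer (auto simp: fun_eq_iff)
qed

lemma bij_frob: "bij (frob :: 'k::{alg_closed_field, field_prime_char} witt \<Rightarrow> _)"
proof -
  have ex: "\<exists>y. y ^ CHAR('k) = x" for x :: 'k
    using nth_root_exists[of "CHAR('k)" x] by simp
  have "\<exists>y. x = frob y" for x :: "'k witt"
  proof transfer
    fix x :: "nat \<Rightarrow> 'k"
    have "\<forall>n. \<exists>y. x n = y ^ CHAR('k)" using ex by metis
    thus "\<exists>y. x = (\<lambda>n. y n ^ CHAR('k))" by (auto dest!: choice)
  qed
  hence "surj (frob :: 'k witt \<Rightarrow> _)" by (simp add: surj_def)
  thus ?thesis by (simp add: bij_def inj_frob)
qed

text \<open>The extension of the Frobenius to the field of fractions.\<close>

definition frob_fract :: "'a::idom_prime_char witt fract \<Rightarrow> 'a witt fract" where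
  "frob_fract q = (THE r. \<exists>a b. b \<noteq> 0 \<and> q = Fract a b \<and> r = Fract (frob a) (frob b))"

lemma frob_eq_0_iff [simp]: "frob x = 0 \<longleftrightarrow> x = 0"
proof -
  have "frob x = frob 0 \<longleftrightarrow> x = 0" by (rule inj_eq[OF inj_frob])
  thus ?thesis by (simp only: hom_0[OF is_ring_hom_frob])
qed

lemma frob_fract_Fract:
  assumes "b \<noteq> 0"
  shows "frob_fract (Fract a b) = Fract (frob a) (frob b)"
  unfolding frob_fract_def
proof (rule the_equality)
  show "\<exists>a' b'. b' \<noteq> 0 \<and> Fract a b = Fract a' b' \<and> Fract (frob a) (frob b) = Fract (frob a') (frob b')"
    using assms by blast
  fix r assume "\<exists>a' b'. b' \<noteq> 0 \<and> Fract a b = Fract a' b' \<and> r = Fract (frob a') (frob b')"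
  then obtain a' b' where r: "b' \<noteq> 0" "Fract a b = Fract a' b'" "r = Fract (frob a') (frob b')"
    by blast
  hence "a * b' = a' * b" using assms by (simp only: eq_fract(1) not_False_eq_True)
  hence "frob a * frob b' = frob a' * frob b" by (metis frob_mult)
  thus "r = Fract (frob a) (frob b)" using assms r(1) by (simp add: r(3) eq_fract)
qed

section \<open>The Dieudonne ring\<close>

definition frob_pow :: "int \<Rightarrow> 'k::{alg_closed_field, field_prime_char} witt \<Rightarrow> 'k witt" where
  "frob_pow n = (if n \<ge> 0 then frob ^^ nat n else inv frob ^^ nat (- n))"

lemma frob_inv [simp]: "frob (inv frob w) = w" "inv frob (frob w) = w"
  for w :: "'k::{alg_closed_field, field_prime_char} witt"
  using bij_frob[where ?'k = 'k] by (simp_all add: bij_def surj_f_inv_f)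

lemma frob_pow_0 [simp]: "frob_pow 0 w = w"
  by (simp add: frob_pow_def)

lemma frob_pow_1 [simp]: "frob_pow 1 w = frob w"
  by (simp add: frob_pow_def)

lemma frob_pow_Suc: "frob_pow (n + 1) w = frob (frob_pow n w)"
proof (cases "n \<ge> 0")
  case True
  thus ?thesis by (simp add: frob_pow_def nat_add_distrib)
next
  case False
  then obtain m where m: "n = - int (Suc m)" by (metis negD not_le)
  have "frob_pow (n + 1) w = (inv frob ^^ m) w"
    by (cases "m = 0") (simp_all add: m frob_pow_def)
  moreover have "frob_pow n w = inv frob ((inv frob ^^ m) w)"
    unfolding m frob_pow_def by (simp del: of_nat_Suc)
  ultimately show ?thesis by simp
qed

lemma frob_pow_pred: "frob_pow (n - 1) w = inv frob (frob_pow n w)"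
  using frob_pow_Suc[of "n - 1" w] by simp

lemma frob_pow_add: "frob_pow (n + m) w = frob_pow n (frob_pow m w)"
proof (induction n rule: int_induct[where k = 0])
  case (step1 i)
  have "frob_pow (i + 1 + m) w = frob (frob_pow (i + m) w)"
    by (subst frob_pow_Suc[symmetric]) (simp add: add_ac)
  thus ?case using step1 by (simp only: frob_pow_Suc)
next
  case (step2 i)
  have "frob_pow (i - 1 + m) w = inv frob (frob_pow (i + m) w)"
    by (subst frob_pow_pred[symmetric]) (simp add: algebra_simps)
  thus ?case using step2 by (simp only: frob_pow_pred)
qed simp

lemma is_ring_hom_inv_frob: "is_ring_hom (inv (frob :: 'k::{alg_closed_field, field_prime_char} witt \<Rightarrow> _))"
proof -
  have "inv frob (1::'k witt) = 1" by (metis frob_inv(2) frob_1)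
  moreover have "inv frob (x + y) = inv frob x + inv frob y" for x y :: "'k witt"
    by (metis frob_inv frob_add)
  moreover have "inv frob (x * y) = inv frob x * inv frob y" for x y :: "'k witt"
    by (metis frob_inv frob_mult)
  ultimately show ?thesis by (simp add: is_ring_hom_def)
qed

lemma is_ring_hom_frob_pow: "is_ring_hom (frob_pow n)"
proof (induction n rule: int_induct[where k = 0])
  case base
  show ?case by (simp add: is_ring_hom_def)
next
  case (step1 i)
  thus ?case by (simp add: is_ring_hom_def frob_pow_Suc hom_simps[OF is_ring_hom_frob])
next
  case (step2 i)
  thus ?case by (simp add: is_ring_hom_def frob_pow_pred hom_simps[OF is_ring_hom_inv_frob])
qed

text \<open>
  Writing \<open>\<tau> n\<close> for \<open>F ^ n\<close> if \<open>n \<ge> 0\<close> and for \<open>V ^ (- n)\<close> if \<open>n \<le> 0\<close>, the relations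
  \<open>FV = VF = p\<close> give \<open>\<tau> n * \<tau> m = p ^ defect n m * \<tau> (n + m)\<close>.
\<close>

definition defect :: "int \<Rightarrow> int \<Rightarrow> nat" where
  "defect n m = (if n \<ge> 0 \<and> m \<le> 0 \<or> n \<le> 0 \<and> m \<ge> 0 then nat (min \<bar>n\<bar> \<bar>m\<bar>) else 0)"

lemma defect_simps [simp]: "defect 0 m = 0" "defect n 0 = 0"
  by (auto simp: defect_def)

lemma defect_assoc: "defect n m + defect (n + m) l = defect m l + defect n (m + l)"
proof -
  have d: "int (defect n m) * 2 = \<bar>n\<bar> + \<bar>m\<bar> - \<bar>n + m\<bar>" for n m
    unfolding defect_def by auto
  have "int (defect n m) * 2 + int (defect (n + m) l) * 2 = int (defect m l) * 2 + int (defect n (m + l)) * 2"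
    unfolding d by (simp add: algebra_simps)
  thus ?thesis by linarith
qed

text \<open>
  The ring generated over the Witt vectors by \<open>F\<close> and \<open>V\<close> subject to \<open>F w = \<sigma>(w) F\<close>,
  \<open>w V = V \<sigma>(w)\<close> and \<open>FV = VF = p\<close> is free as a left module over the Witt vectors on the
  elements \<open>\<tau> n\<close> above, with \<open>\<tau> n * w = \<sigma>\<^sup>n(w) * \<tau> n\<close>.  An element is given by its
  coefficients with respect to this basis.
\<close>

typedef (overloaded) 'k dieud = "UNIV :: (int \<Rightarrow>\<^sub>0 'k::{alg_closed_field, field_prime_char} witt) set"
  morphisms dcoeffs Dieud ..

setup_lifting type_definition_dieud

definition dieud_mult :: "(int \<Rightarrow>\<^sub>0 'k::{alg_closed_field, field_prime_char} witt) \<Rightarrow> (int \<Rightarrow>\<^sub>0 'k witt) \<Rightarrow> (int \<Rightarrow>\<^sub>0 'k witt)" where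
  "dieud_mult x y = (\<Sum>n\<in>Poly_Mapping.keys x. \<Sum>m\<in>Poly_Mapping.keys y.
     Poly_Mapping.single (n + m)
       (of_nat CHAR('k) ^ defect n m * Poly_Mapping.lookup x n * frob_pow n (Poly_Mapping.lookup y m)))"

lemma dieud_mult_psum: "dieud_mult x y = psum (\<lambda>n a. psum (\<lambda>m b. Poly_Mapping.single (n + m)
       (of_nat CHAR('k) ^ defect n m * a * frob_pow n b)) y) x"
  for x :: "int \<Rightarrow>\<^sub>0 'k::{alg_closed_field, field_prime_char} witt"
  by (simp add: dieud_mult_def psum_def)

lemma psum_zero_fun [simp]: "psum (\<lambda>_ _. 0) x = 0"
  by (simp add: psum_def)

lemma psum_add_fun: "psum (\<lambda>k a. s k a + t k a) x = psum s x + psum t x"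
  by (simp add: psum_def sum.distrib)

lemma dieud_mult_add_left: "dieud_mult (x + y) z = dieud_mult x z + dieud_mult y z"
  unfolding dieud_mult_psum
  by (rule psum_add) (simp_all add: distrib_left distrib_right Poly_Mapping.single_add psum_add_fun)

lemma dieud_mult_add_right: "dieud_mult x (y + z) = dieud_mult x y + dieud_mult x z"
  unfolding dieud_mult_psum
  by (subst psum_add, simp_all add: hom_simps[OF is_ring_hom_frob_pow] distrib_left Poly_Mapping.single_add psum_add_fun)

lemma dieud_mult_0 [simp]: "dieud_mult 0 x = 0" "dieud_mult x 0 = 0"
  by (simp_all add: dieud_mult_def)

lemma dieud_mult_single: "dieud_mult (Poly_Mapping.single n a) (Poly_Mapping.single m b) =
   Poly_Mapping.single (n + m) (of_nat CHAR('k) ^ defect n m * a * frob_pow n b)"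
  for a b :: "'k::{alg_closed_field, field_prime_char} witt"
  unfolding dieud_mult_psum
  by (simp add: psum_single hom_simps[OF is_ring_hom_frob_pow])

lemma dieud_mult_assoc: "dieud_mult (dieud_mult x y) z = dieud_mult x (dieud_mult y z)"
  for x y z :: "int \<Rightarrow>\<^sub>0 'k::{alg_closed_field, field_prime_char} witt"
proof (induction x rule: poly_mapping_single_induct)
  case (single_add n a x)
  have "dieud_mult (dieud_mult (Poly_Mapping.single n a) y) z = dieud_mult (Poly_Mapping.single n a) (dieud_mult y z)"
  proof (induction y rule: poly_mapping_single_induct)
    case (single_add m b y)
    have "dieud_mult (dieud_mult (Poly_Mapping.single n a) (Poly_Mapping.single m b)) z =
       dieud_mult (Poly_Mapping.single n a) (dieud_mult (Poly_Mapping.single m b) z)"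
    proof (induction z rule: poly_mapping_single_induct)
      case (single_add l c z)
      let ?p = "of_nat CHAR('k) :: 'k witt"
      have "?p ^ defect (n + m) l * (?p ^ defect n m * a * frob_pow n b) * frob_pow (n + m) c =
        ?p ^ (defect n m + defect (n + m) l) * (a * frob_pow n b * frob_pow (n + m) c)"
        by (simp add: power_add algebra_simps)
      also have "\<dots> = ?p ^ defect n (m + l) * a * frob_pow n (?p ^ defect m l * b * frob_pow m c)"
        unfolding defect_assoc
        by (simp add: power_add hom_simps[OF is_ring_hom_frob_pow] frob_pow_add mult_ac)
      finally have eq: "?p ^ defect (n + m) l * (?p ^ defect n m * a * frob_pow n b) * frob_pow (n + m) c = \<dots>" .
      show ?case
        using single_add by (simp only: dieud_mult_add_right dieud_mult_single add.assoc eq)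
    qed auto
    thus ?case using single_add by (simp add: dieud_mult_add_left dieud_mult_add_right)
  qed auto
  thus ?case using single_add by (simp add: dieud_mult_add_left)
qed auto

instantiation dieud :: ("{alg_closed_field, field_prime_char}") ring_1
begin

lift_definition zero_dieud :: "'a dieud" is 0 .
lift_definition one_dieud :: "'a dieud" is "Poly_Mapping.single 0 1" .
lift_definition plus_dieud :: "'a dieud \<Rightarrow> 'a dieud \<Rightarrow> 'a dieud" is "(+)" .
lift_definition minus_dieud :: "'a dieud \<Rightarrow> 'a dieud \<Rightarrow> 'a dieud" is "(-)" .
lift_definition uminus_dieud :: "'a dieud \<Rightarrow> 'a dieud" is "uminus" .
lift_definition times_dieud :: "'a dieud \<Rightarrow> 'a dieud \<Rightarrow> 'a dieud" is dieud_mult .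

instance
proof
  fix a b c :: "'a dieud"
  show "1 * a = a"
  proof transfer
    fix a :: "int \<Rightarrow>\<^sub>0 'a witt"
    show "dieud_mult (Poly_Mapping.single 0 1) a = a"
      by (induction a rule: poly_mapping_single_induct) (simp_all add: dieud_mult_add_right dieud_mult_single del: single_one)
  qed
  show "a * 1 = a"
  proof transfer
    fix a :: "int \<Rightarrow>\<^sub>0 'a witt"
    show "dieud_mult a (Poly_Mapping.single 0 1) = a"
      by (induction a rule: poly_mapping_single_induct)
         (simp_all add: dieud_mult_add_left dieud_mult_single hom_simps[OF is_ring_hom_frob_pow] del: single_one)
  qed
  show "(0::'a dieud) \<noteq> 1" by transfer (metis lookup_single_eq lookup_zero zero_neq_one)
qed (transfer, simp add: dieud_mult_assoc dieud_mult_add_left dieud_mult_add_right add_ac)+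

end

definition of_witt :: "'k::{alg_closed_field, field_prime_char} witt \<Rightarrow> 'k dieud" where
  "of_witt w = Dieud (Poly_Mapping.single 0 w)"

definition dF :: "'k::{alg_closed_field, field_prime_char} dieud" where
  "dF = Dieud (Poly_Mapping.single 1 1)"

definition dV :: "'k::{alg_closed_field, field_prime_char} dieud" where
  "dV = Dieud (Poly_Mapping.single (- 1) 1)"

lemma of_witt_add: "of_witt (x + y) = of_witt x + of_witt y"
  by (simp add: of_witt_def plus_dieud.abs_eq Poly_Mapping.single_add)

lemma of_witt_mult: "of_witt (x * y) = of_witt x * of_witt y"
  by (simp add: of_witt_def times_dieud.abs_eq dieud_mult_single)

lemma of_witt_1 [simp]: "of_witt 1 = 1"
  by (simp add: of_witt_def one_dieud_def)

lemma of_witt_0 [simp]: "of_witt 0 = 0"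
  by (simp add: of_witt_def zero_dieud_def)

lemma of_witt_of_nat [simp]: "of_witt (of_nat n) = of_nat n"
  by (induction n) (simp_all add: of_witt_add)

lemma dF_of_witt: "dF * of_witt w = of_witt (frob w) * dF"
  by (simp add: of_witt_def dF_def times_dieud.abs_eq dieud_mult_single del: single_one)

lemma of_witt_dV: "of_witt w * dV = dV * of_witt (frob w)"
  by (simp add: of_witt_def dV_def times_dieud.abs_eq dieud_mult_single frob_pow_def del: single_one)

lemma dF_dV: "dF * dV = (of_nat CHAR('k) :: 'k::{alg_closed_field, field_prime_char} dieud)"
proof -
  have "dF * dV = of_witt (of_nat CHAR('k) :: 'k witt)"
    by (simp add: of_witt_def dF_def dV_def times_dieud.abs_eq dieud_mult_single defect_def frob_1 del: single_one single_of_nat)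
  thus ?thesis by simp
qed

lemma dV_dF: "dV * dF = (of_nat CHAR('k) :: 'k::{alg_closed_field, field_prime_char} dieud)"
proof -
  have "dV * dF = of_witt (of_nat CHAR('k) :: 'k witt)"
    by (simp add: of_witt_def dF_def dV_def times_dieud.abs_eq dieud_mult_single defect_def
        hom_1[OF is_ring_hom_frob_pow] del: single_one single_of_nat)
  thus ?thesis by simp
qed

section \<open>The modules $A_{1,1}$ and $A_{1,1}^{\oplus g}$\<close>

lifting_update dieud.lifting
lifting_forget dieud.lifting

text \<open>The quotient of the Dieudonne ring by the left ideal generated by \<open>F - V\<close>.\<close>

quotient_type (overloaded) 'k A11 = "'k::{alg_closed_field, field_prime_char} dieud" /
  "\<lambda>x y. \<exists>d. x - y = d * (dF - dV)"
proof (rule equivpI)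
  show "reflp (\<lambda>x y :: 'k dieud. \<exists>d. x - y = d * (dF - dV))"
    by (rule reflpI) (metis diff_self mult_zero_left)
  show "symp (\<lambda>x y :: 'k dieud. \<exists>d. x - y = d * (dF - dV))"
    by (rule sympI) (metis minus_diff_eq mult_minus_left)
  show "transp (\<lambda>x y :: 'k dieud. \<exists>d. x - y = d * (dF - dV))"
    by (rule transpI) (metis diff_add_cancel add_diff_eq distrib_right)
qed

instantiation A11 :: ("{alg_closed_field, field_prime_char}") ab_group_add
begin

lift_definition zero_A11 :: "'a A11" is 0 .
lift_definition plus_A11 :: "'a A11 \<Rightarrow> 'a A11 \<Rightarrow> 'a A11" is "(+)"
  by (metis add_diff_add distrib_right)
lift_definition uminus_A11 :: "'a A11 \<Rightarrow> 'a A11" is uminus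
  by (metis minus_diff_eq minus_diff_minus mult_minus_left)
definition minus_A11 :: "'a A11 \<Rightarrow> 'a A11 \<Rightarrow> 'a A11" where "minus_A11 x y = x + - y"

instance
proof
  fix a b c :: "'a A11"
  show "a + b + c = a + (b + c)" "a + b = b + a" "0 + a = a" "- a + a = 0"
    by (transfer, simp add: add_ac, metis diff_self mult_zero_left)+
qed (rule minus_A11_def)

end

lift_definition A11_act :: "'k::{alg_closed_field, field_prime_char} dieud \<Rightarrow> 'k A11 \<Rightarrow> 'k A11" is "(*)"
  by (metis mult.assoc right_diff_distrib)

locale left_module =
  fixes act :: "'r::ring_1 \<Rightarrow> 'm::ab_group_add \<Rightarrow> 'm"
  assumes act_add_left: "act (r + s) x = act r x + act s x"
    and act_add_right: "act r (x + y) = act r x + act r y"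
    and act_act: "act r (act s x) = act (r * s) x"
    and act_one: "act 1 x = x"

definition submodule :: "('r::ring_1 \<Rightarrow> 'm::ab_group_add \<Rightarrow> 'm) \<Rightarrow> 'm set \<Rightarrow> bool" where
  "submodule act M \<longleftrightarrow> 0 \<in> M \<and> (\<forall>x\<in>M. \<forall>y\<in>M. x + y \<in> M) \<and> (\<forall>r. \<forall>x\<in>M. act r x \<in> M)"

definition module_hom_on ::
  "('r::ring_1 \<Rightarrow> 'm::ab_group_add \<Rightarrow> 'm) \<Rightarrow> 'm set \<Rightarrow> ('r \<Rightarrow> 'n::ab_group_add \<Rightarrow> 'n) \<Rightarrow> 'n set \<Rightarrow> ('m \<Rightarrow> 'n) \<Rightarrow> bool"
  where
  "module_hom_on act M act' M' \<phi> \<longleftrightarrow> \<phi> ` M \<subseteq> M' \<and>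
     (\<forall>x\<in>M. \<forall>y\<in>M. \<phi> (x + y) = \<phi> x + \<phi> y) \<and> (\<forall>r. \<forall>x\<in>M. \<phi> (act r x) = act' r (\<phi> x))"

lemma left_module_A11: "left_module A11_act"
proof
  fix r s :: "'a dieud" and x y :: "'a A11"
  show "A11_act (r + s) x = A11_act r x + A11_act s x"
    by transfer (metis diff_self distrib_right mult_zero_left)
  show "A11_act r (x + y) = A11_act r x + A11_act r y"
    by transfer (metis diff_self distrib_left mult_zero_left)
  show "A11_act r (A11_act s x) = A11_act (r * s) x"
    by transfer (metis diff_self mult.assoc mult_zero_left)
  show "A11_act 1 x = x"
    by transfer (metis diff_self mult_1 mult_zero_left)
qed

text \<open>Direct sums are finitely supported families; summands are numbered by \<open>0, \<dots>, g - 1\<close>.\<close>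

definition A11_sum :: "nat \<Rightarrow> (nat \<Rightarrow>\<^sub>0 'k::{alg_closed_field, field_prime_char} A11) set" where
  "A11_sum g = {x. Poly_Mapping.keys x \<subseteq> {..<g}}"

definition A11_sum_act ::
  "'k::{alg_closed_field, field_prime_char} dieud \<Rightarrow> (nat \<Rightarrow>\<^sub>0 'k A11) \<Rightarrow> (nat \<Rightarrow>\<^sub>0 'k A11)" where
  "A11_sum_act d = Poly_Mapping.map (A11_act d)"

lemma left_module_A11_sum: "left_module (A11_sum_act :: 'k::{alg_closed_field, field_prime_char} dieud \<Rightarrow> _)"
proof -
  interpret A: left_module "A11_act :: 'k dieud \<Rightarrow> _" by (rule left_module_A11)
  have zero: "A11_act d 0 = 0" for d :: "'k dieud" using A.act_add_right[of d 0 0] by simp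
  have lk: "Poly_Mapping.lookup (A11_sum_act d x) i = A11_act d (Poly_Mapping.lookup x i)"
    for d :: "'k dieud" and x i
    by (simp add: A11_sum_act_def map.rep_eq when_def zero)
  show ?thesis
    by unfold_locales
       (simp_all add: poly_mapping_eq_iff fun_eq_iff lookup_add lk A.act_add_left A.act_add_right A.act_act A.act_one)
qed

section \<open>Dieudonne modules\<close>

definition witt_basis ::
  "('k::{alg_closed_field, field_prime_char} dieud \<Rightarrow> 'm::ab_group_add \<Rightarrow> 'm) \<Rightarrow> 'm set \<Rightarrow> 'i set \<Rightarrow> ('i \<Rightarrow> 'm) \<Rightarrow> bool"
  where
  "witt_basis act M I b \<longleftrightarrow> finite I \<and> b ` I \<subseteq> M \<and>
     (\<forall>x\<in>M. \<exists>!w. (\<forall>i. i \<notin> I \<longrightarrow> w i = 0) \<and> x = (\<Sum>i\<in>I. act (of_witt (w i)) (b i)))"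

text \<open>
  Free Dieudonne modules of genus \<open>g\<close>, that is of rank \<open>2 * g\<close>, as subsets of an ambient left
  module \<open>act\<close> over the Dieudonne ring.
\<close>

definition dieudonne_module ::
  "('k::{alg_closed_field, field_prime_char} dieud \<Rightarrow> 'm::ab_group_add \<Rightarrow> 'm) \<Rightarrow> nat \<Rightarrow> 'm set \<Rightarrow> bool" where
  "dieudonne_module act g M \<longleftrightarrow> submodule act M \<and> (\<exists>b. witt_basis act M {..<2 * g} b)"

text \<open>Supersingular means isogenous to $A_{1,1}^{\oplus g}$.\<close>

definition supersingular ::
  "('k::{alg_closed_field, field_prime_char} dieud \<Rightarrow> 'm::ab_group_add \<Rightarrow> 'm) \<Rightarrow> nat \<Rightarrow> 'm set \<Rightarrow> bool" where
  "supersingular act g M \<longleftrightarrow> dieudonne_module act g M \<and>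
     (\<exists>\<phi>. module_hom_on A11_sum_act (A11_sum g) act M \<phi> \<and> inj_on \<phi> (A11_sum g) \<and>
       (\<exists>n. \<forall>x\<in>M. act (of_nat (CHAR('k) ^ n)) x \<in> \<phi> ` A11_sum g))"

definition iso_A11_sum ::
  "('k::{alg_closed_field, field_prime_char} dieud \<Rightarrow> 'm::ab_group_add \<Rightarrow> 'm) \<Rightarrow> nat \<Rightarrow> 'm set \<Rightarrow> bool" where
  "iso_A11_sum act g M \<longleftrightarrow>
     (\<exists>\<phi>. module_hom_on A11_sum_act (A11_sum g) act M \<phi> \<and> bij_betw \<phi> (A11_sum g) M)"

text \<open>
  \<open>dim\<^sub>k (M / L) = n\<close>, by way of a \<open>k\<close>-basis of the quotient.  This is used when \<open>p M \<subseteq> L\<close>, so that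
  \<open>c \<in> k = W(k)/p\<close> acts on \<open>M / L\<close> through any of its lifts, in particular the Teichmueller lift.
\<close>

definition quotient_dim ::
  "('k::{alg_closed_field, field_prime_char} dieud \<Rightarrow> 'm::ab_group_add \<Rightarrow> 'm) \<Rightarrow> 'm set \<Rightarrow> 'm set \<Rightarrow> nat \<Rightarrow> bool" where
  "quotient_dim act M L n \<longleftrightarrow> (\<exists>b. b ` {..<n} \<subseteq> M \<and>
     (\<forall>x\<in>M. \<exists>!c. (\<forall>j\<ge>n. c j = 0) \<and> x - (\<Sum>j<n. act (of_witt (teich (c j))) (b j)) \<in> L))"

section \<open>Polarised flag type quotients\<close>

text \<open>
  The ambient space plays the role of \<open>M \<otimes> Frac(W(k))\<close>: a vector space over the fraction field
  with compatible operators \<open>F\<close> and \<open>V\<close>, together with the extension of a \<open>W(k)\<close>-bilinear form on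
  \<open>M\<close> to a bilinear form over the fraction field.  The modules are subsets of it and carry the
  restricted form.
\<close>

locale rational_dieudonne = vector_space scale + left_module act
  for scale :: "'k::{alg_closed_field, field_prime_char} witt fract \<Rightarrow> 'v::ab_group_add \<Rightarrow> 'v"
    and act :: "'k dieud \<Rightarrow> 'v \<Rightarrow> 'v" +
  fixes form :: "'v \<Rightarrow> 'v \<Rightarrow> 'k witt fract"
  assumes act_of_witt: "act (of_witt w) x = scale (to_fract w) x"
    and form_linear_left: "Vector_Spaces.linear scale (*) (\<lambda>x. form x y)"
    and form_linear_right: "Vector_Spaces.linear scale (*) (form x)"

text \<open>
  Bilinearity is part of \<open>rational_dieudonne\<close>; the properties below are only required on \<open>M\<close>.
\<close>

definition quasi_polarised ::
  "('k::{alg_closed_field, field_prime_char} dieud \<Rightarrow> 'v::ab_group_add \<Rightarrow> 'v) \<Rightarrow> ('v \<Rightarrow> 'v \<Rightarrow> 'k witt fract) \<Rightarrow> 'v set \<Rightarrow> bool"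
  where
  "quasi_polarised act form M \<longleftrightarrow>
     (\<forall>x\<in>M. form x x = 0) \<and>
     (\<forall>x\<in>M. (\<forall>y\<in>M. form x y = 0) \<longrightarrow> x = 0) \<and>
     (\<forall>x\<in>M. \<forall>y\<in>M. form (act dF x) y = frob_fract (form x (act dV y)))"

text \<open>Here \<open>module.span scale M\<close> is \<open>M \<otimes> Frac(W(k))\<close> and \<open>range to_fract\<close> is \<open>W(k)\<close>.\<close>

definition dual ::
  "('k::{alg_closed_field, field_prime_char} witt fract \<Rightarrow> 'v::ab_group_add \<Rightarrow> 'v) \<Rightarrow> ('v \<Rightarrow> 'v \<Rightarrow> 'k witt fract) \<Rightarrow>
   'v set \<Rightarrow> 'v set" where
  "dual scale form M = {x \<in> module.span scale M. \<forall>y\<in>M. form x y \<in> range to_fract}"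

text \<open>Only the values \<open>M i\<close> with \<open>m \<le> i \<le> g - 1\<close> are part of the data.\<close>

definition truncated_pftq ::
  "('k::{alg_closed_field, field_prime_char} witt fract \<Rightarrow> 'v::ab_group_add \<Rightarrow> 'v) \<Rightarrow> ('k dieud \<Rightarrow> 'v \<Rightarrow> 'v) \<Rightarrow>
   ('v \<Rightarrow> 'v \<Rightarrow> 'k witt fract) \<Rightarrow> nat \<Rightarrow> nat \<Rightarrow> (nat \<Rightarrow> 'v set) \<Rightarrow> bool" where
  "truncated_pftq scale act form g m M \<longleftrightarrow>
     (\<forall>i\<in>{m..g - 1}. supersingular act g (M i) \<and> quasi_polarised act form (M i)) \<and>
     (\<forall>i\<in>{m<..g - 1}. M (i - 1) \<subseteq> M i) \<and>
     iso_A11_sum act g (M (g - 1)) \<and>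
     dual scale form (M (g - 1)) = act (dF ^ (g - 1)) ` M (g - 1) \<and>
     (\<forall>i\<in>{m<..g - 1}. act dF ` M i \<union> act dV ` M i \<subseteq> M (i - 1) \<and> quotient_dim act (M i) (M (i - 1)) i) \<and>
     (\<forall>i\<in>{m..g - 1}. \<forall>j\<le>i div 2. act (dF ^ (i - j) * dV ^ j) ` M i \<subseteq> dual scale form (M i))"

definition normal_form_basis ::
  "('k::{alg_closed_field, field_prime_char} dieud \<Rightarrow> 'v::ab_group_add \<Rightarrow> 'v) \<Rightarrow> ('v \<Rightarrow> 'v \<Rightarrow> 'k witt fract) \<Rightarrow>
   nat \<Rightarrow> 'v set \<Rightarrow> (nat \<Rightarrow> 'v) \<Rightarrow> (nat \<Rightarrow> 'v) \<Rightarrow> bool" where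
  "normal_form_basis act form g M e f \<longleftrightarrow>
     witt_basis act M ({1..g} <+> {1..g}) (case_sum e f) \<and>
     (if odd g then
        (\<forall>i\<in>{1..g}.
           act dF (e i) = f i \<and> act dV (e i) = - f i \<and>
           act dF (f i) = - act (of_nat CHAR('k)) (e i) \<and> act dV (f i) = act (of_nat CHAR('k)) (e i)) \<and>
        (\<forall>i\<in>{1..g}. \<forall>j\<in>{1..g}.
           form (e i) (e j) = 0 \<and> form (f i) (f j) = 0 \<and>
           form (e i) (f j) = (if i = j then of_nat CHAR('k) powi (- ((int g - 1) div 2)) else 0) \<and>
           form (f i) (e j) = (if i = j then - (of_nat CHAR('k) powi (- ((int g - 1) div 2))) else 0))
      else
        (\<forall>i\<in>{1..g}.
           act dF (e i) = f i \<and> act dV (e i) = f i \<and>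
           act dF (f i) = act (of_nat CHAR('k)) (e i) \<and> act dV (f i) = act (of_nat CHAR('k)) (e i)) \<and>
        (\<forall>i\<in>{1..g}. \<forall>j\<in>{1..g}.
           form (e i) (f j) = 0 \<and> form (f i) (e j) = 0 \<and>
           form (e i) (e j) =
             (if odd i \<and> j = i + 1 then of_nat CHAR('k) powi (- (int g div 2))
              else if odd j \<and> i = j + 1 then - (of_nat CHAR('k) powi (- (int g div 2))) else 0) \<and>
           form (f i) (f j) =
             (if odd i \<and> j = i + 1 then of_nat CHAR('k) powi (- (int g div 2) + 1)
              else if odd j \<and> i = j + 1 then - (of_nat CHAR('k) powi (- (int g div 2) + 1)) else 0)))"

section \<open>The fiber of the truncation morphism\<close>

definition first_step ::
  "('k::{alg_closed_field, field_prime_char} dieud \<Rightarrow> 'v::ab_group_add \<Rightarrow> 'v) \<Rightarrow> nat \<Rightarrow> 'v set \<Rightarrow> (nat \<Rightarrow> 'v) \<Rightarrow>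
   (nat \<Rightarrow> 'k) \<Rightarrow> 'v set" where
  "first_step act g M e \<alpha> = module.span (\<lambda>w. act (of_witt w))
     ({\<Sum>i=1..g. act (of_witt (teich (\<alpha> i))) (e i)} \<union> act dF ` M \<union> act dV ` M)"

text \<open>
  Points of the projective space of dimension \<open>g - 1\<close>, as classes of nonzero tuples indexed by
  \<open>1, \<dots>, g\<close>; outside this range the tuples are padded by \<open>0\<close>.
\<close>

definition homogeneous_coords :: "nat \<Rightarrow> (nat \<Rightarrow> 'k::field) set" where
  "homogeneous_coords g = {\<alpha>. (\<forall>i. i \<notin> {1..g} \<longrightarrow> \<alpha> i = 0) \<and> (\<exists>i. \<alpha> i \<noteq> 0)}"

definition proj_space :: "nat \<Rightarrow> (nat \<Rightarrow> 'k::field) set set" where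
  "proj_space g = homogeneous_coords g //
     {(\<alpha>, \<beta>). \<alpha> \<in> homogeneous_coords g \<and> \<beta> \<in> homogeneous_coords g \<and> (\<exists>c. c \<noteq> 0 \<and> \<beta> = (\<lambda>i. c * \<alpha> i))}"

definition truncation_fiber ::
  "('k::{alg_closed_field, field_prime_char} witt fract \<Rightarrow> 'v::ab_group_add \<Rightarrow> 'v) \<Rightarrow> ('k dieud \<Rightarrow> 'v \<Rightarrow> 'v) \<Rightarrow>
   ('v \<Rightarrow> 'v \<Rightarrow> 'k witt fract) \<Rightarrow> nat \<Rightarrow> 'v set \<Rightarrow> 'v set set" where
  "truncation_fiber scale act form g M =
     {L. truncated_pftq scale act form g (g - 2) (\<lambda>i. if i = g - 1 then M else L)}"

text \<open>
  The equations are homogeneous, and the first conjunct says that the submodule attached to a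
  point does not depend on the representative.
\<close>

definition fiber_given_by ::
  "('k::{alg_closed_field, field_prime_char} witt fract \<Rightarrow> 'v::ab_group_add \<Rightarrow> 'v) \<Rightarrow> ('k dieud \<Rightarrow> 'v \<Rightarrow> 'v) \<Rightarrow>
   ('v \<Rightarrow> 'v \<Rightarrow> 'k witt fract) \<Rightarrow> nat \<Rightarrow> 'v set \<Rightarrow> (nat \<Rightarrow> 'v) \<Rightarrow> ((nat \<Rightarrow> 'k) \<Rightarrow> bool) \<Rightarrow> bool" where
  "fiber_given_by scale act form g M e E \<longleftrightarrow>
     (\<exists>\<Phi>. (\<forall>P\<in>proj_space g. \<forall>\<alpha>\<in>P. \<Phi> P = first_step act g M e \<alpha>) \<and>
       bij_betw \<Phi> {P \<in> proj_space g. \<forall>\<alpha>\<in>P. E \<alpha>} (truncation_fiber scale act form g M))"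

end

theory Submission
  imports Defs "HOL-Library.Function_Algebras"
begin

text \<open>
  Write \<open>W = W(k)\<close>, \<open>M\<close> for the top module and \<open>x\<^sub>\<alpha>\<close> for the element \<open>\<Sum> teich(\<alpha>\<^sub>i) e\<^sub>i\<close> of \<open>M\<close>.

  The submodule \<open>FM = VM\<close> is spanned by the \<open>p e\<^sub>i\<close> and the \<open>f\<^sub>i\<close>, so reducing the
  \<open>e\<close>-coordinates modulo \<open>p\<close> identifies \<open>M / FM\<close> with \<open>k\<^sup>g\<close>.  A submodule \<open>L\<close> between \<open>FM\<close> and
  \<open>M\<close> is the preimage of its image in \<open>k\<^sup>g\<close>, and \<open>dim M/L = g - 1\<close> says that this image is a
  line.  The possible \<open>L\<close> are therefore the modules \<open>W x\<^sub>\<alpha> + FM\<close>, one for each point \<open>[\<alpha>]\<close> of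
  the projective space (\<open>first_step_eq\<close>, \<open>first_step_eq_iff\<close>, \<open>fiber_first_step\<close>).  Because of
  \<open>pM \<subseteq> L \<subseteq> M\<close>, each of them inherits from \<open>M\<close> all properties of a quasi-polarised supersingular
  Dieudonne module (\<open>supersingular_first_step\<close>, \<open>quasi_polarised_first_step\<close>).

  What remains is the condition that \<open>\<langle>F\<^sup>aV\<^sup>j x, y\<rangle>\<close> be integral for \<open>x, y \<in> L\<close>, where
  \<open>a = g - 2 - j\<close> and \<open>j \<le> (g - 2)/2\<close>.  It holds automatically if \<open>x\<close> or \<open>y\<close> lies in \<open>FM\<close>: an
  extra \<open>F\<close> on either side turns the pairing into one of \<open>F\<^sup>a\<^sup>+\<^sup>1V\<^sup>jM\<close> with \<open>M\<close>, which is integral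
  by the same condition one step higher.  As \<open>L = W x\<^sub>\<alpha> + FM\<close>, only the value
  \<open>\<langle>F\<^sup>aV\<^sup>j x\<^sub>\<alpha>, x\<^sub>\<alpha>\<rangle>\<close> matters (\<open>FV_word_pairing_integral_iff\<close>).  Now \<open>FV = p\<close> gives
  \<open>F\<^sup>aV\<^sup>j = p\<^sup>jF\<^sup>c\<close> with \<open>c = g - 2(j + 1)\<close>, and the normal form of the basis evaluates the pairing
  to \<open>\<plusminus> T/p\<close>, where \<open>T\<close> is the left hand side of the equation with index \<open>j + 1\<close>, formed with
  Teichmueller lifts (\<open>form_FV_word_lift_odd\<close>, \<open>form_FV_word_lift_even\<close>).  Finally \<open>T/p\<close> is
  integral if and only if \<open>T\<close> has residue \<open>0\<close> in \<open>k\<close>, since \<open>k\<close> is perfect and so \<open>pW\<close> is the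
  kernel of the residue map (\<open>residue_eq_0_iff\<close>).
\<close>

section \<open>Witt vectors modulo p\<close>

text \<open>
  The coordinates of \<open>n * x\<close> over an arbitrary ring.  They are needed over the integer polynomials,
  where ghost components determine a Witt vector, and are then specialised to \<open>k\<close>.
\<close>

definition witt_nat_mult :: "nat \<Rightarrow> (nat \<Rightarrow> 'a::comm_ring_1) \<Rightarrow> nat \<Rightarrow> nat \<Rightarrow> 'a" where
  "witt_nat_mult p x n = (witt_add p x ^^ n) (witt_teich 0)"

lemma ghost_witt_nat_mult:
  assumes "prime p"
  shows "ghost p (witt_nat_mult p x n) m = of_nat n * ghost p x m"
  by (induction n)
     (use prime_gt_0_nat[OF assms] in \<open>simp_all add: witt_nat_mult_def ghost_witt_add[OF assms]
        ghost_witt_teich power_0_left distrib_right\<close>)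

lemma hom_witt_nat_mult:
  assumes "is_ring_hom h"
  shows "h (witt_nat_mult p x n m) = witt_nat_mult p (\<lambda>i. h (x i)) n m"
  by (induction n arbitrary: m)
     (simp_all add: witt_nat_mult_def hom_witt_add[OF assms] hom_witt_teich[OF assms] hom_0[OF assms])

lemma wcoord_of_nat_mult:
  fixes w :: "'a::idom_prime_char witt"
  shows "wcoord (of_nat n * w) = witt_nat_mult CHAR('a) (wcoord w) n"
  by (induction n)
     (simp_all add: witt_nat_mult_def zero_witt.rep_eq plus_witt.rep_eq distrib_right)

text \<open>
  The \<open>n\<close>-th ghost component is \<open>p\<^sup>n z\<^sub>n\<close> plus terms \<open>p\<^sup>i z\<^sub>i\<^bsup>p^(n-i)\<^esup>\<close> with \<open>i < n\<close>.  If \<open>z\<^sub>i\<close> and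
  \<open>y\<^sub>i\<close> agree modulo \<open>p\<close>, these terms agree modulo \<open>p\<^sup>n\<^sup>+\<^sup>1\<close>, so one may divide by \<open>p\<^sup>n\<close>.
\<close>

lemma witt_congI:
  fixes y z :: "nat \<Rightarrow> zpoly"
  assumes p: "prime p" and dvd: "\<And>n. of_nat p ^ Suc n dvd ghost p z n - ghost p y n"
  shows "of_nat p dvd z n - y n"
proof (induction n rule: less_induct)
  case (less n)
  have p0: "p > 0" using p by (simp add: prime_gt_0_nat)
  have eq: "ghost p z n - ghost p y n = 
      (\<Sum>i<n. of_nat p ^ i * (z i ^ (p ^ (n - i)) - y i ^ (p ^ (n - i)))) + of_nat p ^ n * (z n - y n)"
    by (simp add: ghost_split sum_subtractf algebra_simps)
  have "of_nat p ^ Suc n dvd (\<Sum>i<n. of_nat p ^ i * (z i ^ (p ^ (n - i)) - y i ^ (p ^ (n - i))))"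
  proof (rule dvd_sum)
    fix i assume i: "i \<in> {..<n}"
    hence "of_nat p ^ Suc (n - i) dvd z i ^ (p ^ (n - i)) - y i ^ (p ^ (n - i))"
      using dvd_power_lift[OF _ p0] less by blast
    hence "of_nat p ^ i * of_nat p ^ Suc (n - i) dvd of_nat p ^ i * (z i ^ (p ^ (n - i)) - y i ^ (p ^ (n - i)))"
      by (rule mult_dvd_mono[OF dvd_refl])
    moreover have "of_nat p ^ i * of_nat p ^ Suc (n - i) = (of_nat p ^ Suc n :: zpoly)"
      using i by (subst power_add[symmetric]) simp
    ultimately show "of_nat p ^ Suc n dvd of_nat p ^ i * (z i ^ (p ^ (n - i)) - y i ^ (p ^ (n - i)))"
      by (simp only:)
  qed
  with dvd[of n] have "of_nat p ^ Suc n dvd of_nat p ^ n * (z n - y n)"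
    unfolding eq by (subst (asm) dvd_add_right_iff)
  moreover have "(of_nat p :: zpoly) ^ n \<noteq> 0" using p0 by simp
  ultimately show ?case by (simp only: power_Suc2 dvd_mult_cancel_left) simp
qed

text \<open>
  Multiplication by \<open>p\<close> is Verschiebung after Frobenius.  The generic Witt vector \<open>p X\<close> and
  \<open>y = (0, X\<^sub>0\<^sup>p, X\<^sub>1\<^sup>p, \<dots>)\<close> have \<open>n\<close>-th ghost components that differ by \<open>p\<^sup>n\<^sup>+\<^sup>1 X\<^sub>n\<close>, hence
  congruent coordinates, and the congruence becomes an equality in characteristic \<open>p\<close>.
\<close>

lemma wcoord_p_mult:
  fixes w :: "'a::idom_prime_char witt"
  shows "wcoord (of_nat CHAR('a) * w) n = (case n of 0 \<Rightarrow> 0 | Suc m \<Rightarrow> wcoord w m ^ CHAR('a))"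
proof -
  let ?p = "CHAR('a)"
  have p: "prime ?p" by simp
  define y :: "nat \<Rightarrow> zpoly" where "y = (\<lambda>n. case n of 0 \<Rightarrow> 0 | Suc m \<Rightarrow> Var m ^ ?p)"
  have "of_nat ?p ^ Suc n dvd ghost ?p (witt_nat_mult ?p Var ?p) n - ghost ?p y n" for n
  proof (cases n)
    case 0
    thus ?thesis by (simp add: ghost_witt_nat_mult[OF p]) (simp add: ghost_def y_def)
  next
    case (Suc m)
    have "ghost ?p y n = (\<Sum>i\<le>m. of_nat ?p ^ Suc i * (Var i ^ ?p) ^ (?p ^ (m - i)))"
      unfolding Suc ghost_def
      by (subst sum.atMost_Suc_shift) (simp add: y_def power_0_left)
    also have "\<dots> = of_nat ?p * (ghost ?p Var n - of_nat ?p ^ Suc m * Var n)"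
      unfolding Suc ghost_Suc by (simp add: sum_distrib_left mult.assoc)
    finally have "ghost ?p (witt_nat_mult ?p Var ?p) n - ghost ?p y n = of_nat ?p ^ Suc n * Var n"
      by (simp add: ghost_witt_nat_mult[OF p] Suc algebra_simps)
    thus ?thesis by simp
  qed
  hence "of_nat ?p dvd witt_nat_mult ?p Var ?p n - y n" by (rule witt_congI[OF p])
  then obtain q where q: "witt_nat_mult ?p Var ?p n - y n = of_nat ?p * q" by (rule dvdE)
  define h where "h = peval (wcoord w)"
  have h: "is_ring_hom h" unfolding h_def by (rule is_ring_hom_peval)
  have "h (witt_nat_mult ?p Var ?p n - y n) = 0"
    unfolding q by (simp add: hom_simps[OF h])
  hence "witt_nat_mult ?p (wcoord w) ?p n = h (y n)"
    by (simp add: hom_simps[OF h] hom_witt_nat_mult[OF h]) (simp add: h_def)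
  thus ?thesis unfolding wcoord_of_nat_mult
    by (cases n) (simp_all add: y_def peval_simps h_def)
qed

definition residue :: "'a::idom_prime_char witt \<Rightarrow> 'a" where
  "residue w = wcoord w 0"

lemma is_ring_hom_residue: "is_ring_hom (residue :: 'a::idom_prime_char witt \<Rightarrow> 'a)"
proof -
  have p: "prime CHAR('a)" by simp
  have "sum_poly CHAR('a) 0 = Var 0 + Var 1" "prod_poly CHAR('a) 0 = Var 0 * Var 1"
    using ghost_sum_poly[OF p, of 0] ghost_prod_poly[OF p, of 0] by (simp_all add: ghost_def)
  thus ?thesis
    by (simp add: is_ring_hom_def residue_def one_witt.rep_eq plus_witt.rep_eq times_witt.rep_eq
        witt_teich_def witt_add_def witt_mult_def peval_simps interleave_def)
qed

lemmas residue_simps = hom_simps[OF is_ring_hom_residue]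

lemma residue_teich [simp]: "residue (teich a) = a"
  by (simp add: residue_def teich.rep_eq witt_teich_def)

lemma p_witt_nonzero [simp]: "(of_nat CHAR('a) :: 'a::idom_prime_char witt) \<noteq> 0"
proof
  assume "(of_nat CHAR('a) :: 'a witt) = 0"
  hence "wcoord (of_nat CHAR('a) * 1 :: 'a witt) 1 = 0" by (simp add: zero_witt.rep_eq witt_teich_def)
  moreover have "wcoord (of_nat CHAR('a) * 1 :: 'a witt) 1 = 1"
    unfolding wcoord_p_mult by (simp add: one_witt.rep_eq witt_teich_def)
  ultimately show False by simp
qed

text \<open>
  If \<open>w\<^sub>0 = 0\<close>, dividing by \<open>p\<close> means to shift the coordinates and to extract \<open>p\<close>-th roots; this is
  where \<open>k\<close> being perfect enters.
\<close>

lemma residue_eq_0_iff: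
  fixes w :: "'k::{alg_closed_field, field_prime_char} witt"
  shows "residue w = 0 \<longleftrightarrow> of_nat CHAR('k) dvd w"
proof
  assume "residue w = 0"
  have "\<forall>n. \<exists>y. y ^ CHAR('k) = wcoord w (Suc n)"
    using nth_root_exists[of "CHAR('k)"] by auto
  then obtain y where y: "\<And>n. y n ^ CHAR('k) = wcoord w (Suc n)" by metis
  have "wcoord (of_nat CHAR('k) * Witt y) = wcoord w"
  proof
    fix n show "wcoord (of_nat CHAR('k) * Witt y) n = wcoord w n"
      unfolding wcoord_p_mult using \<open>residue w = 0\<close>
      by (cases n) (simp_all add: residue_def Witt_inverse y)
  qed
  hence "w = of_nat CHAR('k) * Witt y" by (simp add: wcoord_inject)
  thus "of_nat CHAR('k) dvd w" by simp
next
  assume "of_nat CHAR('k) dvd w"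
  thus "residue w = 0" by (auto elim!: dvdE simp: residue_simps)
qed

lemma teich_mult: "teich (a * b) = teich a * teich b"
  for a b :: "'a::idom_prime_char"
proof transfer
  fix a b :: 'a
  let ?p = "CHAR('a)"
  have p: "prime ?p" by simp
  have u: "witt_mult ?p (witt_teich (Var 0)) (witt_teich (Var 1)) = witt_teich (Var 0 * Var 1)"
    by (rule ghost_inj[of ?p])
       (simp_all add: ghost_witt_mult[OF p] ghost_witt_teich power_mult_distrib)
  define h where "h = peval (\<lambda>i. if i = 0 then a else b)"
  have h: "is_ring_hom h" unfolding h_def by (rule is_ring_hom_peval)
  have "h (witt_mult ?p (witt_teich (Var 0)) (witt_teich (Var 1)) n) = h (witt_teich (Var 0 * Var 1) n)" for n
    unfolding u ..
  moreover have "h (Var 0) = a" "h (Var 1) = b" by (simp_all add: h_def)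
  ultimately show "witt_teich (a * b) = witt_mult ?p (witt_teich a) (witt_teich b)"
    by (simp add: fun_eq_iff hom_witt_mult[OF h] hom_witt_teich[OF h] hom_mult[OF h])
qed

lemma teich_1 [simp]: "teich 1 = 1"
  by (simp add: teich_def one_witt_def)

lemma teich_0 [simp]: "teich 0 = 0"
  by (simp add: teich_def zero_witt_def)

lemma frob_power_teich: "(frob ^^ n) (teich a) = teich (a ^ (CHAR('a) ^ n))"
  for a :: "'a::idom_prime_char"
  by (induction n) (simp_all add: frob_teich mult.commute flip: power_mult)

section \<open>Recognising lines by their codimension\<close>

text \<open>
  Repeated vectors in a family already are a dependence; distinct ones outnumber a spanning set.
\<close>

lemma (in vector_space) dependent_family:
  assumes "finite I" "finite T" "card T < card I" "\<And>i. i \<in> I \<Longrightarrow> x i \<in> span T"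
  shows "\<exists>c. (\<exists>i\<in>I. c i \<noteq> 0) \<and> (\<Sum>i\<in>I. scale (c i) (x i)) = 0"
proof (cases "inj_on x I")
  case True
  hence "\<not> card (x ` I) \<le> card T" using assms(3) by (simp add: card_image)
  hence "dependent (x ` I)"
    using independent_span_bound[OF assms(2), of "x ` I"] assms(4) by blast
  then obtain u where u: "\<exists>v\<in>x ` I. u v \<noteq> 0" "(\<Sum>v\<in>x ` I. scale (u v) v) = 0"
    using dependent_finite[of "x ` I"] assms(1) by auto
  show ?thesis
    by (rule exI[of _ "u \<circ> x"]) (use u True in \<open>auto simp: sum.reindex\<close>)
next
  case False
  then obtain i j where ij: "i \<in> I" "j \<in> I" "i \<noteq> j" "x i = x j" by (auto simp: inj_on_def)
  define c where "c = (\<lambda>k. if k = i then 1 else if k = j then - 1 else 0 :: 'a)"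
  have "(\<Sum>k\<in>I. scale (c k) (x k)) = (\<Sum>k\<in>{i, j}. scale (c k) (x k))"
    by (rule sum.mono_neutral_right) (use assms(1) ij in \<open>auto simp: c_def\<close>)
  also have "\<dots> = 0" using ij by (simp add: c_def)
  finally show ?thesis using ij(1) by (intro exI[of _ c]) (auto simp: c_def)
qed

lemma vector_space_functions: "vector_space (\<lambda>(c::'k::field) v (i::'i). c * v i)"
  by unfold_locales (simp_all add: fun_eq_iff algebra_simps)

lemma dependent_coordinate_vectors:
  fixes x :: "'j \<Rightarrow> 'i \<Rightarrow> 'k::field"
  assumes "finite J" "finite A" "card A < card J" "\<And>j i. j \<in> J \<Longrightarrow> i \<notin> A \<Longrightarrow> x j i = 0"
  obtains c where "\<exists>j\<in>J. c j \<noteq> 0" "\<And>i. (\<Sum>j\<in>J. c j * x j i) = 0"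
proof -
  interpret vs: vector_space "\<lambda>(c::'k) v (i::'i). c * v i" by (rule vector_space_functions)
  define unit where "unit = (\<lambda>k (i::'i). if i = k then 1 else 0 :: 'k)"
  have apply_sum: "(sum f S) i = (\<Sum>k\<in>S. f k i)" for f :: "'z \<Rightarrow> 'i \<Rightarrow> 'k" and S i
    by (induction S rule: infinite_finite_induct) auto
  have "x j \<in> vs.span (unit ` A)" if "j \<in> J" for j
  proof -
    have "x j i = (\<Sum>k\<in>A. x j k * unit k i)" for i
    proof (cases "i \<in> A")
      case True
      have "(\<Sum>k\<in>A. x j k * unit k i) = (\<Sum>k\<in>A. if i = k then x j k else 0)"
        by (intro sum.cong refl) (simp add: unit_def)
      thus ?thesis using assms(2) True by simp
    next
      case False
      hence "(\<Sum>k\<in>A. x j k * unit k i) = 0" by (intro sum.neutral) (auto simp: unit_def)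
      thus ?thesis using assms(4)[OF that False] by simp
    qed
    hence "x j = (\<Sum>k\<in>A. (\<lambda>i. x j k * unit k i))" by (intro ext) (subst apply_sum)
    also have "\<dots> \<in> vs.span (unit ` A)"
      by (intro vs.span_sum vs.span_scale vs.span_base) auto
    finally show ?thesis .
  qed
  moreover have "card (unit ` A) < card J" using card_image_le[OF assms(2), of unit] assms(3) by linarith
  ultimately obtain c where "\<exists>j\<in>J. c j \<noteq> 0" "(\<Sum>j\<in>J. (\<lambda>i. c j * x j i)) = 0"
    using vs.dependent_family[OF assms(1) finite_imageI[OF assms(2)], of unit x] by blast
  moreover from this(2) have "(\<Sum>j\<in>J. c j * x j i) = 0" for i
    by (subst (asm) fun_eq_iff) (simp only: apply_sum zero_fun_apply)
  ultimately show ?thesis by (intro that[of c])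
qed

text \<open>
  The hypotheses say that the \<open>n\<close> vectors \<open>b\<close> represent a basis of \<open>k\<^sup>A / U\<close>.  If \<open>U\<close> were
  zero, the \<open>n + 1\<close> unit vectors would be combinations of \<open>n\<close> vectors, so their rows of
  coefficients would be dependent.  If \<open>U\<close> contained two independent vectors, these and \<open>b\<close> would be
  \<open>n + 2\<close> independent vectors in dimension \<open>n + 1\<close>.
\<close>

lemma line_of_codim_1:
  fixes U :: "('i \<Rightarrow> 'k::field) set" and b :: "nat \<Rightarrow> 'i \<Rightarrow> 'k"
  assumes A: "finite A" "card A = Suc n"
    and supp: "\<And>v i. v \<in> U \<Longrightarrow> i \<notin> A \<Longrightarrow> v i = 0" "\<And>j i. j < n \<Longrightarrow> i \<notin> A \<Longrightarrow> b j i = 0"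
    and lin: "\<And>u v s t. u \<in> U \<Longrightarrow> v \<in> U \<Longrightarrow> (\<lambda>i. s * u i + t * v i) \<in> U"
    and ex: "\<And>v. (\<And>i. i \<notin> A \<Longrightarrow> v i = 0) \<Longrightarrow> \<exists>c. (\<lambda>i. v i - (\<Sum>j<n. c j * b j i)) \<in> U"
    and uniq: "\<And>c j. (\<lambda>i. \<Sum>j<n. c j * b j i) \<in> U \<Longrightarrow> j < n \<Longrightarrow> c j = 0"
  obtains u where "u \<in> U" "\<exists>i. u i \<noteq> 0" "\<And>v. v \<in> U \<Longrightarrow> \<exists>t. v = (\<lambda>i. t * u i)"
proof -
  have "\<exists>u\<in>U. \<exists>i. u i \<noteq> 0"
  proof (rule ccontr)
    assume "\<not> ?thesis"
    hence zero: "u i = 0" if "u \<in> U" for u i using that by blast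
    have "\<exists>c. \<forall>i. (if i = k then 1 else 0) = (\<Sum>j<n. c j * b j i)" if "k \<in> A" for k
      using ex[of "\<lambda>i. if i = k then 1 else 0"] zero that by fastforce
    then obtain c where c: "\<And>k i. k \<in> A \<Longrightarrow> (if i = k then 1 else 0) = (\<Sum>j<n. c k j * b j i)"
      by metis
    obtain d where d: "\<exists>k\<in>A. d k \<noteq> 0" "\<And>j. (\<Sum>k\<in>A. d k * (if j < n then c k j else 0)) = 0"
      by (rule dependent_coordinate_vectors[of A "{..<n}" "\<lambda>k j. if j < n then c k j else 0"])
         (use A in auto)
    have d': "(\<Sum>k\<in>A. d k * c k j) = 0" if "j < n" for j using d(2)[of j] that by simp
    have "d i = 0" if "i \<in> A" for i
    proof -
      have "d i = (\<Sum>k\<in>A. if i = k then d k else 0)"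
        using that A(1) by simp
      also have "\<dots> = (\<Sum>k\<in>A. d k * (if i = k then 1 else 0))"
        by (intro sum.cong refl) simp
      also have "\<dots> = (\<Sum>k\<in>A. \<Sum>j<n. d k * (c k j * b j i))"
        by (intro sum.cong refl) (simp add: c sum_distrib_left)
      also have "\<dots> = (\<Sum>j<n. (\<Sum>k\<in>A. d k * c k j) * b j i)"
        by (subst sum.swap) (simp add: sum_distrib_right mult.assoc)
      also have "\<dots> = 0" using d' by simp
      finally show ?thesis .
    qed
    with d(1) show False by blast
  qed
  then obtain u i0 where u: "u \<in> U" "u i0 \<noteq> 0" by blast
  have "\<exists>t. v = (\<lambda>i. t * u i)" if v: "v \<in> U" for v
  proof -
    define x where "x = (\<lambda>j. if j < n then b j else if j = n then u else v)"
    obtain c where c: "\<exists>j\<in>{..<Suc (Suc n)}. c j \<noteq> 0" "\<And>i. (\<Sum>j<Suc (Suc n). c j * x j i) = 0"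
      by (rule dependent_coordinate_vectors[of "{..<Suc (Suc n)}" A x])
         (use A supp u v in \<open>auto simp: x_def\<close>)
    have rel: "(\<Sum>j<n. c j * b j i) + c n * u i + c (Suc n) * v i = 0" for i
      using c(2)[of i] by (simp add: x_def)
    have "(\<Sum>j<n. c j * b j i) = (- c n) * u i + (- c (Suc n)) * v i" for i
    proof -
      have "(\<Sum>j<n. c j * b j i) = - (c n * u i + c (Suc n) * v i)"
        unfolding eq_neg_iff_add_eq_0 using rel[of i] by (simp only: add.assoc)
      thus ?thesis by simp
    qed
    hence "(\<lambda>i. \<Sum>j<n. c j * b j i) = (\<lambda>i. (- c n) * u i + (- c (Suc n)) * v i)" by blast
    hence c0: "c j = 0" if "j < n" for j using uniq[OF _ that, of c] lin[OF u(1) v, of "- c n" "- c (Suc n)"] by simp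
    hence rel: "c n * u i + c (Suc n) * v i = 0" for i using rel[of i] by simp
    have "c (Suc n) \<noteq> 0"
    proof
      assume 0: "c (Suc n) = 0"
      hence "c n = 0" using rel[of i0] u(2) by simp
      with 0 c0 c(1) show False by (auto simp: less_Suc_eq)
    qed
    moreover have "c (Suc n) * v i = - (c n * u i)" for i
      using rel[of i] by (simp only: eq_neg_iff_add_eq_0 add.commute)
    ultimately have "v i = - (c n / c (Suc n)) * u i" for i
      by (metis minus_divide_left mult_minus_left nonzero_mult_div_cancel_left times_divide_eq_left)
    thus ?thesis by blast
  qed
  thus ?thesis using that u by blast
qed

section \<open>Bases, words in F and V, and integrality\<close>

lemma witt_basis_reindex:
  assumes b: "witt_basis act M I b" and h: "bij_betw h J I"
  shows "witt_basis act M J (b \<circ> h)"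
  unfolding witt_basis_def
proof (intro conjI ballI)
  have I: "finite I" "b ` I \<subseteq> M" and hJ: "h ` J = I" "inj_on h J"
    using b h by (auto simp: witt_basis_def bij_betw_def)
  show "finite J" using bij_betw_finite[OF h] I(1) by simp
  show "(b \<circ> h) ` J \<subseteq> M" using I hJ by (auto simp: image_comp[symmetric])
  fix x assume x: "x \<in> M"
  have sum: "(\<Sum>i\<in>I. act (of_witt (w i)) (b i)) = (\<Sum>j\<in>J. act (of_witt (w (h j))) ((b \<circ> h) j))" for w
    using sum.reindex_bij_betw[OF h, of "\<lambda>i. act (of_witt (w i)) (b i)"] by simp
  have "\<exists>!w. (\<forall>i. i \<notin> I \<longrightarrow> w i = 0) \<and> x = (\<Sum>i\<in>I. act (of_witt (w i)) (b i))"
    using b x unfolding witt_basis_def by blast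
  then obtain w where w: "\<forall>i. i \<notin> I \<longrightarrow> w i = 0" "x = (\<Sum>i\<in>I. act (of_witt (w i)) (b i))"
    and uniq: "\<And>w'. \<forall>i. i \<notin> I \<longrightarrow> w' i = 0 \<Longrightarrow> x = (\<Sum>i\<in>I. act (of_witt (w' i)) (b i)) \<Longrightarrow> w' = w"
    by (elim ex1E) blast
  show "\<exists>!w. (\<forall>j. j \<notin> J \<longrightarrow> w j = 0) \<and> x = (\<Sum>j\<in>J. act (of_witt (w j)) ((b \<circ> h) j))"
  proof (rule ex1I[of _ "\<lambda>j. if j \<in> J then w (h j) else 0"], safe)
    show "x = (\<Sum>j\<in>J. act (of_witt (if j \<in> J then w (h j) else 0)) ((b \<circ> h) j))"
      using w(2) sum[of w] by (simp cong: sum.cong)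
  next
    fix v assume v: "\<forall>j. j \<notin> J \<longrightarrow> v j = 0" "x = (\<Sum>j\<in>J. act (of_witt (v j)) ((b \<circ> h) j))"
    define w' where "w' = (\<lambda>i. if i \<in> I then v (inv_into J h i) else 0)"
    have w'h: "w' (h j) = v j" if "j \<in> J" for j
      using that hJ by (auto simp: w'_def)
    have "x = (\<Sum>i\<in>I. act (of_witt (w' i)) (b i))"
      unfolding v(2) sum by (intro sum.cong refl) (simp add: w'h)
    hence "w' = w" by (intro uniq) (auto simp: w'_def)
    thus "v = (\<lambda>j. if j \<in> J then w (h j) else 0)" using w'h v(1) by (auto simp: fun_eq_iff)
  qed auto
qed

text \<open>
  As \<open>FV = p\<close> is central, every \<open>V\<close> can be cancelled against an \<open>F\<close>.
\<close>

lemma dF_power_mult_dV_power: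
  "dF ^ (c + b) * dV ^ b = of_nat (CHAR('k) ^ b) * (dF ^ c :: 'k::{alg_closed_field, field_prime_char} dieud)"
proof (induction b)
  case (Suc b)
  have "dF ^ (c + Suc b) * (dV :: 'k dieud) ^ Suc b = dF ^ (c + b) * (dF * dV) * dV ^ b"
    by (simp only: add_Suc_right power_Suc2[of dF] power_Suc[of dV] mult.assoc)
  also have "\<dots> = of_nat CHAR('k) * (dF ^ (c + b) * dV ^ b)"
    by (simp add: dF_dV mult_of_nat_commute mult.assoc[symmetric])
  finally show ?case using Suc by (simp add: mult.assoc)
qed simp

lemma dF_power_of_witt: "dF ^ n * of_witt w = of_witt ((frob ^^ n) w) * dF ^ n"
proof (induction n)
  case (Suc n)
  have "dF ^ Suc n * of_witt w = dF * (dF ^ n * of_witt w)" by (simp add: mult.assoc)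
  also have "\<dots> = of_witt (frob ((frob ^^ n) w)) * (dF * dF ^ n)"
    unfolding Suc by (simp only: mult.assoc[symmetric] dF_of_witt)
  finally show ?case by simp
qed simp

lemma dV_of_witt: "dV * of_witt w = of_witt (inv frob w) * dV"
  by (simp add: of_witt_dV)

lemma to_fract_of_nat [simp]: "to_fract (of_nat n) = of_nat n"
  by (induction n) simp_all

lemma to_fract_sum: "to_fract (sum t A) = (\<Sum>i\<in>A. to_fract (t i))"
  by (induction A rule: infinite_finite_induct) auto

lemma range_to_fract_add: "x \<in> range to_fract \<Longrightarrow> y \<in> range to_fract \<Longrightarrow> x + y \<in> range to_fract"
  by (auto simp flip: to_fract_add)

lemma range_to_fract_mult: "x \<in> range to_fract \<Longrightarrow> y \<in> range to_fract \<Longrightarrow> x * y \<in> range to_fract"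
  by (auto simp flip: to_fract_mult)

lemma range_to_fract_uminus: "x \<in> range to_fract \<Longrightarrow> - x \<in> range to_fract"
  by (auto simp flip: to_fract_uminus)

lemma frob_fract_to_fract: "frob_fract (to_fract w) = to_fract (frob w)"
  by (simp add: to_fract_def frob_fract_Fract frob_1)

text \<open>
  This turns integrality of a pairing into an equation over \<open>k\<close>.
\<close>

lemma to_fract_div_p_integral_iff:
  fixes w :: "'k::{alg_closed_field, field_prime_char} witt"
  shows "to_fract w / of_nat CHAR('k) \<in> range to_fract \<longleftrightarrow> residue w = 0"
proof -
  have p: "(of_nat CHAR('k) :: 'k witt fract) \<noteq> 0"
    by (metis p_witt_nonzero to_fract_eq_0_iff to_fract_of_nat)
  have "to_fract w / of_nat CHAR('k) = to_fract v \<longleftrightarrow> w = of_nat CHAR('k) * v" for v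
    using p by (simp add: field_simps flip: to_fract_of_nat to_fract_mult)
  thus ?thesis unfolding residue_eq_0_iff by (auto simp: dvd_def image_iff)
qed

section \<open>The top module modulo F\<close>

locale normal_form = rational_dieudonne scale act form
  for scale :: "'k::{alg_closed_field, field_prime_char} witt fract \<Rightarrow> 'v::ab_group_add \<Rightarrow> 'v"
    and act :: "'k dieud \<Rightarrow> 'v \<Rightarrow> 'v"
    and form :: "'v \<Rightarrow> 'v \<Rightarrow> 'k witt fract" +
  fixes g :: nat and M :: "'v set" and e f :: "nat \<Rightarrow> 'v"
  assumes g2: "g \<ge> 2"
    and top: "truncated_pftq scale act form g (g - 1) (\<lambda>_. M)"
    and basis: "normal_form_basis act form g M e f"
begin

abbreviation wact :: "'k witt \<Rightarrow> 'v \<Rightarrow> 'v" (infixr "\<star>" 75) where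
  "w \<star> x \<equiv> act (of_witt w) x"

sublocale W: module "\<lambda>w x. w \<star> x"
  by unfold_locales (simp_all add: act_one act_add_left act_add_right act_act of_witt_add of_witt_mult)

lemma act_0 [simp]: "act d 0 = 0"
  using act_add_right[of d 0 0] by simp

lemma act_zero [simp]: "act 0 x = 0"
  using act_add_left[of 0 0 x] by simp

declare act_one [simp]

lemma act_sum: "act d (sum t A) = (\<Sum>i\<in>A. act d (t i))"
  by (induction A rule: infinite_finite_induct) (simp_all add: act_add_right)

lemma act_dF_wact: "act dF (w \<star> x) = frob w \<star> act dF x"
  by (simp add: act_act dF_of_witt)

lemma act_dV_wact: "act dV (w \<star> x) = inv frob w \<star> act dV x"
  by (simp add: act_act dV_of_witt)

lemma submodule_wact: "submodule act L \<Longrightarrow> x \<in> L \<Longrightarrow> w \<star> x \<in> L"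
  by (simp add: submodule_def)

lemma submodule_sum: "submodule act L \<Longrightarrow> (\<And>i. i \<in> A \<Longrightarrow> t i \<in> L) \<Longrightarrow> sum t A \<in> L"
  by (induction A rule: infinite_finite_induct) (simp_all add: submodule_def)

lemma submodule_diff:
  assumes "submodule act L" "x \<in> L" "y \<in> L"
  shows "x - y \<in> L"
proof -
  have "x + (- 1) \<star> y \<in> L"
    using assms submodule_wact[OF assms(1,3), of "- 1"] unfolding submodule_def by blast
  moreover have "(- 1) \<star> y = - y" by (simp only: W.scale_minus_left W.scale_one)
  ultimately show ?thesis by simp
qed

lemma top_conditions:
  shows supersingular_M: "supersingular act g M"
    and quasi_polarised_M: "quasi_polarised act form M"
    and iso_A11_sum_M: "iso_A11_sum act g M"
    and dual_M: "dual scale form M = act (dF ^ (g - 1)) ` M"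
    and FV_words_M: "\<forall>j\<le>(g - 1) div 2. act (dF ^ (g - 1 - j) * dV ^ j) ` M \<subseteq> dual scale form M"
proof -
  have single: "(\<forall>i\<in>{g - 1..g - 1}. Q i) \<longleftrightarrow> Q (g - 1)" for Q :: "nat \<Rightarrow> bool" by simp
  note T = top[unfolded truncated_pftq_def single]
  show "supersingular act g M" "quasi_polarised act form M" "iso_A11_sum act g M"
    "dual scale form M = act (dF ^ (g - 1)) ` M"
    "\<forall>j\<le>(g - 1) div 2. act (dF ^ (g - 1 - j) * dV ^ j) ` M \<subseteq> dual scale form M"
    by (rule T[THEN conjunct1, THEN conjunct1] T[THEN conjunct1, THEN conjunct2]
      T[THEN conjunct2, THEN conjunct2, THEN conjunct1]
      T[THEN conjunct2, THEN conjunct2, THEN conjunct2, THEN conjunct1]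
      T[THEN conjunct2, THEN conjunct2, THEN conjunct2, THEN conjunct2, THEN conjunct2])+
qed

lemma submodule_M: "submodule act M"
  using supersingular_M by (simp add: supersingular_def dieudonne_module_def)

lemma M_closed:
  "0 \<in> M" "x \<in> M \<Longrightarrow> y \<in> M \<Longrightarrow> x + y \<in> M" "x \<in> M \<Longrightarrow> act d x \<in> M"
  using submodule_M by (auto simp: submodule_def)

text \<open>
  Coordinates with respect to the basis are handled through this map from pairs of coordinate
  families to \<open>M\<close>; only the values on \<open>{1..g}\<close> matter.
\<close>

definition lin_comb :: "(nat \<Rightarrow> 'k witt) \<Rightarrow> (nat \<Rightarrow> 'k witt) \<Rightarrow> 'v" where
  "lin_comb w v = (\<Sum>i=1..g. w i \<star> e i) + (\<Sum>i=1..g. v i \<star> f i)"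

lemma witt_basis_M: "witt_basis act M ({1..g} <+> {1..g}) (case_sum e f)"
  using basis by (simp add: normal_form_basis_def)

lemma sum_Plus_lin_comb:
  "(\<Sum>i\<in>{1..g} <+> {1..g}. u i \<star> case_sum e f i) = lin_comb (u \<circ> Inl) (u \<circ> Inr)"
  by (simp add: lin_comb_def sum.Plus)

lemma e_in_M [intro]: "i \<in> {1..g} \<Longrightarrow> e i \<in> M" and f_in_M [intro]: "i \<in> {1..g} \<Longrightarrow> f i \<in> M"
proof -
  have sub: "case_sum e f ` ({1..g} <+> {1..g}) \<subseteq> M"
    using witt_basis_M unfolding witt_basis_def by blast
  show "e i \<in> M" if "i \<in> {1..g}"
    using subsetD[OF sub imageI[OF InlI[OF that]]] by simp
  show "f i \<in> M" if "i \<in> {1..g}"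
    using subsetD[OF sub imageI[OF InrI[OF that]]] by simp
qed

lemma lin_comb_in_M [intro]: "lin_comb w v \<in> M"
  unfolding lin_comb_def by (intro M_closed(2) submodule_sum[OF submodule_M] M_closed(3)) auto

lemma lin_comb_exists:
  assumes "x \<in> M" obtains w v where "x = lin_comb w v"
proof -
  have "\<exists>u. x = lin_comb (u \<circ> Inl) (u \<circ> Inr)"
    using assms witt_basis_M unfolding witt_basis_def sum_Plus_lin_comb by blast
  thus ?thesis using that by blast
qed

lemma lin_comb_cong: "(\<And>i. i \<in> {1..g} \<Longrightarrow> w i = w' i) \<Longrightarrow> (\<And>i. i \<in> {1..g} \<Longrightarrow> v i = v' i) \<Longrightarrow> lin_comb w v = lin_comb w' v'"
  by (simp add: lin_comb_def)

lemma lin_comb_eq_iff: "lin_comb w v = lin_comb w' v' \<longleftrightarrow> (\<forall>i\<in>{1..g}. w i = w' i \<and> v i = v' i)"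
proof
  define u where "u = (\<lambda>w v i. case i of Inl j \<Rightarrow> if j \<in> {1..g} then w j else 0 | Inr j \<Rightarrow> if j \<in> {1..g} then v j else (0::'k witt))"
  have u: "lin_comb w v = (\<Sum>i\<in>{1..g} <+> {1..g}. u w v i \<star> case_sum e f i)" for w v
    unfolding sum_Plus_lin_comb by (rule lin_comb_cong) (auto simp: u_def)
  have u0: "i \<notin> {1..g} <+> {1..g} \<longrightarrow> u w v i = 0" for w v i
    by (cases i) (auto simp: u_def)
  assume eq: "lin_comb w v = lin_comb w' v'"
  have "\<exists>!q. (\<forall>i. i \<notin> {1..g} <+> {1..g} \<longrightarrow> q i = 0) \<and>
      lin_comb w v = (\<Sum>i\<in>{1..g} <+> {1..g}. q i \<star> case_sum e f i)"
    using witt_basis_M lin_comb_in_M[of w v] unfolding witt_basis_def by blast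
  moreover have "lin_comb w v = (\<Sum>i\<in>{1..g} <+> {1..g}. u w' v' i \<star> case_sum e f i)"
    using u[of w' v'] eq by simp
  ultimately have "u w v = u w' v'" using u[of w v] u0 by blast
  hence "u w v (Inl i) = u w' v' (Inl i)" "u w v (Inr i) = u w' v' (Inr i)" for i by simp_all
  hence "w i = w' i \<and> v i = v' i" if "i \<in> {1..g}" for i
    using that unfolding u_def sum.case by metis
  thus "\<forall>i\<in>{1..g}. w i = w' i \<and> v i = v' i" by blast
qed (auto intro: lin_comb_cong)

lemma lin_comb_add: "lin_comb w v + lin_comb w' v' = lin_comb (\<lambda>i. w i + w' i) (\<lambda>i. v i + v' i)"
  by (simp add: lin_comb_def W.scale_left_distrib sum.distrib algebra_simps)

lemma wact_lin_comb: "a \<star> lin_comb w v = lin_comb (\<lambda>i. a * w i) (\<lambda>i. a * v i)"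
  by (simp add: lin_comb_def W.scale_right_distrib W.scale_sum_right)

text \<open>
  With this sign the two normal forms satisfy the same formulas for \<open>F\<close> and \<open>V\<close>, so that parity of
  \<open>g\<close> only matters for the form.
\<close>

definition sign :: "'k witt" where "sign = (if odd g then - 1 else 1)"

lemma sign_simps [simp]: "sign * sign = 1" "sign * (sign * w) = w" "frob sign = sign" "inv frob sign = sign"
proof -
  note [simp] = hom_1[OF is_ring_hom_frob] hom_minus[OF is_ring_hom_frob] hom_1[OF is_ring_hom_inv_frob] hom_minus[OF is_ring_hom_inv_frob]
  show "sign * sign = 1" "sign * (sign * w) = w" "frob sign = sign" "inv frob sign = sign"
    by (auto simp: sign_def)
qed

lemma act_basis:
  assumes "i \<in> {1..g}"
  shows "act dF (e i) = f i" "act dV (e i) = sign \<star> f i"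
    "act dF (f i) = (sign * of_nat CHAR('k)) \<star> e i" "act dV (f i) = of_nat CHAR('k) \<star> e i"
proof -
  have 1: "sign \<star> x = (if odd g then - x else x)" for x
    by (simp add: sign_def W.scale_minus_left)
  have 2: "act (of_nat CHAR('k)) x = of_nat CHAR('k) \<star> x" for x by simp
  have 3: "(sign * of_nat CHAR('k)) \<star> x = sign \<star> act (of_nat CHAR('k)) x" for x
    unfolding 2 by (rule W.scale_scale[symmetric])
  show "act dF (e i) = f i" "act dV (e i) = sign \<star> f i"
    "act dF (f i) = (sign * of_nat CHAR('k)) \<star> e i" "act dV (f i) = of_nat CHAR('k) \<star> e i"
    unfolding 3 unfolding 1 using basis assms
    by (cases "odd g"; simp add: normal_form_basis_def)+
qed

lemma act_dF_lin_comb: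
  "act dF (lin_comb w v) = lin_comb (\<lambda>i. sign * of_nat CHAR('k) * frob (v i)) (\<lambda>i. frob (w i))"
proof -
  have "act dF (lin_comb w v) = (\<Sum>i=1..g. frob (w i) \<star> act dF (e i)) + (\<Sum>i=1..g. frob (v i) \<star> act dF (f i))"
    by (simp add: lin_comb_def act_add_right act_sum act_dF_wact)
  also have "(\<Sum>i=1..g. frob (w i) \<star> act dF (e i)) = (\<Sum>i=1..g. frob (w i) \<star> f i)"
    by (intro sum.cong refl) (simp only: act_basis W.scale_scale mult.commute)
  also have "(\<Sum>i=1..g. frob (v i) \<star> act dF (f i)) = (\<Sum>i=1..g. (sign * of_nat CHAR('k) * frob (v i)) \<star> e i)"
    by (intro sum.cong refl) (simp only: act_basis W.scale_scale mult.commute)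
  finally show ?thesis by (simp add: lin_comb_def add.commute)
qed

lemma act_dV_lin_comb:
  "act dV (lin_comb w v) = lin_comb (\<lambda>i. of_nat CHAR('k) * inv frob (v i)) (\<lambda>i. sign * inv frob (w i))"
proof -
  have "act dV (lin_comb w v) = (\<Sum>i=1..g. inv frob (w i) \<star> act dV (e i)) + (\<Sum>i=1..g. inv frob (v i) \<star> act dV (f i))"
    by (simp add: lin_comb_def act_add_right act_sum act_dV_wact)
  also have "(\<Sum>i=1..g. inv frob (w i) \<star> act dV (e i)) = (\<Sum>i=1..g. (sign * inv frob (w i)) \<star> f i)"
    by (intro sum.cong refl) (simp only: act_basis W.scale_scale mult.commute)
  also have "(\<Sum>i=1..g. inv frob (v i) \<star> act dV (f i)) = (\<Sum>i=1..g. (of_nat CHAR('k) * inv frob (v i)) \<star> e i)"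
    by (intro sum.cong refl) (simp only: act_basis W.scale_scale mult.commute)
  finally show ?thesis by (simp add: lin_comb_def add.commute)
qed

text \<open>
  The coordinates in \<open>k\<^sup>g\<close> of the class of \<open>x\<close> in \<open>M / FM\<close>.
\<close>

definition mod_FM :: "'v \<Rightarrow> nat \<Rightarrow> 'k" where
  "mod_FM x i = (if i \<in> {1..g} then residue (THE a. \<exists>w v. x = lin_comb w v \<and> a = w i) else 0)"

lemma mod_FM_comb: "mod_FM (lin_comb w v) i = (if i \<in> {1..g} then residue (w i) else 0)"
proof -
  have "(THE a. \<exists>w' v'. lin_comb w v = lin_comb w' v' \<and> a = w' i) = w i" if "i \<in> {1..g}"
    by (rule the_equality) (use that in \<open>auto simp: lin_comb_eq_iff\<close>)
  thus ?thesis by (simp add: mod_FM_def)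
qed

lemma mod_FM_outside: "i \<notin> {1..g} \<Longrightarrow> mod_FM x i = 0"
  unfolding mod_FM_def by (simp only: if_False)

lemma mod_FM_add: "x \<in> M \<Longrightarrow> y \<in> M \<Longrightarrow> mod_FM (x + y) i = mod_FM x i + mod_FM y i"
  by (elim lin_comb_exists) (simp add: lin_comb_add mod_FM_comb residue_simps)

lemma mod_FM_wact: "x \<in> M \<Longrightarrow> mod_FM (w \<star> x) i = residue w * mod_FM x i"
  by (elim lin_comb_exists) (simp add: wact_lin_comb mod_FM_comb residue_simps)

lemma mod_FM_0 [simp]: "mod_FM 0 i = 0"
  using mod_FM_wact[of 0 0 i] M_closed(1) by (simp add: residue_simps)

lemma mod_FM_diff: "x \<in> M \<Longrightarrow> y \<in> M \<Longrightarrow> mod_FM (x - y) i = mod_FM x i - mod_FM y i"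
  using mod_FM_add[of "x - y" y i] submodule_diff[OF submodule_M, of x y] by simp

lemma mod_FM_sum: "(\<And>j. j \<in> A \<Longrightarrow> t j \<in> M) \<Longrightarrow> mod_FM (sum t A) i = (\<Sum>j\<in>A. mod_FM (t j) i)"
  by (induction A rule: infinite_finite_induct) (simp_all add: mod_FM_add submodule_sum[OF submodule_M])

lemma in_image_FV:
  assumes "x \<in> act dF ` M \<union> act dV ` M"
  shows image_FV_in_M: "x \<in> M" and mod_FM_image_FV: "mod_FM x i = 0"
proof -
  show "x \<in> M" using assms by (elim UnE imageE) (simp_all add: M_closed(3))
  show "mod_FM x i = 0"
    using assms
    by (elim UnE imageE lin_comb_exists) (simp_all add: act_dF_lin_comb act_dV_lin_comb mod_FM_comb residue_simps)
qed

text \<open>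
  Together with \<open>mod_FM_image_FV\<close> this shows that \<open>FM\<close> and \<open>VM\<close> are both the kernel of \<open>mod_FM\<close>, and
  in particular equal.  Preimages exist because Frobenius is bijective on \<open>W(k)\<close>.
\<close>

lemma in_image_FV_if_mod_FM_0:
  assumes "x \<in> M" "\<And>i. mod_FM x i = 0"
  shows "x \<in> act dF ` M" "x \<in> act dV ` M"
proof -
  note [simp] = hom_simps[OF is_ring_hom_frob] hom_simps[OF is_ring_hom_inv_frob]
  obtain w v where x: "x = lin_comb w v" using assms(1) by (rule lin_comb_exists)
  have "\<exists>u. w i = of_nat CHAR('k) * u" if "i \<in> {1..g}" for i
  proof -
    have "residue (w i) = 0" using assms(2)[of i] that unfolding x mod_FM_comb by (simp only: if_True)
    thus ?thesis unfolding residue_eq_0_iff by (rule dvdE) blast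
  qed
  then obtain u where u: "\<And>i. i \<in> {1..g} \<Longrightarrow> w i = of_nat CHAR('k) * u i" by metis
  have "x = act dF (lin_comb (\<lambda>i. inv frob (v i)) (\<lambda>i. sign * inv frob (u i)))"
    unfolding x act_dF_lin_comb by (rule lin_comb_cong) (simp_all add: u mult_ac)
  thus "x \<in> act dF ` M" using lin_comb_in_M by (rule image_eqI)
  have "x = act dV (lin_comb (\<lambda>i. sign * frob (v i)) (\<lambda>i. frob (u i)))"
    unfolding x act_dV_lin_comb by (rule lin_comb_cong) (simp_all add: u mult_ac)
  thus "x \<in> act dV ` M" using lin_comb_in_M by (rule image_eqI)
qed

definition lift :: "(nat \<Rightarrow> 'k) \<Rightarrow> 'v" where
  "lift \<alpha> = (\<Sum>i=1..g. teich (\<alpha> i) \<star> e i)"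

lemma lift_eq_lin_comb: "lift \<alpha> = lin_comb (\<lambda>i. teich (\<alpha> i)) (\<lambda>_. 0)"
  by (simp add: lift_def lin_comb_def)

lemma lift_in_M [intro]: "lift \<alpha> \<in> M"
  by (auto simp: lift_eq_lin_comb)

lemma mod_FM_lift: "(\<And>i. i \<notin> {1..g} \<Longrightarrow> \<alpha> i = 0) \<Longrightarrow> mod_FM (lift \<alpha>) = \<alpha>"
  by (auto simp: lift_eq_lin_comb mod_FM_comb fun_eq_iff)

section \<open>First steps as lines\<close>

text \<open>
  The span of \<open>x\<^sub>\<alpha>\<close> and the kernel of \<open>mod_FM\<close> is the preimage of the line through \<open>\<alpha>\<close>.
\<close>

lemma first_step_eq:
  assumes "\<alpha> \<in> homogeneous_coords g"
  shows "first_step act g M e \<alpha> = {x \<in> M. \<exists>t. \<forall>i. mod_FM x i = t * \<alpha> i}" (is "?L = ?R")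
proof
  have \<alpha>: "mod_FM (lift \<alpha>) = \<alpha>" using assms by (intro mod_FM_lift) (auto simp: homogeneous_coords_def)
  have L: "?L = W.span ({lift \<alpha>} \<union> act dF ` M \<union> act dV ` M)"
    by (simp add: first_step_def lift_def)
  show "?L \<subseteq> ?R"
    unfolding L
  proof (rule W.span_minimal)
    show "{lift \<alpha>} \<union> act dF ` M \<union> act dV ` M \<subseteq> ?R"
    proof
      fix x assume "x \<in> {lift \<alpha>} \<union> act dF ` M \<union> act dV ` M"
      then consider "x = lift \<alpha>" | "x \<in> act dF ` M \<union> act dV ` M" by blast
      thus "x \<in> ?R"
      proof cases
        case 1
        have "\<forall>i. mod_FM x i = 1 * \<alpha> i" using 1 \<alpha> by simp
        moreover have "x \<in> M" unfolding 1 by (rule lift_in_M)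
        ultimately show ?thesis by blast
      next
        case 2
        have "\<forall>i. mod_FM x i = 0 * \<alpha> i" using mod_FM_image_FV[OF 2] by simp
        moreover have "x \<in> M" using 2 by (rule image_FV_in_M)
        ultimately show ?thesis by blast
      qed
    qed
    show "W.subspace ?R"
      unfolding W.subspace_def
    proof (intro conjI ballI allI)
      show "0 \<in> ?R" using M_closed(1) by (auto intro: exI[of _ 0])
    next
      fix x y assume "x \<in> ?R" "y \<in> ?R"
      then obtain s t where "x \<in> M" "y \<in> M" "\<And>i. mod_FM x i = s * \<alpha> i" "\<And>i. mod_FM y i = t * \<alpha> i" by blast
      thus "x + y \<in> ?R" by (auto simp: mod_FM_add M_closed(2) intro!: exI[of _ "s + t"] distrib_right[symmetric])
    next
      fix w x assume "x \<in> ?R"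
      then obtain s where "x \<in> M" "\<And>i. mod_FM x i = s * \<alpha> i" by blast
      thus "w \<star> x \<in> ?R" by (auto simp: mod_FM_wact M_closed(3) intro!: exI[of _ "residue w * s"])
    qed
  qed
  show "?R \<subseteq> ?L"
  proof safe
    fix x t assume x: "x \<in> M" "\<forall>i. mod_FM x i = t * \<alpha> i"
    have "mod_FM (x - teich t \<star> lift \<alpha>) i = 0" for i
      using x by (simp add: mod_FM_diff mod_FM_wact \<alpha> lift_in_M M_closed(3))
    hence "x - teich t \<star> lift \<alpha> \<in> act dF ` M"
      by (intro in_image_FV_if_mod_FM_0(1) submodule_diff[OF submodule_M] x(1) M_closed(3) lift_in_M)
    hence "(x - teich t \<star> lift \<alpha>) + teich t \<star> lift \<alpha> \<in> ?L"
      unfolding L by (intro W.span_add W.span_scale W.span_base ) simp_all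
    thus "x \<in> ?L" by simp
  qed
qed

lemma first_step_eq_iff:
  assumes "\<alpha> \<in> homogeneous_coords g" "\<beta> \<in> homogeneous_coords g"
  shows "first_step act g M e \<alpha> = first_step act g M e \<beta> \<longleftrightarrow> (\<exists>c. c \<noteq> 0 \<and> \<beta> = (\<lambda>i. c * \<alpha> i))"
proof
  assume eq: "first_step act g M e \<alpha> = first_step act g M e \<beta>"
  have \<beta>: "mod_FM (lift \<beta>) = \<beta>" using assms(2) by (intro mod_FM_lift) (auto simp: homogeneous_coords_def)
  have "lift \<beta> \<in> first_step act g M e \<beta>"
    unfolding first_step_eq[OF assms(2)] using \<beta> by (auto intro: exI[of _ 1])
  then obtain c where c: "\<And>i. \<beta> i = c * \<alpha> i"
    unfolding eq[symmetric] first_step_eq[OF assms(1)] using \<beta> by auto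
  moreover have "c \<noteq> 0" using c assms(2) by (auto simp: homogeneous_coords_def)
  ultimately show "\<exists>c. c \<noteq> 0 \<and> \<beta> = (\<lambda>i. c * \<alpha> i)" by blast
next
  assume "\<exists>c. c \<noteq> 0 \<and> \<beta> = (\<lambda>i. c * \<alpha> i)"
  then obtain c where c: "c \<noteq> 0" "\<beta> = (\<lambda>i. c * \<alpha> i)" by blast
  have "(\<exists>t. \<forall>i. y i = t * \<alpha> i) \<longleftrightarrow> (\<exists>t. \<forall>i. y i = t * \<beta> i)" for y :: "nat \<Rightarrow> 'k"
  proof
    assume "\<exists>t. \<forall>i. y i = t * \<alpha> i"
    then obtain t where "\<forall>i. y i = t * \<alpha> i" by blast
    thus "\<exists>t. \<forall>i. y i = t * \<beta> i" using c by (intro exI[of _ "t / c"]) simp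
  next
    assume "\<exists>t. \<forall>i. y i = t * \<beta> i"
    thus "\<exists>t. \<forall>i. y i = t * \<alpha> i" unfolding c(2) by (metis mult.assoc)
  qed
  thus "first_step act g M e \<alpha> = first_step act g M e \<beta>"
    by (simp add: first_step_eq[OF assms(1)] first_step_eq[OF assms(2)])
qed

end

text \<open>
  Every monomial in \<open>F\<close> and \<open>V\<close> other than \<open>1\<close> has a leftmost \<open>F\<close> or \<open>V\<close>.  Consequently a
  \<open>W(k)\<close>-submodule of \<open>M\<close> that contains \<open>FM\<close> and \<open>VM\<close> is stable under the whole Dieudonne ring.
\<close>

lemma dieud_decompose:
  fixes d :: "'k::{alg_closed_field, field_prime_char} dieud"
  obtains w d1 d2 where "d = of_witt w + dF * d1 + dV * d2"
proof -
  have single: "\<exists>w d1 d2. Dieud (Poly_Mapping.single n a) = of_witt w + dF * d1 + dV * d2"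
    for n and a :: "'k witt"
  proof -
    consider "n = 0" | "n > 0" | "n < 0" by linarith
    thus ?thesis
    proof cases
      case 1
      thus ?thesis by (intro exI[of _ a] exI[of _ 0]) (simp add: of_witt_def)
    next
      case 2
      have "Dieud (Poly_Mapping.single n a) = dF * Dieud (Poly_Mapping.single (n - 1) (inv frob a))"
        using 2 by (simp add: dF_def times_dieud.abs_eq dieud_mult_single defect_def)
      hence "Dieud (Poly_Mapping.single n a) = of_witt 0 + dF * Dieud (Poly_Mapping.single (n - 1) (inv frob a)) + dV * 0"
        by simp
      thus ?thesis by (intro exI)
    next
      case 3
      have "Dieud (Poly_Mapping.single n a) = dV * Dieud (Poly_Mapping.single (n + 1) (frob a))"
        using 3 by (simp add: dV_def times_dieud.abs_eq dieud_mult_single defect_def frob_pow_def)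
      hence "Dieud (Poly_Mapping.single n a) = of_witt 0 + dF * 0 + dV * Dieud (Poly_Mapping.single (n + 1) (frob a))"
        by simp
      thus ?thesis by (intro exI)
    qed
  qed
  have "\<exists>w d1 d2. Dieud x = of_witt w + dF * d1 + dV * d2" for x :: "int \<Rightarrow>\<^sub>0 'k witt"
  proof (induction x rule: poly_mapping_single_induct)
    case zero
    show ?case by (intro exI[of _ 0]) (simp add: zero_dieud_def[symmetric])
  next
    case (single_add n a x)
    from single[of n a] obtain w d1 d2 where 1: "Dieud (Poly_Mapping.single n a) = of_witt w + dF * d1 + dV * d2"
      by (elim exE)
    from single_add obtain w' d1' d2' where 2: "Dieud x = of_witt w' + dF * d1' + dV * d2'"
      by (elim exE)
    have "Dieud (Poly_Mapping.single n a + x) = Dieud (Poly_Mapping.single n a) + Dieud x"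
      by (simp add: plus_dieud.abs_eq)
    also have "\<dots> = of_witt (w + w') + dF * (d1 + d1') + dV * (d2 + d2')"
      unfolding 1 2 by (simp add: of_witt_add distrib_left algebra_simps)
    finally show ?case by (intro exI)
  qed
  from this[of "dcoeffs d"] obtain w d1 d2 where "d = of_witt w + dF * d1 + dV * d2"
    unfolding dcoeffs_inverse by (elim exE)
  thus ?thesis by (rule that)
qed

context normal_form
begin

lemma submodule_between:
  assumes "W.subspace L" "L \<subseteq> M" "act dF ` M \<subseteq> L" "act dV ` M \<subseteq> L"
  shows "submodule act L"
  unfolding submodule_def
proof (intro conjI ballI allI)
  show "0 \<in> L" using assms(1) by (rule W.subspace_0)
  show "x + y \<in> L" if "x \<in> L" "y \<in> L" for x y using assms(1) that by (rule W.subspace_add)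
  fix d :: "'k dieud" and x assume x: "x \<in> L"
  obtain w d1 d2 where d: "d = of_witt w + dF * d1 + dV * d2" by (rule dieud_decompose)
  have "act d x = w \<star> x + act dF (act d1 x) + act dV (act d2 x)"
    by (simp add: d act_add_left act_act)
  moreover have "x \<in> M" using x assms(2) by (rule subsetD[rotated])
  hence "act dF (act d1 x) \<in> L" "act dV (act d2 x) \<in> L"
    using assms(3,4) M_closed(3) by (simp_all add: image_subset_iff)
  ultimately show "act d x \<in> L"
    using W.subspace_add[OF assms(1)] W.subspace_scale[OF assms(1) x] by simp
qed

text \<open>
  The conditions on the top module alone hold by assumption, so those involving the first step
  remain.
\<close>

lemma fiber_iff:
  "L \<in> truncation_fiber scale act form g M \<longleftrightarrow>
     supersingular act g L \<and> quasi_polarised act form L \<and> L \<subseteq> M \<and>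
     act dF ` M \<subseteq> L \<and> act dV ` M \<subseteq> L \<and> quotient_dim act M L (g - 1) \<and>
     (\<forall>j\<le>(g - 2) div 2. act (dF ^ (g - 2 - j) * dV ^ j) ` L \<subseteq> dual scale form L)"
proof -
  have ne: "(g - 2 = g - 1) = False" "g - 1 - 1 = g - 2" using g2 by auto
  have ball: "(\<forall>i\<in>{g - 2..g - 1}. Q i) \<longleftrightarrow> Q (g - 2) \<and> Q (g - 1)" "(\<forall>i\<in>{g - 2<..g - 1}. Q i) \<longleftrightarrow> Q (g - 1)"
    for Q :: "nat \<Rightarrow> bool"
  proof -
    have "{g - 2..g - 1} = {g - 2, g - 1}" "{g - 2<..g - 1} = {g - 1}" using g2 by auto
    thus "(\<forall>i\<in>{g - 2..g - 1}. Q i) \<longleftrightarrow> Q (g - 2) \<and> Q (g - 1)" "(\<forall>i\<in>{g - 2<..g - 1}. Q i) \<longleftrightarrow> Q (g - 1)"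
      by auto
  qed
  show ?thesis
    unfolding truncation_fiber_def mem_Collect_eq truncated_pftq_def ball
    by (simp only: ne if_True if_False top_conditions[THEN eqTrueI] simp_thms Un_subset_iff conj_ac)
qed

text \<open>
  Since \<open>L\<close> contains \<open>FM\<close>, membership in \<open>L\<close> depends only on the class in \<open>k\<^sup>g\<close>, and the dimension
  of \<open>M / L\<close> makes the image of \<open>L\<close> a line.
\<close>

lemma fiber_first_step:
  assumes L: "L \<in> truncation_fiber scale act form g M"
  obtains \<alpha> where "\<alpha> \<in> homogeneous_coords g" "L = first_step act g M e \<alpha>"
proof -
  have sub: "submodule act L" and LM: "L \<subseteq> M" and FL: "act dF ` M \<subseteq> L"
    and dim: "quotient_dim act M L (g - 1)"
    using L by (simp_all add: fiber_iff supersingular_def dieudonne_module_def)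
  have eqI: "x \<in> L" if "x \<in> M" "y \<in> L" "mod_FM x = mod_FM y" for x y
  proof -
    have M: "x \<in> M" "y \<in> M" using that LM by auto
    have "x - y \<in> act dF ` M"
      by (rule in_image_FV_if_mod_FM_0(1)[OF submodule_diff[OF submodule_M M]]) (simp add: mod_FM_diff M that(3))
    hence "x - y \<in> L" by (rule subsetD[OF FL])
    hence "(x - y) + y \<in> L" using sub that(2) by (simp only: submodule_def)
    thus ?thesis by simp
  qed
  from dim obtain b where b: "b ` {..<g - 1} \<subseteq> M" and
    quot_all: "\<forall>x\<in>M. \<exists>!c. (\<forall>j\<ge>g - 1. c j = 0) \<and> x - (\<Sum>j<g - 1. teich (c j) \<star> b j) \<in> L"
    unfolding quotient_dim_def by (elim exE conjE)
  note quot = bspec[OF quot_all]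
  have bM: "b j \<in> M" if "j < g - 1" for j using b that by (simp add: image_subset_iff)
  have comb_b: "(\<Sum>j<g - 1. teich (c j) \<star> b j) \<in> M" for c
    by (intro submodule_sum[OF submodule_M] submodule_wact[OF submodule_M]) (simp add: bM)
  have mod_FM_b: "mod_FM (\<Sum>j<g - 1. teich (c j) \<star> b j) i = (\<Sum>j<g - 1. c j * mod_FM (b j) i)" for c i
    by (subst mod_FM_sum) (simp_all add: bM mod_FM_wact M_closed(3))
  obtain \<alpha> where \<alpha>: "\<alpha> \<in> mod_FM ` L" "\<exists>i. \<alpha> i \<noteq> 0" "\<And>v. v \<in> mod_FM ` L \<Longrightarrow> \<exists>t. v = (\<lambda>i. t * \<alpha> i)"
  proof (rule line_of_codim_1[of "{1..g}" "g - 1" "mod_FM ` L" "\<lambda>j. mod_FM (b j)"])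
    show "card {1..g} = Suc (g - 1)" using g2 by simp
    show "v i = 0" if "v \<in> mod_FM ` L" "i \<notin> {1..g}" for v i using that mod_FM_outside by blast
    show "mod_FM (b j) i = 0" if "i \<notin> {1..g}" for j i using that by (rule mod_FM_outside)
    fix u v s t assume "u \<in> mod_FM ` L" "v \<in> mod_FM ` L"
    then obtain x y where xy: "x \<in> L" "y \<in> L" "u = mod_FM x" "v = mod_FM y" by blast
    have "x \<in> M" "y \<in> M" using xy LM by auto
    hence "(\<lambda>i. s * u i + t * v i) = mod_FM (teich s \<star> x + teich t \<star> y)"
      by (simp add: fun_eq_iff mod_FM_add mod_FM_wact M_closed(3) xy)
    moreover have "teich s \<star> x + teich t \<star> y \<in> L" using xy sub by (simp add: submodule_def)
    ultimately show "(\<lambda>i. s * u i + t * v i) \<in> mod_FM ` L" by (rule image_eqI)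
  next
    fix v :: "nat \<Rightarrow> 'k" assume v: "\<And>i. i \<notin> {1..g} \<Longrightarrow> v i = 0"
    obtain c where c: "lift v - (\<Sum>j<g - 1. teich (c j) \<star> b j) \<in> L"
      using quot[OF lift_in_M[of v]] by (elim ex1E conjE)
    have lift_v: "mod_FM (lift v) = v" by (rule mod_FM_lift) (rule v)
    have "mod_FM (lift v - (\<Sum>j<g - 1. teich (c j) \<star> b j)) = (\<lambda>i. v i - (\<Sum>j<g - 1. c j * mod_FM (b j) i))"
      by (intro ext) (simp only: mod_FM_diff[OF lift_in_M comb_b] mod_FM_b lift_v)
    thus "\<exists>c. (\<lambda>i. v i - (\<Sum>j<g - 1. c j * mod_FM (b j) i)) \<in> mod_FM ` L"
      by (intro exI[of _ c] image_eqI[OF _ c]) (rule sym)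
  next
    fix c j assume c: "(\<lambda>i. \<Sum>j<g - 1. c j * mod_FM (b j) i) \<in> mod_FM ` L" and j: "j < g - 1"
    \<comment> \<open>Coefficient families have to vanish from \<open>g - 1\<close> on.\<close>
    define c' where "c' = (\<lambda>j. if j < g - 1 then c j else 0)"
    define y where "y = (\<Sum>j<g - 1. teich (c j) \<star> b j)"
    from c obtain z where z: "(\<lambda>i. \<Sum>j<g - 1. c j * mod_FM (b j) i) = mod_FM z" "z \<in> L" by (rule imageE)
    have "y \<in> M" unfolding y_def by (rule comb_b)
    have "mod_FM y = mod_FM z" unfolding z(1)[symmetric] y_def by (rule ext) (rule mod_FM_b)
    with \<open>y \<in> M\<close> z(2) have "y \<in> L" by (rule eqI)
    obtain c0 where c0: "\<forall>c. (\<forall>j\<ge>g - 1. c j = 0) \<and> y - (\<Sum>j<g - 1. teich (c j) \<star> b j) \<in> L \<longrightarrow> c = c0"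
      using quot[OF \<open>y \<in> M\<close>] by (rule ex1E)
    have "y - (\<Sum>j<g - 1. teich (c' j) \<star> b j) \<in> L"
      using sub by (simp add: y_def c'_def submodule_def)
    hence "c' = c0" by (intro c0[rule_format] conjI) (simp_all add: c'_def)
    moreover have "(\<lambda>_. 0) = c0" using \<open>y \<in> L\<close> by (intro c0[rule_format] conjI) simp_all
    ultimately have "c' j = 0" by metis
    thus "c j = 0" using j by (simp add: c'_def)
  qed auto
  from \<alpha>(1) obtain x0 where x0: "\<alpha> = mod_FM x0" "x0 \<in> L" by (rule imageE)
  have hom: "\<alpha> \<in> homogeneous_coords g"
    using \<alpha>(2) unfolding homogeneous_coords_def x0(1)
    by (intro CollectI conjI allI impI) (rule mod_FM_outside)
  have "L = first_step act g M e \<alpha>"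
    unfolding first_step_eq[OF hom]
  proof safe
    fix x assume x: "x \<in> L"
    thus "x \<in> M" using LM by auto
    obtain t where "mod_FM x = (\<lambda>i. t * \<alpha> i)" using \<alpha>(3)[OF imageI[OF x]] by (rule exE)
    thus "\<exists>t. \<forall>i. mod_FM x i = t * \<alpha> i" by (intro exI[of _ t]) simp
  next
    fix x t assume x: "x \<in> M" "\<forall>i. mod_FM x i = t * \<alpha> i"
    show "x \<in> L"
      by (rule eqI[of _ "teich t \<star> x0"])
         (use x x0 LM sub in \<open>simp_all add: mod_FM_wact fun_eq_iff submodule_def subset_iff\<close>)
  qed
  thus ?thesis using hom that by blast
qed

section \<open>The form on the top module\<close>

lemma form_polarised:
  assumes "x \<in> M" "y \<in> M"
  shows "form (act dF x) y = frob_fract (form x (act dV y))"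
  using quasi_polarised_M assms unfolding quasi_polarised_def by simp

lemma form_add_left: "form (x + y) z = form x z + form y z"
  and form_scale_left: "form (scale a x) z = a * form x z"
proof -
  interpret l: Vector_Spaces.linear scale "(*)" "\<lambda>x. form x z" by (rule form_linear_left)
  show "form (x + y) z = form x z + form y z" "form (scale a x) z = a * form x z"
    by (rule l.add, rule l.scale)
qed

lemma form_add_right: "form z (x + y) = form z x + form z y"
  and form_scale_right: "form z (scale a x) = a * form z x"
proof -
  interpret l: Vector_Spaces.linear scale "(*)" "form z" by (rule form_linear_right)
  show "form z (x + y) = form z x + form z y" "form z (scale a x) = a * form z x"
    by (rule l.add, rule l.scale)
qed

lemma form_0_left: "form 0 z = 0" and form_0_right: "form z 0 = 0"
  using form_scale_left[of 0 0 z] form_scale_right[of z 0 0] by simp_all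

lemma form_wact_left: "form (w \<star> x) z = to_fract w * form x z"
  by (simp add: act_of_witt form_scale_left)

lemma form_wact_right: "form z (w \<star> x) = to_fract w * form z x"
  by (simp add: act_of_witt form_scale_right)

lemma form_sum_left: "form (sum t A) z = (\<Sum>i\<in>A. form (t i) z)"
  by (induction A rule: infinite_finite_induct) (simp_all add: form_0_left form_add_left)

lemma form_sum_right: "form z (sum t A) = (\<Sum>i\<in>A. form z (t i))"
  by (induction A rule: infinite_finite_induct) (simp_all add: form_0_right form_add_right)

lemma form_skew:
  assumes "x \<in> M" "y \<in> M"
  shows "form x y = - form y x"
proof -
  have alt: "form z z = 0" if "z \<in> M" for z
    using quasi_polarised_M that unfolding quasi_polarised_def by simp
  have "form (x + y) (x + y) = 0" by (rule alt) (intro M_closed(2) assms)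
  hence "form x y + form y x = 0"
    by (simp add: form_add_left form_add_right alt assms add.commute)
  thus ?thesis by (simp only: eq_neg_iff_add_eq_0)
qed

section \<open>First steps are quasi-polarised Dieudonne modules\<close>

lemma first_step_closed:
  assumes "\<alpha> \<in> homogeneous_coords g"
  defines "L \<equiv> first_step act g M e \<alpha>"
  shows "W.subspace L" "L \<subseteq> M" "act dF ` M \<subseteq> L" "act dV ` M \<subseteq> L" "lift \<alpha> \<in> L" "submodule act L"
proof -
  have L: "L = W.span ({lift \<alpha>} \<union> act dF ` M \<union> act dV ` M)"
    by (simp add: L_def first_step_def lift_def)
  show 1: "W.subspace L" unfolding L by (rule W.subspace_span)
  show 2: "L \<subseteq> M" unfolding L_def first_step_eq[OF assms(1)] by (rule Collect_restrict)
  have gen: "{lift \<alpha>} \<union> act dF ` M \<union> act dV ` M \<subseteq> L" unfolding L by (rule W.span_superset)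
  show 3: "act dF ` M \<subseteq> L" using gen by (simp only: Un_subset_iff)
  show 4: "act dV ` M \<subseteq> L" using gen by (simp only: Un_subset_iff)
  show "lift \<alpha> \<in> L" by (rule subsetD[OF gen]) simp
  show "submodule act L" using 1 2 3 4 by (rule submodule_between)
qed

lemma teich_mult_inverse: "a \<noteq> 0 \<Longrightarrow> teich (inverse a) * teich a = 1" for a :: 'k
  by (simp flip: teich_mult)

text \<open>
  If \<open>\<alpha>\<^sub>i\<^sub>0 \<noteq> 0\<close>, then \<open>teich(\<alpha>\<^sub>i\<^sub>0)\<close> is a unit of \<open>W(k)\<close>, and one obtains a basis from the basis
  \<open>p e\<^sub>i, f\<^sub>i\<close> of \<open>FM\<close> by replacing \<open>p e\<^sub>i\<^sub>0\<close> by \<open>x\<^sub>\<alpha>\<close>.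
\<close>

lemma witt_basis_first_step:
  assumes \<alpha>: "\<alpha> \<in> homogeneous_coords g"
  shows "\<exists>b. witt_basis act (first_step act g M e \<alpha>) {..<2 * g} b"
proof -
  let ?I = "{1..g} <+> {1..g}" and ?L = "first_step act g M e \<alpha>" and ?p = "of_nat CHAR('k) :: 'k witt"
  obtain i0 where i0: "i0 \<in> {1..g}" "\<alpha> i0 \<noteq> 0" using \<alpha> unfolding homogeneous_coords_def by auto
  define b where "b = case_sum (\<lambda>i. if i = i0 then lift \<alpha> else ?p \<star> e i) f"
  have sum_b: "(\<Sum>i\<in>?I. u i \<star> b i) =
      lin_comb (\<lambda>i. (if i = i0 then 0 else u (Inl i) * ?p) + u (Inl i0) * teich (\<alpha> i)) (u \<circ> Inr)" for u
  proof -
    have 1: "(\<Sum>i=1..g. u (Inl i) \<star> b (Inl i)) =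
        lin_comb (\<lambda>i. if i = i0 then 0 else u (Inl i) * ?p) (\<lambda>_. 0) + u (Inl i0) \<star> lift \<alpha>"
    proof -
      have "(\<Sum>i=1..g. u (Inl i) \<star> b (Inl i)) =
          (\<Sum>i=1..g. (if i = i0 then 0 else u (Inl i) * ?p) \<star> e i + (if i = i0 then u (Inl i0) \<star> lift \<alpha> else 0))"
        by (intro sum.cong refl) (simp add: b_def W.scale_scale del: of_witt_of_nat)
      thus ?thesis using i0(1) by (simp add: sum.distrib lin_comb_def)
    qed
    have "(\<Sum>i\<in>?I. u i \<star> b i) = (\<Sum>i=1..g. u (Inl i) \<star> b (Inl i)) + (\<Sum>i=1..g. u (Inr i) \<star> f i)"
      by (simp add: sum.Plus b_def)
    also have "(\<Sum>i=1..g. u (Inr i) \<star> f i) = lin_comb (\<lambda>_. 0) (u \<circ> Inr)" by (simp add: lin_comb_def)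
    finally show ?thesis
      unfolding 1 by (simp add: lift_eq_lin_comb wact_lin_comb lin_comb_add comp_def)
  qed
  have "witt_basis act ?L ?I b"
    unfolding witt_basis_def
  proof (intro conjI ballI)
    show "finite ?I" by simp
    show "b ` ?I \<subseteq> ?L"
    proof
      fix x assume "x \<in> b ` ?I"
      then obtain i where i: "i \<in> {1..g}" "x = lift \<alpha> \<or> x = ?p \<star> e i \<or> x = f i"
        unfolding b_def by (elim imageE PlusE) (auto split: if_splits)
      have "?p \<star> e i = act dV (f i)" "f i = act dF (e i)" using act_basis[OF i(1)] by simp_all
      hence "?p \<star> e i \<in> ?L" "f i \<in> ?L"
        using first_step_closed(3,4)[OF \<alpha>] e_in_M[OF i(1)] f_in_M[OF i(1)] by (simp_all add: image_subset_iff)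
      thus "x \<in> ?L" using i(2) first_step_closed(5)[OF \<alpha>] by (elim disjE) simp_all
    qed
    fix x assume "x \<in> ?L"
    then obtain t where x: "x \<in> M" "\<forall>i. mod_FM x i = t * \<alpha> i" unfolding first_step_eq[OF \<alpha>] by auto
    obtain w v where wv: "x = lin_comb w v" using x(1) by (rule lin_comb_exists)
    have w: "residue (w i) = t * \<alpha> i" if "i \<in> {1..g}" for i
      using x(2) that unfolding wv mod_FM_comb by (metis (full_types))
    \<comment> \<open>The coefficient of \<open>x\<^sub>\<alpha>\<close> is forced by the \<open>i0\<close>-th coordinate.\<close>
    define q where "q = w i0 * teich (inverse (\<alpha> i0))"
    have q: "q * teich (\<alpha> i0) = w i0"
      by (simp only: q_def mult.assoc teich_mult_inverse[OF i0(2)] mult_1_right)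
    have "residue q = t" using i0(2) by (simp add: q_def residue_simps w[OF i0(1)])
    hence "\<exists>z. w i - q * teich (\<alpha> i) = ?p * z" if "i \<in> {1..g}" for i
      using residue_eq_0_iff[of "w i - q * teich (\<alpha> i)"] w[OF that] by (auto simp: residue_simps elim: dvdE)
    then obtain z where "\<And>i. i \<in> {1..g} \<Longrightarrow> w i - q * teich (\<alpha> i) = ?p * z i" by metis
    hence z: "w i = z i * ?p + q * teich (\<alpha> i)" if "i \<in> {1..g}" for i
      using that by (metis diff_add_cancel mult.commute)
    show "\<exists>!u. (\<forall>i. i \<notin> ?I \<longrightarrow> u i = 0) \<and> x = (\<Sum>i\<in>?I. u i \<star> b i)"
    proof (rule ex1I, rule conjI)
      define u where "u = case_sum (\<lambda>i. if i \<in> {1..g} then if i = i0 then q else z i else 0)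
        (\<lambda>i. if i \<in> {1..g} then v i else 0)"
      show "\<forall>i. i \<notin> ?I \<longrightarrow> u i = 0" by (auto simp: u_def split: sum.splits)
      show "x = (\<Sum>i\<in>?I. u i \<star> b i)"
        unfolding sum_b wv by (rule lin_comb_cong) (use i0(1) q in \<open>auto simp: u_def z\<close>)
      fix u' assume u': "(\<forall>i. i \<notin> ?I \<longrightarrow> u' i = 0) \<and> x = (\<Sum>i\<in>?I. u' i \<star> b i)"
      hence eq: "w i = (if i = i0 then 0 else u' (Inl i) * ?p) + u' (Inl i0) * teich (\<alpha> i)"
        "v i = u' (Inr i)" if "i \<in> {1..g}" for i
        using that unfolding sum_b wv lin_comb_eq_iff by auto
      have "w i0 = u' (Inl i0) * teich (\<alpha> i0)" using eq(1)[OF i0(1)] by simp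
      hence u0: "u' (Inl i0) = q"
        unfolding q_def using teich_mult_inverse[OF i0(2)] by (simp add: mult.assoc mult.commute)
      have "u' (Inl i) * ?p = z i * ?p" if "i \<in> {1..g}" "i \<noteq> i0" for i
        using eq(1)[OF that(1)] z[OF that(1)] that(2) by (simp add: u0)
      hence ui: "u' (Inl i) = z i" if "i \<in> {1..g}" "i \<noteq> i0" for i
        using that by (metis mult_right_cancel p_witt_nonzero)
      show "u' = u"
      proof
        fix i show "u' i = u i"
        proof (cases "i \<in> ?I")
          case True
          thus ?thesis by (elim PlusE) (simp_all add: u_def u0 ui eq(2))
        next
          case False
          thus ?thesis using u' by (auto simp: u_def split: sum.splits)
        qed
      qed
    qed
  qed
  moreover have "card {..<2 * g} = card ?I" by (simp add: card_Plus)
  then obtain h where "bij_betw h {..<2 * g} ?I"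
    using finite_same_card_bij[of "{..<2 * g}" ?I] by auto
  ultimately show ?thesis using witt_basis_reindex by blast
qed

text \<open>
  If \<open>\<alpha>\<^sub>i\<^sub>0 \<noteq> 0\<close>, the unit vectors other than the \<open>i0\<close>-th one represent a basis of \<open>k\<^sup>g / k \<alpha>\<close>: the
  multiple of \<open>\<alpha>\<close> to be subtracted is determined by the \<open>i0\<close>-th coordinate.
\<close>

lemma quotient_dim_first_step:
  assumes \<alpha>: "\<alpha> \<in> homogeneous_coords g"
  shows "quotient_dim act M (first_step act g M e \<alpha>) (g - 1)"
proof -
  define n where "n = g - 1"
  let ?L = "first_step act g M e \<alpha>"
  obtain i0 where i0: "i0 \<in> {1..g}" "\<alpha> i0 \<noteq> 0" using \<alpha> unfolding homogeneous_coords_def by auto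
  have "card {..<n} = card ({1..g} - {i0})" using i0(1) by (simp add: n_def)
  then obtain h where h: "bij_betw h {..<n} ({1..g} - {i0})"
    using finite_same_card_bij[of "{..<n}" "{1..g} - {i0}"] by auto
  have hI: "h j \<in> {1..g}" "h j \<noteq> i0" if "j < n" for j
    using bij_betwE[OF h] that by auto
  have h_surj: "\<exists>j<n. i = h j" if "i \<in> {1..g}" "i \<noteq> i0" for i
  proof -
    have "i \<in> h ` {..<n}" unfolding bij_betw_imp_surj_on[OF h] using that by simp
    thus ?thesis by auto
  qed
  have inj: "h j = h k \<longleftrightarrow> j = k" if "j < n" "k < n" for j k
    using bij_betw_imp_inj_on[OF h] that by (simp add: inj_on_eq_iff)
  have mod_FM_e: "mod_FM (e k) i = (if i = k then 1 else 0)" if "k \<in> {1..g}" for k i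
  proof -
    have "e k = lin_comb (\<lambda>i. if i = k then 1 else 0) (\<lambda>_. 0)"
    proof -
      have "(\<Sum>i=1..g. (if i = k then 1 else 0 :: 'k witt) \<star> e i) = (\<Sum>i=1..g. if i = k then e k else 0)"
        by (intro sum.cong refl) simp
      thus ?thesis using that by (simp add: lin_comb_def)
    qed
    thus ?thesis using that by (simp add: mod_FM_comb residue_simps)
  qed
  have eh_in_M: "e (h j) \<in> M" if "j < n" for j by (rule e_in_M[OF hI(1)[OF that]])
  have mod_FM_eh: "mod_FM (e (h j)) i = (if i = h j then 1 else 0)" if "j < n" for i j
    by (rule mod_FM_e[OF hI(1)[OF that]])
  have sumM: "(\<Sum>j<n. teich (c j) \<star> e (h j)) \<in> M" for c
    by (intro submodule_sum[OF submodule_M] submodule_wact[OF submodule_M] eh_in_M) simp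
  have mod_FM_sum_e: "mod_FM (\<Sum>j<n. teich (c j) \<star> e (h j)) i = (\<Sum>j<n. c j * (if i = h j then 1 else 0))" for c i
    by (subst mod_FM_sum) (simp_all add: mod_FM_wact mod_FM_eh eh_in_M M_closed(3))
  have at_h: "mod_FM (\<Sum>j<n. teich (c j) \<star> e (h j)) (h k) = c k" if "k < n" for c k
  proof -
    have "(\<Sum>j<n. c j * (if h k = h j then 1 else 0)) = (\<Sum>j<n. if k = j then c j else 0)"
      by (intro sum.cong refl) (use inj that in auto)
    thus ?thesis using that by (simp add: mod_FM_sum_e)
  qed
  have at_i0: "mod_FM (\<Sum>j<n. teich (c j) \<star> e (h j)) i0 = 0" for c
    unfolding mod_FM_sum_e by (intro sum.neutral ballI) (use hI(2) in auto)
  have mem: "x - (\<Sum>j<n. teich (c j) \<star> e (h j)) \<in> ?L \<longleftrightarrow>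
      (\<forall>j<n. c j = mod_FM x (h j) - mod_FM x i0 / \<alpha> i0 * \<alpha> (h j))" if x: "x \<in> M" for x c
  proof -
    let ?y = "x - (\<Sum>j<n. teich (c j) \<star> e (h j))"
    have yM: "?y \<in> M" by (rule submodule_diff[OF submodule_M x sumM])
    have y_h: "mod_FM ?y (h j) = mod_FM x (h j) - c j" if "j < n" for j
      by (simp only: mod_FM_diff[OF x sumM] at_h[OF that])
    have y_i0: "mod_FM ?y i0 = mod_FM x i0" by (simp only: mod_FM_diff[OF x sumM] at_i0 diff_0_right)
    have "?y \<in> ?L \<longleftrightarrow> (\<exists>t. \<forall>i. mod_FM ?y i = t * \<alpha> i)"
      unfolding first_step_eq[OF \<alpha>] using yM by simp
    also have "\<dots> \<longleftrightarrow> (\<forall>j<n. mod_FM ?y (h j) = mod_FM x i0 / \<alpha> i0 * \<alpha> (h j))"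
    proof
      assume "\<exists>t. \<forall>i. mod_FM ?y i = t * \<alpha> i"
      then obtain t where t: "\<And>i. mod_FM ?y i = t * \<alpha> i" by auto
      have "t = mod_FM x i0 / \<alpha> i0" using t[of i0] i0(2) by (simp only: y_i0) simp
      thus "\<forall>j<n. mod_FM ?y (h j) = mod_FM x i0 / \<alpha> i0 * \<alpha> (h j)" using t by simp
    next
      assume A: "\<forall>j<n. mod_FM ?y (h j) = mod_FM x i0 / \<alpha> i0 * \<alpha> (h j)"
      have "mod_FM ?y i = mod_FM x i0 / \<alpha> i0 * \<alpha> i" for i
      proof -
        consider "i = i0" | j where "j < n" "i = h j" | "i \<notin> {1..g}"
          using h_surj[of i] by blast
        thus ?thesis
        proof cases
          case 1
          thus ?thesis using i0(2) by (simp only: y_i0) simp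
        next
          case 2
          thus ?thesis using A by simp
        next
          case 3
          have "\<alpha> i = 0" using 3 \<alpha> unfolding homogeneous_coords_def by simp
          thus ?thesis by (simp only: mod_FM_outside[OF 3] mult_zero_right)
        qed
      qed
      thus "\<exists>t. \<forall>i. mod_FM ?y i = t * \<alpha> i" by (intro exI allI)
    qed
    also have "\<dots> \<longleftrightarrow> (\<forall>j<n. c j = mod_FM x (h j) - mod_FM x i0 / \<alpha> i0 * \<alpha> (h j))"
    proof -
      have "mod_FM ?y (h j) = r \<longleftrightarrow> c j = mod_FM x (h j) - r" if "j < n" for j r
        unfolding y_h[OF that] by (auto simp: algebra_simps)
      thus ?thesis by (simp only: cong: imp_cong)
    qed
    finally show ?thesis .
  qed
  show ?thesis
    unfolding quotient_dim_def n_def[symmetric]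
  proof (intro exI[of _ "\<lambda>j. e (h j)"] conjI ballI)
    show "(\<lambda>j. e (h j)) ` {..<n} \<subseteq> M" using hI(1) e_in_M by (simp add: image_subset_iff)
    fix x assume x: "x \<in> M"
    show "\<exists>!c. (\<forall>j\<ge>n. c j = 0) \<and> x - (\<Sum>j<n. teich (c j) \<star> e (h j)) \<in> ?L"
      unfolding mem[OF x]
    proof (rule ex1I)
      let ?c = "\<lambda>j. if j < n then mod_FM x (h j) - mod_FM x i0 / \<alpha> i0 * \<alpha> (h j) else 0"
      show "(\<forall>j\<ge>n. ?c j = 0) \<and> (\<forall>j<n. ?c j = mod_FM x (h j) - mod_FM x i0 / \<alpha> i0 * \<alpha> (h j))" by simp
      fix c assume c: "(\<forall>j\<ge>n. c j = 0) \<and> (\<forall>j<n. c j = mod_FM x (h j) - mod_FM x i0 / \<alpha> i0 * \<alpha> (h j))"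
      show "c = ?c"
      proof
        fix j show "c j = ?c j" using c by (cases "j < n") auto
      qed
    qed
  qed
qed

lemma act_p_injective: "act (of_nat CHAR('k)) x = act (of_nat CHAR('k)) y \<longleftrightarrow> x = y"
proof -
  have "act (of_nat CHAR('k)) z = scale (to_fract (of_nat CHAR('k))) z" for z
    using act_of_witt[of "of_nat CHAR('k)" z] by simp
  moreover have "to_fract (of_nat CHAR('k) :: 'k witt) \<noteq> 0"
    by (simp only: to_fract_eq_0_iff p_witt_nonzero not_False_eq_True)
  ultimately show ?thesis by (simp del: to_fract_of_nat)
qed

lemma act_p_in_image_F: "x \<in> M \<Longrightarrow> act (of_nat CHAR('k)) x \<in> act dF ` M"
  by (rule image_eqI[of _ _ "act dV x"]) (simp_all add: act_act dF_dV M_closed(3))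

text \<open>
  An isogeny from \<open>A\<^sub>1\<^sub>,\<^sub>1\<^sup>g\<close> to \<open>M\<close> followed by multiplication by \<open>p\<close> has its image in \<open>pM \<subseteq> FM \<subseteq> L\<close>.
\<close>

lemma supersingular_first_step:
  assumes \<alpha>: "\<alpha> \<in> homogeneous_coords g"
  shows "supersingular act g (first_step act g M e \<alpha>)"
proof -
  let ?L = "first_step act g M e \<alpha>" and ?p = "of_nat CHAR('k) :: 'k dieud"
  have pL: "act ?p x \<in> ?L" if "x \<in> M" for x
    using act_p_in_image_F[OF that] first_step_closed(3)[OF \<alpha>] by (rule subsetD[rotated])
  obtain \<phi> n where \<phi>: "module_hom_on A11_sum_act (A11_sum g) act M \<phi>" "inj_on \<phi> (A11_sum g)"
    "\<forall>x\<in>M. act (of_nat (CHAR('k) ^ n)) x \<in> \<phi> ` A11_sum g"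
    using supersingular_M unfolding supersingular_def by (elim conjE exE)
  define \<psi> where "\<psi> x = act ?p (\<phi> x)" for x
  have \<phi>M: "\<phi> x \<in> M" if "x \<in> A11_sum g" for x
    using \<phi>(1) that by (simp add: module_hom_on_def image_subset_iff)
  have comm: "act ?p (act r x) = act r (act ?p x)" for r x
    by (simp add: act_act mult_of_nat_commute)
  have "module_hom_on A11_sum_act (A11_sum g) act ?L \<psi>"
    using \<phi>(1) pL by (simp add: module_hom_on_def \<psi>_def image_subset_iff act_add_right comm)
  moreover have "inj_on \<psi> (A11_sum g)"
    using \<phi>(2) by (simp add: inj_on_def \<psi>_def act_p_injective)
  moreover have "act (of_nat (CHAR('k) ^ Suc n)) x \<in> \<psi> ` A11_sum g" if "x \<in> ?L" for x
  proof -
    have "x \<in> M" using that first_step_closed(2)[OF \<alpha>] by (rule subsetD[rotated])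
    then obtain y where y: "y \<in> A11_sum g" "act (of_nat (CHAR('k) ^ n)) x = \<phi> y"
      using bspec[OF \<phi>(3)] by (metis imageE)
    have "act (of_nat (CHAR('k) ^ Suc n)) x = act ?p (act (of_nat (CHAR('k) ^ n)) x)"
      by (simp add: act_act)
    hence "act (of_nat (CHAR('k) ^ Suc n)) x = \<psi> y" by (simp only: y(2) \<psi>_def)
    thus ?thesis using y(1) by (rule image_eqI)
  qed
  ultimately have "\<exists>\<phi>. module_hom_on A11_sum_act (A11_sum g) act ?L \<phi> \<and> inj_on \<phi> (A11_sum g) \<and>
      (\<exists>n. \<forall>x\<in>?L. act (of_nat (CHAR('k) ^ n)) x \<in> \<phi> ` A11_sum g)"
    by (intro exI[of _ \<psi>] exI[of _ "Suc n"] conjI ballI)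
  thus ?thesis
    unfolding supersingular_def dieudonne_module_def
    using first_step_closed(6)[OF \<alpha>] witt_basis_first_step[OF \<alpha>] by (intro conjI)
qed

text \<open>
  Non-degeneracy passes from \<open>M\<close> to \<open>L\<close> because an element orthogonal to \<open>L\<close> is orthogonal to \<open>pM\<close>.
\<close>

lemma quasi_polarised_first_step:
  assumes \<alpha>: "\<alpha> \<in> homogeneous_coords g"
  shows "quasi_polarised act form (first_step act g M e \<alpha>)"
proof -
  let ?L = "first_step act g M e \<alpha>" and ?p = "of_nat CHAR('k) :: 'k dieud"
  have LM: "x \<in> M" if "x \<in> ?L" for x using first_step_closed(2)[OF \<alpha>] that by (rule subsetD)
  have pL: "act ?p x \<in> ?L" if "x \<in> M" for x
    using act_p_in_image_F[OF that] first_step_closed(3)[OF \<alpha>] by (rule subsetD[rotated])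
  note Q = quasi_polarised_M[unfolded quasi_polarised_def]
  show ?thesis
    unfolding quasi_polarised_def
  proof (intro conjI ballI impI)
    fix x assume "x \<in> ?L" thus "form x x = 0" using Q LM by simp
  next
    fix x assume x: "x \<in> ?L" "\<forall>y\<in>?L. form x y = 0"
    have "form x y = 0" if "y \<in> M" for y
    proof -
      have "form x (act ?p y) = to_fract (of_nat CHAR('k)) * form x y"
        using form_wact_right[of x "of_nat CHAR('k)" y] by simp
      moreover have "form x (act ?p y) = 0" using x(2) pL[OF that] by (rule bspec)
      moreover have "to_fract (of_nat CHAR('k) :: 'k witt) \<noteq> 0"
        by (simp only: to_fract_eq_0_iff p_witt_nonzero not_False_eq_True)
      ultimately show ?thesis by (metis mult_eq_0_iff)
    qed
    thus "x = 0" using Q LM[OF x(1)] by simp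
  next
    fix x y assume "x \<in> ?L" "y \<in> ?L"
    thus "form (act dF x) y = frob_fract (form x (act dV y))" by (intro form_polarised LM)
  qed
qed

end

section \<open>The integrality conditions\<close>

lemma dV_dF_commute: "dV * dF = (dF * dV :: 'k::{alg_closed_field, field_prime_char} dieud)"
  by (simp only: dV_dF dF_dV)

lemma p_power_mult_powi:
  fixes p :: "'a::field"
  assumes "p \<noteq> 0"
  shows "p ^ n * p powi (- int (Suc n)) = inverse p"
  unfolding power_int_minus power_int_of_nat using assms by (simp add: field_simps)

lemma to_fract_power: "to_fract (x ^ n) = to_fract x ^ n"
  by (induction n) simp_all

context normal_form
begin

abbreviation integral :: "'k witt fract \<Rightarrow> bool" where
  "integral a \<equiv> a \<in> range to_fract"

lemma integral_to_fract: "integral (to_fract w)"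
  by (rule rangeI)

text \<open>
  The operators in the integrality condition on the first step.
\<close>

definition FV_word :: "nat \<Rightarrow> 'k dieud" where
  "FV_word j = dF ^ (g - 2 - j) * dV ^ j"

lemma FV_word_eq:
  assumes "j \<le> (g - 2) div 2"
  shows "FV_word j = of_nat (CHAR('k) ^ j) * dF ^ (g - 2 - 2 * j)"
proof -
  have "g - 2 - j = (g - 2 - 2 * j) + j" using assms by linarith
  thus ?thesis unfolding FV_word_def using dF_power_mult_dV_power[of "g - 2 - 2 * j" j] by metis
qed

lemma act_FV_word_wact:
  assumes "j \<le> (g - 2) div 2"
  shows "act (FV_word j) (w \<star> x) = (frob ^^ (g - 2 - 2 * j)) w \<star> act (FV_word j) x"
proof -
  have "FV_word j * of_witt w = of_witt ((frob ^^ (g - 2 - 2 * j)) w) * FV_word j"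
  proof -
    let ?N = "CHAR('k) ^ j" and ?w = "(frob ^^ (g - 2 - 2 * j)) w"
    have "FV_word j * of_witt w = of_nat ?N * of_witt ?w * dF ^ (g - 2 - 2 * j)"
      unfolding FV_word_eq[OF assms] by (simp only: mult.assoc dF_power_of_witt)
    also have "of_nat ?N * of_witt ?w = of_witt ?w * of_nat ?N" by (rule mult_of_nat_commute)
    finally show ?thesis unfolding FV_word_eq[OF assms] by (simp only: mult.assoc)
  qed
  thus ?thesis by (simp only: act_act)
qed

lemma FV_word_commute_V: "dV * FV_word j = FV_word j * dV"
proof -
  have "dV * dF ^ n = dF ^ n * (dV :: 'k dieud)" for n
    by (rule power_commuting_commutes[symmetric]) (rule dV_dF_commute[symmetric])
  hence "dV * FV_word j = dF ^ (g - 2 - j) * (dV * dV ^ j)" by (simp only: FV_word_def mult.assoc[symmetric])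
  also have "\<dots> = FV_word j * dV" by (simp only: FV_word_def mult.assoc power_commutes)
  finally show ?thesis .
qed

lemma FV_word_mult_F:
  assumes "j \<le> (g - 2) div 2"
  shows "FV_word j * dF = dF ^ (g - 1 - j) * dV ^ j"
proof -
  have "dV ^ j * dF = dF * (dV ^ j :: 'k dieud)"
    by (rule power_commuting_commutes) (rule dV_dF_commute)
  hence "FV_word j * dF = dF ^ (g - 2 - j) * dF * dV ^ j" by (simp only: FV_word_def mult.assoc)
  moreover have "g - 1 - j = Suc (g - 2 - j)" using assms g2 by linarith
  ultimately show ?thesis by (simp only: power_Suc2)
qed

text \<open>
  The operator \<open>F\<^bsup>g-2-j\<^esup>V\<^sup>j F = F\<^bsup>g-1-j\<^esup>V\<^sup>j\<close> is one of those in the integrality condition on \<open>M\<close>.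
\<close>

lemma form_top_integral:
  assumes "j \<le> (g - 2) div 2" "x \<in> M" "y \<in> M"
  shows "integral (form (act (FV_word j) (act dF x)) y)"
proof -
  have le: "j \<le> (g - 1) div 2" using assms(1) g2 by linarith
  have "act (dF ^ (g - 1 - j) * dV ^ j) ` M \<subseteq> dual scale form M" using FV_words_M le by simp
  hence "act (dF ^ (g - 1 - j) * dV ^ j) x \<in> dual scale form M" using imageI[OF assms(2)] by (rule subsetD)
  thus ?thesis unfolding dual_def using assms(3) by (simp add: act_act FV_word_mult_F[OF assms(1)])
qed

lemma integral_FV_word_left:
  assumes "j \<le> (g - 2) div 2" "x \<in> act dF ` M" "y \<in> M"
  shows "integral (form (act (FV_word j) x) y)"
  using assms(2) by (rule imageE) (simp only: form_top_integral[OF assms(1) _ assms(3)])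

text \<open>
  For \<open>y = F y'\<close> and \<open>u = F\<^bsup>g-2-j\<^esup>V\<^sup>j x\<close>, the pairing \<open>\<langle>F y', u\<rangle>\<close> is the Frobenius of \<open>\<langle>y', V u\<rangle>\<close>.
  Here \<open>V\<close> can be moved to the other end of the word, and \<open>V x\<close> lies in \<open>FM\<close>.
\<close>

lemma integral_FV_word_right:
  assumes j: "j \<le> (g - 2) div 2" and x: "x \<in> M" and y: "y \<in> act dF ` M"
  shows "integral (form (act (FV_word j) x) y)"
proof -
  obtain y' where y': "y = act dF y'" "y' \<in> M" using y by (rule imageE)
  let ?u = "act (FV_word j) x"
  have u: "?u \<in> M" using x by (rule M_closed(3))
  have "act dV x \<in> act dF ` M"
  proof (rule in_image_FV_if_mod_FM_0(1))
    show "act dV x \<in> M" using x by (rule M_closed(3))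
    show "mod_FM (act dV x) i = 0" for i using x by (intro mod_FM_image_FV) simp
  qed
  hence "integral (form (act (FV_word j) (act dV x)) y')" using integral_FV_word_left[OF j] y'(2) by simp
  hence "integral (form (act dV ?u) y')" by (simp only: act_act FV_word_commute_V)
  hence "integral (form y' (act dV ?u))"
    unfolding form_skew[OF y'(2) M_closed(3)[OF u]] by (rule range_to_fract_uminus)
  then obtain w where "form y' (act dV ?u) = to_fract w" by (rule rangeE)
  hence "form (act dF y') ?u = to_fract (frob w)"
    by (simp only: form_polarised[OF y'(2) u] frob_fract_to_fract)
  hence "integral (form y ?u)" unfolding y'(1) by (simp only: integral_to_fract)
  thus ?thesis
    unfolding form_skew[OF u M_closed(3)[OF y'(2)], of dF, folded y'(1)] by (rule range_to_fract_uminus)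
qed

text \<open>
  By semilinearity on the left and linearity on the right, the pairing on \<open>L = W x\<^sub>\<alpha> + FM\<close> is a
  multiple of its value at \<open>(x\<^sub>\<alpha>, x\<^sub>\<alpha>)\<close> plus pairings with one argument in \<open>FM\<close>.
\<close>

lemma FV_word_pairing_integral_iff:
  assumes \<alpha>: "\<alpha> \<in> homogeneous_coords g" and j: "j \<le> (g - 2) div 2"
  defines "L \<equiv> first_step act g M e \<alpha>"
  shows "act (FV_word j) ` L \<subseteq> dual scale form L \<longleftrightarrow> integral (form (act (FV_word j) (lift \<alpha>)) (lift \<alpha>))"
    (is "_ \<longleftrightarrow> ?R")
proof
  have lift: "lift \<alpha> \<in> L" unfolding L_def by (rule first_step_closed(5)[OF \<alpha>])
  {
    assume "act (FV_word j) ` L \<subseteq> dual scale form L"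
    hence "act (FV_word j) (lift \<alpha>) \<in> dual scale form L" using imageI[OF lift] by (rule subsetD)
    thus ?R unfolding dual_def using lift by simp
  next
    assume R: ?R
    have dec: "\<exists>w n. x = w \<star> lift \<alpha> + n \<and> n \<in> act dF ` M" if x_in_L: "x \<in> L" for x
    proof -
      obtain t where x: "x \<in> M" "\<forall>i. mod_FM x i = t * \<alpha> i"
        using x_in_L unfolding L_def first_step_eq[OF \<alpha>] by auto
      have cl: "mod_FM (lift \<alpha>) = \<alpha>" using \<alpha> by (intro mod_FM_lift) (simp add: homogeneous_coords_def)
      have "x - teich t \<star> lift \<alpha> \<in> act dF ` M"
      proof (rule in_image_FV_if_mod_FM_0(1))
        show "x - teich t \<star> lift \<alpha> \<in> M"
          by (intro submodule_diff[OF submodule_M] x(1) M_closed(3) lift_in_M)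
        show "mod_FM (x - teich t \<star> lift \<alpha>) i = 0" for i
          using x by (simp add: mod_FM_diff mod_FM_wact cl lift_in_M M_closed(3))
      qed
      moreover have "x = teich t \<star> lift \<alpha> + (x - teich t \<star> lift \<alpha>)" by simp
      ultimately show ?thesis by (intro exI conjI)
    qed
    have "integral (form (act (FV_word j) x) y)" if xy: "x \<in> L" "y \<in> L" for x y
    proof -
      obtain w n where x: "x = w \<star> lift \<alpha> + n" "n \<in> act dF ` M" using dec[OF xy(1)] by (elim exE conjE)
      obtain v m where y: "y = v \<star> lift \<alpha> + m" "m \<in> act dF ` M" using dec[OF xy(2)] by (elim exE conjE)
      have yM: "y \<in> M" using xy(2) first_step_closed(2)[OF \<alpha>, folded L_def] by (rule subsetD[rotated])
      have wl: "w \<star> lift \<alpha> \<in> M" by (intro M_closed(3) lift_in_M)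
      have "form (act (FV_word j) x) y = form (act (FV_word j) (w \<star> lift \<alpha>)) y + form (act (FV_word j) n) y"
        unfolding x(1) act_add_right form_add_left ..
      moreover have "form (act (FV_word j) (w \<star> lift \<alpha>)) y =
          form (act (FV_word j) (w \<star> lift \<alpha>)) (v \<star> lift \<alpha>) + form (act (FV_word j) (w \<star> lift \<alpha>)) m"
        unfolding y(1) form_add_right ..
      moreover have "form (act (FV_word j) (w \<star> lift \<alpha>)) (v \<star> lift \<alpha>) =
          to_fract ((frob ^^ (g - 2 - 2 * j)) w) * (to_fract v * form (act (FV_word j) (lift \<alpha>)) (lift \<alpha>))"
        by (simp only: act_FV_word_wact[OF j] form_wact_left form_wact_right mult.left_commute)
      moreover have "integral (form (act (FV_word j) n) y)" using j x(2) yM by (rule integral_FV_word_left)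
      moreover have "integral (form (act (FV_word j) (w \<star> lift \<alpha>)) m)" using j wl y(2) by (rule integral_FV_word_right)
      ultimately show ?thesis
        by (simp only: range_to_fract_add range_to_fract_mult integral_to_fract R)
    qed
    moreover have "act (FV_word j) x \<in> module.span scale L" if "x \<in> L" for x
    proof -
      have "act (FV_word j) x \<in> L"
        using first_step_closed(6)[OF \<alpha>, folded L_def] that by (simp add: submodule_def)
      thus ?thesis by (rule span_base)
    qed
    ultimately show "act (FV_word j) ` L \<subseteq> dual scale form L"
      unfolding dual_def by (intro image_subsetI CollectI conjI ballI)
  }
qed

section \<open>The pairing in the normal form basis\<close>

lemma act_F_power_e:
  assumes i: "i \<in> {1..g}"
  shows "act (dF ^ (2 * m)) (e i) = (sign * of_nat CHAR('k)) ^ m \<star> e i"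
    "act (dF ^ Suc (2 * m)) (e i) = (sign * of_nat CHAR('k)) ^ m \<star> f i"
proof -
  let ?q = "sign * of_nat CHAR('k) :: 'k witt"
  have fr: "frob (?q ^ n) = ?q ^ n" for n
    by (simp add: hom_power[OF is_ring_hom_frob] hom_mult[OF is_ring_hom_frob] hom_of_nat[OF is_ring_hom_frob])
  show 1: "act (dF ^ (2 * m)) (e i) = ?q ^ m \<star> e i" for m
  proof (induction m)
    case (Suc m)
    have "act (dF ^ (2 * Suc m)) (e i) = act dF (act dF (act (dF ^ (2 * m)) (e i)))"
      by (simp add: act_act mult.assoc)
    also have "\<dots> = ?q ^ m \<star> ?q \<star> e i"
      by (simp only: Suc act_dF_wact fr act_basis[OF i])
    also have "\<dots> = ?q ^ Suc m \<star> e i" by (simp only: W.scale_scale power_Suc2)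
    finally show ?case .
  qed simp
  have "act (dF ^ Suc (2 * m)) (e i) = act dF (act (dF ^ (2 * m)) (e i))"
    by (simp add: act_act)
  also have "\<dots> = ?q ^ m \<star> f i" by (simp only: 1 act_dF_wact fr act_basis[OF i])
  finally show "act (dF ^ Suc (2 * m)) (e i) = ?q ^ m \<star> f i" .
qed

lemma form_FV_word_lift:
  assumes j: "j \<le> (g - 2) div 2"
  shows "form (act (FV_word j) (lift \<alpha>)) (lift \<alpha>) =
    (\<Sum>i=1..g. \<Sum>k=1..g. to_fract (teich (\<alpha> i ^ (CHAR('k) ^ (g - 2 - 2 * j)) * \<alpha> k)) * form (act (FV_word j) (e i)) (e k))"
  unfolding lift_def act_sum act_FV_word_wact[OF j]
  unfolding form_sum_left unfolding form_sum_right unfolding form_wact_left form_wact_right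
  by (simp add: frob_power_teich teich_mult mult_ac)

lemma p_fract_nonzero: "(of_nat CHAR('k) :: 'k witt fract) \<noteq> 0"
  using to_fract_eq_0_iff[of "of_nat CHAR('k) :: 'k witt"] by (simp del: to_fract_eq_0_iff)

text \<open>
  Here \<open>F\<^sup>c\<close> with \<open>c\<close> odd sends \<open>e\<^sub>i\<close> to \<open>\<plusminus> p\<^bsup>(c-1)/2\<^esup> f\<^sub>i\<close>, which pairs only with \<open>e\<^sub>i\<close>.  The powers
  of \<open>p\<close> add up to \<open>j + (c - 1)/2 - (g - 1)/2 = -1\<close>.
\<close>

lemma form_FV_word_lift_odd:
  assumes odd: "odd g" and j: "j \<le> (g - 2) div 2"
  shows "integral (form (act (FV_word j) (lift \<alpha>)) (lift \<alpha>)) \<longleftrightarrow> (\<Sum>i=1..g. \<alpha> i ^ (CHAR('k) ^ (g - 2 - 2 * j) + 1)) = 0"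
proof -
  let ?p = "of_nat CHAR('k) :: 'k witt" and ?P = "of_nat CHAR('k) :: 'k witt fract"
  let ?q = "CHAR('k) ^ (g - 2 - 2 * j)"
  obtain b where b: "g = 2 * b + 1" using odd by (rule oddE)
  have b1: "1 \<le> b" using g2 b by linarith
  have jb: "j \<le> b - 1" using j b1 by (simp add: b)
  define m where "m = b - 1 - j"
  have c: "g - 2 - 2 * j = Suc (2 * m)" unfolding m_def b using jb b1 by linarith
  have "b = Suc (j + m)" unfolding m_def using jb b1 by linarith
  hence jm: "(int g - 1) div 2 = int (Suc (j + m))" by (simp add: b)
  have De: "act (FV_word j) (e i) = (sign ^ m * ?p ^ (j + m)) \<star> f i" if "i \<in> {1..g}" for i
  proof -
    have "act (FV_word j) (e i) = (?p ^ j) \<star> act (dF ^ Suc (2 * m)) (e i)"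
      unfolding FV_word_eq[OF j] c by (simp add: act_act flip: of_witt_of_nat)
    also have "\<dots> = (?p ^ j * (sign * ?p) ^ m) \<star> f i"
      by (simp only: act_F_power_e(2)[OF that] W.scale_scale)
    also have "?p ^ j * (sign * ?p) ^ m = sign ^ m * ?p ^ (j + m)"
      by (simp add: power_add power_mult_distrib mult_ac)
    finally show ?thesis .
  qed
  have fe: "form (f i) (e k) = (if i = k then - (?P powi (- int (Suc (j + m)))) else 0)"
    if "i \<in> {1..g}" "k \<in> {1..g}" for i k
    using basis odd that unfolding normal_form_basis_def jm by simp
  have val: "form (act (FV_word j) (e i)) (e k) = (if i = k then - to_fract (sign ^ m) / ?P else 0)"
    if "i \<in> {1..g}" "k \<in> {1..g}" for i k
  proof -
    have "form (act (FV_word j) (e i)) (e k) = (if i = k then - (to_fract (sign ^ m) * (?P ^ (j + m) * ?P powi (- int (Suc (j + m))))) else 0)"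
      unfolding De[OF that(1)] form_wact_left fe[OF that] by (simp add: to_fract_power mult.assoc)
    thus ?thesis unfolding p_power_mult_powi[OF p_fract_nonzero] by (simp add: divide_inverse)
  qed
  have "form (act (FV_word j) (lift \<alpha>)) (lift \<alpha>) =
      (\<Sum>i=1..g. \<Sum>k=1..g. if i = k then to_fract (teich (\<alpha> i ^ ?q * \<alpha> i)) * (- to_fract (sign ^ m) / ?P) else 0)"
    unfolding form_FV_word_lift[OF j] by (intro sum.cong refl) (simp add: val)
  also have "\<dots> = (\<Sum>i=1..g. to_fract (teich (\<alpha> i ^ ?q * \<alpha> i)) * (- to_fract (sign ^ m) / ?P))"
    by (intro sum.cong refl) simp
  also have "\<dots> = to_fract (- (sign ^ m) * (\<Sum>i=1..g. teich (\<alpha> i ^ ?q * \<alpha> i))) / ?P"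
    unfolding sum_distrib_right[symmetric] by (simp add: to_fract_sum)
  finally have "integral (form (act (FV_word j) (lift \<alpha>)) (lift \<alpha>)) \<longleftrightarrow>
      residue (- (sign ^ m) * (\<Sum>i=1..g. teich (\<alpha> i ^ ?q * \<alpha> i))) = 0"
    by (simp only: to_fract_div_p_integral_iff)
  also have "\<dots> \<longleftrightarrow> (\<Sum>i=1..g. \<alpha> i ^ (?q + 1)) = 0"
    using odd by (simp add: residue_simps sign_def mult.commute)
  finally show ?thesis .
qed

text \<open>
  Here \<open>F\<^sup>c\<close> with \<open>c\<close> even multiplies \<open>e\<^sub>i\<close> by \<open>p\<^bsup>c/2\<^esup>\<close>, and the form pairs neighbours
  \<open>e\<^sub>i, e\<^sub>i\<^sub>+\<^sub>1\<close> with \<open>i\<close> odd.  The powers of \<open>p\<close> add up to \<open>j + c/2 - g/2 = -1\<close>.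
\<close>

lemma form_FV_word_lift_even:
  assumes even: "even g" and j: "j \<le> (g - 2) div 2"
  shows "integral (form (act (FV_word j) (lift \<alpha>)) (lift \<alpha>)) \<longleftrightarrow>
    (\<Sum>i | i \<in> {1..g} \<and> odd i. \<alpha> i * \<alpha> (i + 1) ^ (CHAR('k) ^ (g - 2 - 2 * j)) -
       \<alpha> (i + 1) * \<alpha> i ^ (CHAR('k) ^ (g - 2 - 2 * j))) = 0"
proof -
  let ?p = "of_nat CHAR('k) :: 'k witt" and ?P = "of_nat CHAR('k) :: 'k witt fract"
  let ?q = "CHAR('k) ^ (g - 2 - 2 * j)"
  let ?O = "{i. i \<in> {1..g} \<and> odd i}"
  obtain b where b: "g = 2 * b" using even by (rule evenE)
  have b1: "1 \<le> b" using g2 b by linarith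
  have jb: "j \<le> b - 1" using j b1 by (simp add: b)
  define m where "m = b - 1 - j"
  have c: "g - 2 - 2 * j = 2 * m" unfolding m_def b using jb b1 by linarith
  have "b = Suc (j + m)" unfolding m_def using jb b1 by linarith
  hence jm: "int g div 2 = int (Suc (j + m))" by (simp add: b)
  have De: "act (FV_word j) (e i) = (?p ^ (j + m)) \<star> e i" if "i \<in> {1..g}" for i
  proof -
    have "act (FV_word j) (e i) = (?p ^ j) \<star> act (dF ^ (2 * m)) (e i)"
      unfolding FV_word_eq[OF j] c by (simp add: act_act flip: of_witt_of_nat)
    also have "\<dots> = (?p ^ j * (sign * ?p) ^ m) \<star> e i"
      by (simp only: act_F_power_e(1)[OF that] W.scale_scale)
    also have "?p ^ j * (sign * ?p) ^ m = ?p ^ (j + m)"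
      using even by (simp add: power_add sign_def)
    finally show ?thesis .
  qed
  have ee: "form (e i) (e k) = (if odd i \<and> k = i + 1 then ?P powi (- int (Suc (j + m)))
      else if odd k \<and> i = k + 1 then - (?P powi (- int (Suc (j + m)))) else 0)"
    if "i \<in> {1..g}" "k \<in> {1..g}" for i k
    using basis even that unfolding normal_form_basis_def jm by simp
  have val: "form (act (FV_word j) (e i)) (e k) = (if odd i \<and> k = i + 1 then inverse ?P
      else if odd k \<and> i = k + 1 then - inverse ?P else 0)"
    if "i \<in> {1..g}" "k \<in> {1..g}" for i k
  proof -
    have "form (act (FV_word j) (e i)) (e k) = (if odd i \<and> k = i + 1 then ?P ^ (j + m) * ?P powi (- int (Suc (j + m)))
        else if odd k \<and> i = k + 1 then - (?P ^ (j + m) * ?P powi (- int (Suc (j + m)))) else 0)"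
      unfolding De[OF that(1)] form_wact_left ee[OF that] by (simp add: to_fract_power)
    thus ?thesis unfolding p_power_mult_powi[OF p_fract_nonzero] .
  qed
  define a where "a i = teich (\<alpha> i ^ ?q)" for i
  define b where "b i = teich (\<alpha> i)" for i
  have step: "(\<Sum>i=1..g. \<Sum>k=1..g. if odd i \<and> k = i + 1 then h i k else 0) = (\<Sum>i\<in>?O. h i (i + 1))"
    for h :: "nat \<Rightarrow> nat \<Rightarrow> 'k witt fract"
  proof -
    have "(\<Sum>i=1..g. \<Sum>k=1..g. if odd i \<and> k = i + 1 then h i k else 0) =
        (\<Sum>i=1..g. if odd i then h i (i + 1) else 0)"
    proof (intro sum.cong refl)
      fix i assume i: "i \<in> {1..g}"
      show "(\<Sum>k=1..g. if odd i \<and> k = i + 1 then h i k else 0) = (if odd i then h i (i + 1) else 0)"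
      proof (cases "odd i")
        case True
        \<comment> \<open>Odd indices have their right neighbour in range.\<close>
        hence "i \<noteq> g" using even by auto
        hence "i + 1 \<in> {1..g}" using i by simp
        thus ?thesis using True by simp
      qed simp
    qed
    also have "\<dots> = (\<Sum>i\<in>?O. h i (i + 1))"
      by (rule sum.inter_filter[symmetric]) simp
    finally show ?thesis .
  qed
  let ?h = "\<lambda>i k. to_fract (a i * b k) * inverse ?P"
  have "form (act (FV_word j) (lift \<alpha>)) (lift \<alpha>) = (\<Sum>i=1..g. \<Sum>k=1..g.
      (if odd i \<and> k = i + 1 then ?h i k else 0) - (if odd k \<and> i = k + 1 then ?h i k else 0))"
    unfolding form_FV_word_lift[OF j] by (intro sum.cong refl) (auto simp: val a_def b_def teich_mult)
  also have "\<dots> = (\<Sum>i=1..g. \<Sum>k=1..g. if odd i \<and> k = i + 1 then ?h i k else 0) -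
      (\<Sum>k=1..g. \<Sum>i=1..g. if odd k \<and> i = k + 1 then ?h i k else 0)"
    by (subst (3) sum.swap) (simp only: sum_subtractf)
  also have "\<dots> = (\<Sum>i\<in>?O. ?h i (i + 1)) - (\<Sum>i\<in>?O. ?h (i + 1) i)"
    unfolding step step[of "\<lambda>k i. ?h i k"] ..
  also have "\<dots> = to_fract (\<Sum>i\<in>?O. a i * b (i + 1) - a (i + 1) * b i) / ?P"
    by (simp add: to_fract_sum divide_inverse sum_subtractf left_diff_distrib flip: sum_distrib_right)
  finally have "integral (form (act (FV_word j) (lift \<alpha>)) (lift \<alpha>)) \<longleftrightarrow>
      residue (\<Sum>i\<in>?O. a i * b (i + 1) - a (i + 1) * b i) = 0"
    by (simp only: to_fract_div_p_integral_iff)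
  also have "residue (\<Sum>i\<in>?O. a i * b (i + 1) - a (i + 1) * b i) =
      - (\<Sum>i\<in>?O. \<alpha> i * \<alpha> (i + 1) ^ ?q - \<alpha> (i + 1) * \<alpha> i ^ ?q)"
    unfolding sum_negf[symmetric]
    by (simp add: residue_simps a_def b_def mult.commute)
  finally show ?thesis by (simp only: neg_equal_0_iff_equal)
qed

section \<open>The fiber\<close>

lemma first_step_in_fiber_iff:
  assumes \<alpha>: "\<alpha> \<in> homogeneous_coords g"
  shows "first_step act g M e \<alpha> \<in> truncation_fiber scale act form g M \<longleftrightarrow>
    (\<forall>j\<le>(g - 2) div 2. integral (form (act (FV_word j) (lift \<alpha>)) (lift \<alpha>)))"
proof -
  note facts = supersingular_first_step[OF \<alpha>] quasi_polarised_first_step[OF \<alpha>]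
    first_step_closed(2,3,4)[OF \<alpha>] quotient_dim_first_step[OF \<alpha>]
  show ?thesis
    unfolding fiber_iff FV_word_def[symmetric]
    using FV_word_pairing_integral_iff[OF \<alpha>] by (simp only: facts simp_thms cong: imp_cong)
qed

text \<open>
  The index \<open>j\<close> of an integrality condition corresponds to the index \<open>j + 1\<close> of an equation.
\<close>

lemma all_le_half_iff: "(\<forall>j\<le>(g - 2) div 2. Q (g - 2 - 2 * j)) \<longleftrightarrow> (\<forall>j\<in>{1..g div 2}. Q (g - 2 * j))"
proof
  assume Q: "\<forall>j\<le>(g - 2) div 2. Q (g - 2 - 2 * j)"
  show "\<forall>j\<in>{1..g div 2}. Q (g - 2 * j)"
  proof
    fix j assume "j \<in> {1..g div 2}"
    hence "j - 1 \<le> (g - 2) div 2" "g - 2 - 2 * (j - 1) = g - 2 * j" by auto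
    thus "Q (g - 2 * j)" using Q by metis
  qed
next
  assume Q: "\<forall>j\<in>{1..g div 2}. Q (g - 2 * j)"
  show "\<forall>j\<le>(g - 2) div 2. Q (g - 2 - 2 * j)"
  proof (intro allI impI)
    fix j assume "j \<le> (g - 2) div 2"
    hence "j + 1 \<in> {1..g div 2}" "g - 2 * (j + 1) = g - 2 - 2 * j" using g2 by auto
    thus "Q (g - 2 - 2 * j)" using Q by metis
  qed
qed

text \<open>
  Points of the projective space are exactly the classes of nonzero tuples with the same first step,
  so the first step defines an injective map on points; it hits the whole fiber by
  \<open>fiber_first_step\<close>.
\<close>

lemma fiber_given_byI:
  assumes E: "\<And>\<alpha>. \<alpha> \<in> homogeneous_coords g \<Longrightarrow>
    first_step act g M e \<alpha> \<in> truncation_fiber scale act form g M \<longleftrightarrow> E \<alpha>"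
  shows "fiber_given_by scale act form g M e E"
proof -
  let ?R = "{(\<alpha>, \<beta>). \<alpha> \<in> homogeneous_coords g \<and> \<beta> \<in> homogeneous_coords g \<and>
    (\<exists>c. c \<noteq> 0 \<and> \<beta> = (\<lambda>i. c * \<alpha> i))} :: ((nat \<Rightarrow> 'k) \<times> (nat \<Rightarrow> 'k)) set"
  let ?S = "first_step act g M e"
  have R: "(\<alpha>, \<beta>) \<in> ?R \<longleftrightarrow> \<alpha> \<in> homogeneous_coords g \<and> \<beta> \<in> homogeneous_coords g \<and> ?S \<alpha> = ?S \<beta>" for \<alpha> \<beta>
    using first_step_eq_iff[of \<alpha> \<beta>] by auto
  have equiv: "equiv (homogeneous_coords g) ?R"
    by (rule equivI) (auto simp: R refl_on_def sym_def trans_def simp del: mem_Collect_eq split_paired_All)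
  have PS: "proj_space g = homogeneous_coords g // ?R" by (simp only: proj_space_def)
  define \<Phi> where "\<Phi> P = ?S (SOME \<alpha>. \<alpha> \<in> P)" for P
  have \<Phi>: "\<Phi> P = ?S \<alpha>" and hom: "\<alpha> \<in> homogeneous_coords g" if "P \<in> proj_space g" "\<alpha> \<in> P" for P \<alpha>
  proof -
    have "(SOME \<alpha>. \<alpha> \<in> P) \<in> P" using that(2) by (rule someI[of "\<lambda>\<alpha>. \<alpha> \<in> P"])
    hence "((SOME \<alpha>. \<alpha> \<in> P), \<alpha>) \<in> ?R"
      using that quotient_eq_iff[OF equiv, of P P] unfolding PS by blast
    thus "\<Phi> P = ?S \<alpha>" "\<alpha> \<in> homogeneous_coords g" unfolding R \<Phi>_def by simp_all
  qed
  have nonempty: "\<exists>\<alpha>. \<alpha> \<in> P" if "P \<in> proj_space g" for P :: "(nat \<Rightarrow> 'k) set"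
    using in_quotient_imp_non_empty[OF equiv that[unfolded PS]] by auto
  have class_in: "?R `` {\<alpha>} \<in> proj_space g" "\<alpha> \<in> ?R `` {\<alpha>}" if "\<alpha> \<in> homogeneous_coords g" for \<alpha>
    unfolding PS using that by (rule quotientI, rule equiv_class_self[OF equiv])
  have fiber: "\<Phi> P \<in> truncation_fiber scale act form g M \<longleftrightarrow> (\<forall>\<alpha>\<in>P. E \<alpha>)" if P: "P \<in> proj_space g" for P
  proof -
    have "\<Phi> P \<in> truncation_fiber scale act form g M \<longleftrightarrow> E \<alpha>" if "\<alpha> \<in> P" for \<alpha>
      unfolding \<Phi>[OF P that] by (rule E) (rule hom[OF P that])
    thus ?thesis using nonempty[OF P] by metis
  qed
  have "bij_betw \<Phi> {P \<in> proj_space g. \<forall>\<alpha>\<in>P. E \<alpha>} (truncation_fiber scale act form g M)"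
    unfolding bij_betw_def
  proof (intro conjI)
    show "inj_on \<Phi> {P \<in> proj_space g. \<forall>\<alpha>\<in>P. E \<alpha>}"
    proof (rule inj_onI)
      fix P P' assume "P \<in> {P \<in> proj_space g. \<forall>\<alpha>\<in>P. E \<alpha>}" "P' \<in> {P \<in> proj_space g. \<forall>\<alpha>\<in>P. E \<alpha>}"
      hence P: "P \<in> proj_space g" "P' \<in> proj_space g" by simp_all
      assume eq: "\<Phi> P = \<Phi> P'"
      obtain \<alpha> \<alpha>' where \<alpha>: "\<alpha> \<in> P" "\<alpha>' \<in> P'" using P nonempty by metis
      have "(\<alpha>, \<alpha>') \<in> ?R"
        unfolding R using eq hom[OF P(1) \<alpha>(1)] hom[OF P(2) \<alpha>(2)] by (simp add: \<Phi>[OF P(1) \<alpha>(1)] \<Phi>[OF P(2) \<alpha>(2)])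
      thus "P = P'" using quotient_eq_iff[OF equiv _ _ \<alpha>] P unfolding PS by simp
    qed
    show "\<Phi> ` {P \<in> proj_space g. \<forall>\<alpha>\<in>P. E \<alpha>} = truncation_fiber scale act form g M"
    proof
      show "\<Phi> ` {P \<in> proj_space g. \<forall>\<alpha>\<in>P. E \<alpha>} \<subseteq> truncation_fiber scale act form g M"
        using fiber by (intro image_subsetI) simp
      show "truncation_fiber scale act form g M \<subseteq> \<Phi> ` {P \<in> proj_space g. \<forall>\<alpha>\<in>P. E \<alpha>}"
      proof
        fix L assume L: "L \<in> truncation_fiber scale act form g M"
        then obtain \<alpha> where \<alpha>: "\<alpha> \<in> homogeneous_coords g" "L = ?S \<alpha>" by (rule fiber_first_step)
        have "L = \<Phi> (?R `` {\<alpha>})" unfolding \<Phi>[OF class_in[OF \<alpha>(1)]] by (rule \<alpha>(2))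
        moreover have "?R `` {\<alpha>} \<in> {P \<in> proj_space g. \<forall>\<alpha>\<in>P. E \<alpha>}"
          using L class_in(1)[OF \<alpha>(1)] fiber[OF class_in(1)[OF \<alpha>(1)]] \<open>L = \<Phi> (?R `` {\<alpha>})\<close> by simp
        ultimately show "L \<in> \<Phi> ` {P \<in> proj_space g. \<forall>\<alpha>\<in>P. E \<alpha>}" by (rule image_eqI)
      qed
    qed
  qed
  thus ?thesis unfolding fiber_given_by_def using \<Phi> by (intro exI[of _ \<Phi>] conjI ballI)
qed

end

theorem theorem4p5:
  fixes scale :: "'k::{alg_closed_field, field_prime_char} witt fract \<Rightarrow> 'v::ab_group_add \<Rightarrow> 'v"
    and act :: "'k dieud \<Rightarrow> 'v \<Rightarrow> 'v"
    and form :: "'v \<Rightarrow> 'v \<Rightarrow> 'k witt fract"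
    and g :: nat and M :: "'v set" and e f :: "nat \<Rightarrow> 'v"
  assumes "rational_dieudonne scale act form"
    and "g \<ge> 2"
    and "truncated_pftq scale act form g (g - 1) (\<lambda>_. M)"
    and "normal_form_basis act form g M e f"
  shows "(odd g \<longrightarrow> fiber_given_by scale act form g M e
      (\<lambda>\<alpha>. \<forall>j\<in>{1..g div 2}. (\<Sum>i=1..g. \<alpha> i ^ (CHAR('k) ^ (g - 2 * j) + 1)) = 0)) \<and>
    (even g \<longrightarrow> fiber_given_by scale act form g M e
      (\<lambda>\<alpha>. \<forall>j\<in>{1..g div 2}. (\<Sum>i | i \<in> {1..g} \<and> odd i.
         \<alpha> i * \<alpha> (i + 1) ^ (CHAR('k) ^ (g - 2 * j)) - \<alpha> (i + 1) * \<alpha> i ^ (CHAR('k) ^ (g - 2 * j))) = 0))"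
proof -
  interpret normal_form scale act form g M e f
    using assms by (intro normal_form.intro normal_form_axioms.intro)
  show ?thesis
  proof (intro conjI impI fiber_given_byI)
    fix \<alpha> :: "nat \<Rightarrow> 'k" assume \<alpha>: "\<alpha> \<in> homogeneous_coords g" and "odd g"
    thus "first_step act g M e \<alpha> \<in> truncation_fiber scale act form g M \<longleftrightarrow>
        (\<forall>j\<in>{1..g div 2}. (\<Sum>i=1..g. \<alpha> i ^ (CHAR('k) ^ (g - 2 * j) + 1)) = 0)"
      unfolding first_step_in_fiber_iff[OF \<alpha>]
        all_le_half_iff[of "\<lambda>n. (\<Sum>i=1..g. \<alpha> i ^ (CHAR('k) ^ n + 1)) = 0", symmetric]
      by (intro all_cong form_FV_word_lift_odd)
  next
    fix \<alpha> :: "nat \<Rightarrow> 'k" assume \<alpha>: "\<alpha> \<in> homogeneous_coords g" and "even g"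
    thus "first_step act g M e \<alpha> \<in> truncation_fiber scale act form g M \<longleftrightarrow>
        (\<forall>j\<in>{1..g div 2}. (\<Sum>i | i \<in> {1..g} \<and> odd i.
         \<alpha> i * \<alpha> (i + 1) ^ (CHAR('k) ^ (g - 2 * j)) - \<alpha> (i + 1) * \<alpha> i ^ (CHAR('k) ^ (g - 2 * j))) = 0)"
      unfolding first_step_in_fiber_iff[OF \<alpha>]
        all_le_half_iff[of "\<lambda>n. (\<Sum>i | i \<in> {1..g} \<and> odd i.
          \<alpha> i * \<alpha> (i + 1) ^ (CHAR('k) ^ n) - \<alpha> (i + 1) * \<alpha> i ^ (CHAR('k) ^ n)) = 0", symmetric]
      by (intro all_cong form_FV_word_lift_even)
  qed
qed

end
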